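(* Let $X$ be a finite multiset of nonzero vectors spanning $\mathbb{R}^n$, let $I\in\mathbb{I}(X)$, and let $\prec$ be a total order on $X$ in which the elements of $I$ come last, i.e. $x\prec y$ for all $x\in X\setminus I$ and $y\in I$. Then for every integer $j\ge 0$, $$\dim(\mathcal{P}_-(X,I)\cap\Pi_j^0)=\#\{B\in\mathbb{B}_-(X,I):\ \mathrm{val}(B)=j\}.$$
   Context: **Polynomials.** $\Pi=\mathbb{C}[t_1,\dots,t_n]$, and $\Pi_j^0$ is its subspace of homogeneous polynomials of degree $j$ (including $0$). For $x\in\mathbb{R}^n$, $p_x(t):=x\cdot t$ (standard inner product). For a finite multiset $Y$ of vectors, $p_Y:=\prod_{y\in Y}p_y$, with $p_\emptyset=1$. **The multiset $X$.** $X$ is a finite multiset of nonzero vectors spanning $\mathbb{R}^n$ (the columns of an $n\times N$ matrix of rank $n$). Repeated vectors are distinct elements of $X$, subsets of $X$ are submultisets, and cardinalities count multiplicities. $\mathbb{B}(X)$ is the collection of subsets of $X$ that are bases of $\mathbb{R}^n$. $\mathbb{I}(X)$ is the collection of all linearly independent subsets of $X$ (including $\emptyset$). For a subspace $S$, $X\setminus S$ is the multiset of elements of $X$ not in $S$. For $b\in X$, $X\setminus b$ is $X$ with the element $b$ removed (once). **The space $\mathcal{P}_-(X,I)$.** For any finite multiset $A$ of nonzero vectors in $\mathbb{R}^n$, $\mathcal{P}(A):=\mathrm{span}\{p_Y:\ Y\subset A,\ \mathrm{rank}(A\setminus Y)=n\}$ (so $\mathcal{P}(A)=0$ if $\mathrm{rank}\,A<n$).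 For $I\in\mathbb{I}(X)$, $\mathcal{P}_-(X,I):=\bigcap_{b\in I}\mathcal{P}(X\setminus b)$, with the convention $\mathcal{P}_-(X,\emptyset)=\mathcal{P}(X)$. **$I$-internal bases.** Let $B\in\mathbb{B}(X)$. An element $b\in B$ is $I$-internally active in $B$ if $b\in I$ and $b$ is the $\prec$-maximal element of $X\setminus\mathrm{span}(B\setminus b)$. $B$ is $I$-internal if no $b\in B$ is $I$-internally active in $B$. $\mathbb{B}_-(X,I)$ is the set of all $I$-internal bases. **Valuation.** For $B\in\mathbb{B}(X)$, $\mathrm{val}(B):=\#\{x\in X\setminus B:\ x\notin\mathrm{span}\{b\in B:\ b\prec x\}\}$. *)

theory Defs
  imports "HOL-Analysis.Analysis" "HOL-Library.Poly_Mapping"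
begin

section \<open>Polynomials in variables indexed by a finite type\<close>

text \<open>The exponent of the variable \<open>t\<^sub>i\<close> in a monomial \<open>m\<close> is \<open>lookup m i\<close>.\<close>

type_synonym 'n cpoly = "('n \<Rightarrow>\<^sub>0 nat) \<Rightarrow>\<^sub>0 complex"

definition cpoly_scale :: "complex \<Rightarrow> 'n cpoly \<Rightarrow> 'n cpoly" where
  "cpoly_scale c p = Poly_Mapping.single 0 c * p"

global_interpretation cpoly: vector_space cpoly_scale
  by unfold_locales
    (simp_all add: cpoly_scale_def distrib_left distrib_right single_add
      mult.assoc [symmetric] mult_single)

definition homogeneous_polys :: "nat \<Rightarrow> 'n::finite cpoly set" where
  "homogeneous_polys j =
     {p. \<forall>m \<in> Poly_Mapping.keys p. (\<Sum>i\<in>UNIV. Poly_Mapping.lookup m i) = j}"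

definition linear_form :: "real ^ 'n \<Rightarrow> 'n::finite cpoly" where
  "linear_form x =
     (\<Sum>i\<in>UNIV. Poly_Mapping.single (Poly_Mapping.single i 1) (complex_of_real (x $ i)))"


section \<open>Multisets of vectors\<close>

text \<open>
  A finite multiset of vectors is a finite index set \<open>X\<close> together with a family
  \<open>v\<close> of vectors; \<open>v\<close> need not be injective, so repeated vectors are distinct
  elements of \<open>X\<close>, and submultisets are subsets of \<open>X\<close>.
\<close>

definition indep_subsets :: "('i \<Rightarrow> real ^ 'n) \<Rightarrow> 'i set \<Rightarrow> 'i set set" where
  "indep_subsets v X = {I. I \<subseteq> X \<and> inj_on v I \<and> independent (v ` I)}"

definition bases :: "('i \<Rightarrow> real ^ 'n) \<Rightarrow> 'i set \<Rightarrow> 'i set set" where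
  "bases v X = {B \<in> indep_subsets v X. span (v ` B) = UNIV}"

definition prod_form :: "('i \<Rightarrow> real ^ 'n) \<Rightarrow> 'i set \<Rightarrow> 'n::finite cpoly" where
  "prod_form v Y = (\<Prod>y\<in>Y. linear_form (v y))"

definition central_space :: "('i \<Rightarrow> real ^ 'n) \<Rightarrow> 'i set \<Rightarrow> 'n::finite cpoly set" where
  "central_space v A =
     cpoly.span {prod_form v Y | Y. Y \<subseteq> A \<and> dim (v ` (A - Y)) = CARD('n)}"

definition semi_internal_space ::
  "('i \<Rightarrow> real ^ 'n) \<Rightarrow> 'i set \<Rightarrow> 'i set \<Rightarrow> 'n::finite cpoly set" where
  "semi_internal_space v X I =
     (if I = {} then central_space v X else (\<Inter>b\<in>I. central_space v (X - {b})))"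


section \<open>Internal activity and valuation\<close>

text \<open>In what follows, \<open>(x, y) \<in> r\<close> means that \<open>x\<close> strictly precedes \<open>y\<close>.\<close>

definition internally_active ::
  "('i \<Rightarrow> real ^ 'n) \<Rightarrow> 'i set \<Rightarrow> ('i \<times> 'i) set \<Rightarrow> 'i set \<Rightarrow> 'i set \<Rightarrow> 'i \<Rightarrow> bool" where
  "internally_active v X r I B b \<longleftrightarrow>
     b \<in> B \<and> b \<in> I \<and>
     (let C = {x \<in> X. v x \<notin> span (v ` (B - {b}))}
      in b \<in> C \<and> (\<forall>x \<in> C - {b}. (x, b) \<in> r))"

definition internal_bases ::
  "('i \<Rightarrow> real ^ 'n) \<Rightarrow> 'i set \<Rightarrow> ('i \<times> 'i) set \<Rightarrow> 'i set \<Rightarrow> 'i set set" where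
  "internal_bases v X r I = {B \<in> bases v X. \<not> (\<exists>b\<in>B. internally_active v X r I B b)}"

definition valuation ::
  "('i \<Rightarrow> real ^ 'n) \<Rightarrow> 'i set \<Rightarrow> ('i \<times> 'i) set \<Rightarrow> 'i set \<Rightarrow> nat" where
  "valuation v X r B = card {x \<in> X - B. v x \<notin> span (v ` {b \<in> B. (b, x) \<in> r})}"

end

theory Submission
  imports Defs "HOL-Library.Function_Algebras" "HOL-Computational_Algebra.Polynomial"
begin

text \<open>Polynomials are treated as functions on real \<open>n\<close>-space, and the semi-internal space is described by
degree bounds. For a hyperplane \<open>H\<close> spanned by elements of \<open>A\<close>, with normal \<open>\<eta>\<close>, let \<open>m(H)\<close> be the
number of elements of \<open>A\<close> outside \<open>H\<close>. Write \<open>K(A, I)\<close> (\<open>kernel_space\<close> below) for the polynomials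
whose degree along every such \<open>\<eta>\<close> is less than \<open>m(H)\<close>, and less than \<open>m(H) - 1\<close> whenever \<open>I\<close> is not
contained in \<open>H\<close>. The generators \<open>p\<^sub>Y\<close> of the central space obviously satisfy the bounds for \<open>I\<close>
empty. Conversely \<open>K(A, {})\<close> is spanned by them (\<open>kernel_space_subset_graded_central\<close>): restrict to
\<open>x\<^sup>\<bottom>\<close> for some \<open>x\<close> in \<open>A\<close>, lift the restriction along the generators, and divide the remainder by
the linear form of \<open>x\<close>. Hence an intersection of central spaces \<open>P(X \ b)\<close> is again given by
degree bounds, and the semi-internal space is \<open>K(X, I)\<close> (\<open>poly_to_fun_semi_internal_space\<close>).

It remains to show that the degree \<open>j\<close> part of \<open>K(A, I)\<close> has the dimension predicted by the
\<open>I\<close>-internal bases of valuation \<open>j\<close>. The induction runs over all sets \<open>I\<close> that come last in the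
order, because contraction preserves this property but not independence.

The upper bound (\<open>dim_kernel_space_upper\<close>) is a deletion-contraction induction along the smallest element
\<open>x\<close>. Restriction to \<open>x\<^sup>\<bottom>\<close> maps \<open>K(A, I)\<close> into the space of the contraction, and its kernel is
contained in \<open>p\<^sub>x\<close> times the space of the deletion. The bases counted satisfy the same recursion: those avoiding
\<open>x\<close> have \<open>x\<close> in their valuation, those containing \<open>x\<close> are bases of the contraction. For \<open>I\<close> empty
the restriction map is onto and the kernel is as large as possible, so equality holds.

For larger \<open>I\<close> the lower bound (\<open>dim_kernel_space_lower\<close>) comes from another map. Let \<open>I\<close> be \<open>J\<close> together with its smallest
element \<open>b\<close>. Passing from \<open>K(A, J)\<close> to \<open>K(A, I)\<close> imposes one new condition for each hyperplane \<open>H\<close>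
that contains \<open>J\<close> but not \<open>b\<close>: the coefficient of degree \<open>m(H) - 1\<close> along the normal of \<open>H\<close> has to
vanish. That coefficient lies in \<open>K(A \<inter> H, J)\<close>, a space whose dimension is bounded by the upper bound
(\<open>top_coeff_kernel_space\<close>). So the dimension drops by at most the number of \<open>J\<close>-internal bases \<open>B'\<close> of
the hyperplanes \<open>H\<close>; and each \<open>B' \<union> {b}\<close> is a \<open>J\<close>-internal basis of \<open>A\<close> in which \<open>b\<close> is active,
so that the number of bases drops by at least as much (\<open>dim_kernel_space_insert\<close>).\<close>

section \<open>Rank and nullity on a subspace\<close>

lemma (in vector_space) span_Int_span_of_partition:
  assumes "independent B" "B0 \<subseteq> B" "x \<in> span B0" "x \<in> span (B - B0)"
  shows "x = 0"
proof -
  have 1: "representation B x = representation B0 x"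
    using assms by (intro representation_extend) auto
  have 2: "representation B x = representation (B - B0) x"
    using assms by (intro representation_extend) auto
  have "representation B x b = 0" for b
    using representation_ne_zero[of B0 x b] representation_ne_zero[of "B - B0" x b] 1 2 by auto
  moreover have "x \<in> span B" using assms span_mono by blast
  ultimately show ?thesis
    using sum_nonzero_representation_eq[OF assms(1)] by force
qed

text \<open>Linearity is demanded on the subspace only, because the leading coefficient of a function along a
line is meaningful for polynomial functions but not for arbitrary ones.\<close>

lemma (in vector_space_pair) rank_nullity_on:
  assumes U: "vs1.subspace U" and fin: "finite S" "U \<subseteq> vs1.span S"
    and add: "\<And>u w. u \<in> U \<Longrightarrow> w \<in> U \<Longrightarrow> L (u + w) = L u + L w"
    and scale: "\<And>c u. u \<in> U \<Longrightarrow> L (s1 c u) = s2 c (L u)"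
  shows "vs1.dim U = vs1.dim {u \<in> U. L u = 0} + vs2.dim (L ` U)"
proof -
  define N where "N = {u \<in> U. L u = 0}"
  obtain B0 where B0: "B0 \<subseteq> N" "vs1.independent B0" "N \<subseteq> vs1.span B0" "card B0 = vs1.dim N"
    using vs1.basis_exists .
  have "B0 \<subseteq> U" using B0 N_def by auto
  then obtain B where B: "B0 \<subseteq> B" "B \<subseteq> U" "vs1.independent B" "U \<subseteq> vs1.span B"
    using vs1.maximal_independent_subset_extend[of B0 U] B0 by metis
  have BS: "finite B"
    using vs1.independent_span_bound[OF fin(1) B(3)] B(2) fin(2) by auto
  have spB: "vs1.span B = U"
    using B U by (intro vs1.span_subspace)
  obtain M where M: "Vector_Spaces.linear s1 s2 M" "\<And>x. x \<in> B \<Longrightarrow> M x = L x"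
    using linear_independent_extend[OF B(3), of L] by auto
  have M_eq: "M x = L x" if "x \<in> U" for x
  proof -
    have "x \<in> U \<and> M x = L x" if "x \<in> vs1.span B" for x
      using that
    proof (induction rule: vs1.span_induct_alt)
      case base
      have "L 0 = 0" using scale[of 0 0] vs1.subspace_0[OF U] by simp
      then show ?case using vs1.subspace_0[OF U] linear_0[OF M(1)] by simp
    next
      case (step c x y)
      then have xU: "x \<in> U" using B by auto
      have "s1 c x \<in> U" using U xU vs1.subspace_scale by blast
      then show ?case using step xU add[of "s1 c x" y] scale[of x c] U M(2)
        by (auto simp: linear_add[OF M(1)] linear_scale[OF M(1)] vs1.subspace_add)
    qed
    then show ?thesis using that spB by auto
  qed
  define C where "C = B - B0"
  have CB: "C \<subseteq> B" "vs1.span C \<subseteq> U" using C_def vs1.span_mono[of C B] spB by auto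
  have inj: "inj_on M (vs1.span C)"
    unfolding linear_inj_on_iff_eq_0[OF M(1) vs1.subspace_span]
  proof (intro ballI impI)
    fix x assume x: "x \<in> vs1.span C" "M x = 0"
    then have "x \<in> N" using CB M_eq N_def by auto
    then show "x = 0"
      using vs1.span_Int_span_of_partition[OF B(3,1)] B0 x C_def by blast
  qed
  have "vs2.independent (M ` C)"
    using linear_independent_injective_image[OF M(1) _ inj] vs1.independent_mono[OF B(3) CB(1)] by auto
  moreover have "M ` C \<subseteq> L ` U"
    using CB B M_eq by (metis image_cong image_mono order_trans vs1.span_superset)
  moreover have "L ` U \<subseteq> vs2.span (M ` C)"
  proof
    fix y assume "y \<in> L ` U"
    then obtain u where u: "u \<in> U" "y = M u" using M_eq by auto
    then have "u \<in> vs1.span (B0 \<union> C)" using spB B(1) C_def by (simp add: Un_absorb1)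
    then obtain a c where ac: "u = a + c" "a \<in> vs1.span B0" "c \<in> vs1.span C"
      unfolding vs1.span_Un by auto
    have "M b = 0" if "b \<in> B0" for b using that B0 N_def M_eq by auto
    then have "M a = 0" using linear_eq_0_on_span[OF M(1) _ ac(2)] by auto
    then have "y = M c" using u ac linear_add[OF M(1)] by simp
    then show "y \<in> vs2.span (M ` C)" using ac linear_span_image[OF M(1)] by auto
  qed
  ultimately have "vs2.dim (L ` U) = card (M ` C)"
    using vs2.dim_unique by metis
  also have "\<dots> = card C"
    by (meson card_image inj inj_on_subset vs1.span_superset)
  also have "\<dots> + card B0 = card B"
    using BS B(1) C_def by (simp add: card_Diff_subset card_mono finite_subset)
  finally show ?thesis
    using B0(4) vs1.basis_card_eq_dim[OF B(2,4,3)] N_def by simp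
qed

lemma (in vector_space) dim_mono_in_finite_span:
  assumes "U \<subseteq> V" "V \<subseteq> span S" "finite S"
  shows "dim U \<le> dim V"
proof -
  obtain B where B: "B \<subseteq> V" "independent B" "V \<subseteq> span B" "card B = dim V"
    using basis_exists .
  have "finite B" using independent_span_bound[OF assms(3) B(2)] B(1) assms(2) by auto
  then show ?thesis using dim_le_card[of U B] B assms by auto
qed

text \<open>The conditions are imposed one at a time; each costs at most its rank on the subspace that is left.\<close>

lemma (in vector_space_pair) dim_le_common_kernel_plus_ranks:
  assumes "finite F" and U: "vs1.subspace U" and fin: "finite S" "U \<subseteq> vs1.span S"
    and "\<And>h u w. h \<in> F \<Longrightarrow> u \<in> U \<Longrightarrow> w \<in> U \<Longrightarrow> L h (u + w) = L h u + L h w"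
    and "\<And>h c u. h \<in> F \<Longrightarrow> u \<in> U \<Longrightarrow> L h (s1 c u) = s2 c (L h u)"
    and rank: "\<And>h. h \<in> F \<Longrightarrow> L h ` U \<subseteq> V h \<and> vs2.dim (V h) \<le> k h \<and> 
        (\<exists>T. finite T \<and> V h \<subseteq> vs2.span T)"
  shows "vs1.dim U \<le> vs1.dim {u \<in> U. \<forall>h\<in>F. L h u = 0} + (\<Sum>h\<in>F. k h)"
  using assms(1,5-)
proof (induction F rule: finite_induct)
  case empty
  then show ?case by simp
next
  case (insert h F)
  define U' where "U' = {u \<in> U. \<forall>h\<in>F. L h u = 0}"
  have z: "L g 0 = 0" if "g \<in> insert h F" for g
    using insert.prems(2)[OF that, of 0 0] vs1.subspace_0[OF U] by simp
  have sU': "vs1.subspace U'"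
    unfolding U'_def
  proof (rule vs1.subspaceI)
    show "0 \<in> {u \<in> U. \<forall>h\<in>F. L h u = 0}" using z vs1.subspace_0[OF U] by auto
  next
    fix x y assume "x \<in> {u \<in> U. \<forall>h\<in>F. L h u = 0}" "y \<in> {u \<in> U. \<forall>h\<in>F. L h u = 0}"
    then show "x + y \<in> {u \<in> U. \<forall>h\<in>F. L h u = 0}"
      using insert.prems(1) vs1.subspace_add[OF U] by auto
  next
    fix c x assume "x \<in> {u \<in> U. \<forall>h\<in>F. L h u = 0}"
    then show "s1 c x \<in> {u \<in> U. \<forall>h\<in>F. L h u = 0}"
      using insert.prems(2) vs1.subspace_scale[OF U] by auto
  qed
  have "vs1.dim U' = vs1.dim {u \<in> U'. L h u = 0} + vs2.dim (L h ` U')"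
    by (rule rank_nullity_on[OF sU' fin(1)]) (use fin insert.prems U'_def in auto)
  moreover have "vs2.dim (L h ` U') \<le> k h"
  proof -
    obtain T where "finite T" "V h \<subseteq> vs2.span T" using insert.prems(3)[of h] by auto
    moreover have "L h ` U' \<subseteq> V h" using insert.prems(3)[of h] U'_def by auto
    ultimately show ?thesis
      using vs2.dim_mono_in_finite_span[of "L h ` U'" "V h" T] insert.prems(3)[of h] by auto
  qed
  moreover have "{u \<in> U'. L h u = 0} = {u \<in> U. \<forall>h\<in>insert h F. L h u = 0}"
    by (auto simp: U'_def)
  moreover have "vs1.dim U \<le> vs1.dim U' + (\<Sum>h\<in>F. k h)"
    unfolding U'_def using insert by auto
  ultimately show ?case using insert.hyps by simp
qed

section \<open>Polynomial functions on a subspace\<close>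

definition fun_scale :: "complex \<Rightarrow> ('a \<Rightarrow> complex) \<Rightarrow> 'a \<Rightarrow> complex" where
  "fun_scale c f = (\<lambda>t. c * f t)"

global_interpretation fn: vector_space fun_scale
  by unfold_locales (auto simp: fun_scale_def fun_eq_iff algebra_simps)

interpretation fn_pair: vector_space_pair fun_scale fun_scale
  by unfold_locales

lemma sum_fun_at: "(\<Sum>x\<in>A. f x) t = (\<Sum>x\<in>A. f x t)" for f :: "'b \<Rightarrow> 'a \<Rightarrow> complex"
  by (induction A rule: infinite_finite_induct) auto

inductive_set polyfun :: "('a::euclidean_space \<Rightarrow> complex) set" where
  const: "(\<lambda>_. c) \<in> polyfun"
| lin: "(\<lambda>t. complex_of_real (x \<bullet> t)) \<in> polyfun"
| add: "f \<in> polyfun \<Longrightarrow> g \<in> polyfun \<Longrightarrow> (\<lambda>t. f t + g t) \<in> polyfun"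
| mult: "f \<in> polyfun \<Longrightarrow> g \<in> polyfun \<Longrightarrow> (\<lambda>t. f t * g t) \<in> polyfun"

lemma polyfun_sum: "(\<And>i. i \<in> A \<Longrightarrow> f i \<in> polyfun) \<Longrightarrow> (\<lambda>t. \<Sum>i\<in>A. f i t) \<in> polyfun"
  by (induction A rule: infinite_finite_induct) (auto intro: polyfun.intros)

lemma polyfun_prod: "(\<And>i. i \<in> A \<Longrightarrow> f i \<in> polyfun) \<Longrightarrow> (\<lambda>t. \<Prod>i\<in>A. f i t) \<in> polyfun"
  by (induction A rule: infinite_finite_induct) (auto intro: polyfun.intros)

text \<open>The restrictions of \<open>f\<close> to all lines parallel to \<open>\<eta>\<close> are univariate polynomials whose coefficients
are again polynomial functions of the base point. Statements about directional degree that hold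
off a hyperplane thereby extend to the whole space.\<close>

lemma polyfun_line:
  assumes "f \<in> polyfun"
  shows "\<exists>P. (\<forall>i. (\<lambda>t. coeff (P t) i) \<in> polyfun) \<and>
    (\<forall>t s. f (t + s *\<^sub>R \<eta>) = poly (P t) (complex_of_real s))"
  using assms
proof (induction rule: polyfun.induct)
  case (const c)
  show ?case
    by (rule exI[of _ "\<lambda>_. [:c:]"]) (auto intro: polyfun.intros)
next
  case (lin x)
  have "(\<lambda>t. coeff [:complex_of_real (x \<bullet> t), complex_of_real (x \<bullet> \<eta>):] i) \<in> polyfun" for i
    by (cases i rule: nat.exhaust; cases "i = 1") (auto intro: polyfun.intros simp: coeff_pCons split: nat.splits)
  then show ?case
    by (intro exI[of _ "\<lambda>t. [:complex_of_real (x \<bullet> t), complex_of_real (x \<bullet> \<eta>):]"])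
       (auto simp: inner_add_right)
next
  case (add f g)
  then obtain P Q where P: "\<And>i. (\<lambda>t. coeff (P t) i) \<in> polyfun"
      "\<And>t s. f (t + s *\<^sub>R \<eta>) = poly (P t) (complex_of_real s)"
    and Q: "\<And>i. (\<lambda>t. coeff (Q t) i) \<in> polyfun"
      "\<And>t s. g (t + s *\<^sub>R \<eta>) = poly (Q t) (complex_of_real s)" by metis
  show ?case
    by (rule exI[of _ "\<lambda>t. P t + Q t"]) (auto simp: P Q intro: polyfun.add)
next
  case (mult f g)
  then obtain P Q where P: "\<And>i. (\<lambda>t. coeff (P t) i) \<in> polyfun"
      "\<And>t s. f (t + s *\<^sub>R \<eta>) = poly (P t) (complex_of_real s)"
    and Q: "\<And>i. (\<lambda>t. coeff (Q t) i) \<in> polyfun"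
      "\<And>t s. g (t + s *\<^sub>R \<eta>) = poly (Q t) (complex_of_real s)" by metis
  show ?case
    by (rule exI[of _ "\<lambda>t. P t * Q t"]) (auto simp: P Q coeff_mult intro!: polyfun.mult polyfun_sum)
qed

lemma poly_zero_off_finite:
  assumes "\<And>s::real. s \<notin> Z \<Longrightarrow> poly p (complex_of_real s) = 0" "finite Z"
  shows "p = 0"
proof (rule ccontr)
  assume "p \<noteq> 0"
  then have "finite {z. poly p z = 0}" by (rule poly_roots_finite)
  moreover have "complex_of_real ` (- Z) \<subseteq> {z. poly p z = 0}" using assms by auto
  ultimately have "finite (complex_of_real ` (- Z))" using finite_subset by blast
  then have "finite (- Z)" by (rule finite_imageD) (auto simp: inj_on_def)
  then have "finite (UNIV :: real set)" using assms(2) finite_compl by blast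
  then show False using infinite_UNIV_char_0 by auto
qed

lemma line_poly_unique:
  assumes "\<And>s::real. poly p (complex_of_real s) = poly q (complex_of_real s)"
  shows "p = q"
  using poly_zero_off_finite[of "{}" "p - q"] assms by auto

lemma polyfun_vanish_off_hyperplane:
  fixes x :: "'a::euclidean_space"
  assumes "f \<in> polyfun" "subspace W" "w \<in> W" "x \<bullet> w \<noteq> 0"
    and "\<And>t. t \<in> W \<Longrightarrow> x \<bullet> t \<noteq> 0 \<Longrightarrow> f t = 0" and "t \<in> W"
  shows "f t = 0"
proof (cases "x \<bullet> t = 0")
  case True
  obtain P where P: "\<And>t s. f (t + s *\<^sub>R w) = poly (P t) (complex_of_real s)"
    using polyfun_line[OF assms(1), of w] by auto
  have "poly (P t) (complex_of_real s) = 0" if "s \<notin> {0}" for s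
    unfolding P[symmetric]
    using that assms True by (intro assms(5)) (auto simp: inner_add_right subspace_add subspace_scale)
  then have "P t = 0" using poly_zero_off_finite[of "{0}" "P t"] by auto
  then show ?thesis using P[of t 0] by simp
qed (use assms in auto)

lemma polyfun_shear:
  assumes "f \<in> polyfun"
  shows "(\<lambda>t. f (t - (x \<bullet> t) *\<^sub>R w)) \<in> polyfun"
  using assms
proof (induction rule: polyfun.induct)
  case (lin y)
  have "(\<lambda>t. complex_of_real (y \<bullet> (t - (x \<bullet> t) *\<^sub>R w))) = 
      (\<lambda>t. complex_of_real ((y - (y \<bullet> w) *\<^sub>R x) \<bullet> t))"
    by (auto simp: inner_diff_left inner_diff_right mult.commute)
  then show ?case using polyfun.lin by metis
qed (auto intro: polyfun.intros)

lemma polyfun_dilate: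
  assumes "f \<in> polyfun"
  shows "(\<lambda>t. f (c *\<^sub>R t)) \<in> polyfun"
  using assms
proof (induction rule: polyfun.induct)
  case (lin y)
  then show ?case using polyfun.lin[of "c *\<^sub>R y"] by simp
qed (auto intro: polyfun.intros)

text \<open>The argument \<open>t - (x \<bullet> t) w\<close> is the projection of \<open>t\<close> along \<open>w\<close> to \<open>x\<^sup>\<bottom>\<close> when \<open>x \<bullet> w = 1\<close>; a polynomial
function that vanishes on \<open>x\<^sup>\<bottom>\<close> is therefore divisible by the linear form of \<open>x\<close>.\<close>

lemma polyfun_divide:
  assumes "f \<in> polyfun"
  shows "\<exists>q\<in>polyfun. \<forall>t. f t - f (t - (x \<bullet> t) *\<^sub>R w) = complex_of_real (x \<bullet> t) * q t"
  using assms
proof (induction rule: polyfun.induct)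
  case (const c)
  show ?case by (rule bexI[of _ "\<lambda>_. 0"]) (auto intro: polyfun.const)
next
  case (lin y)
  show ?case
    by (rule bexI[of _ "\<lambda>_. complex_of_real (y \<bullet> w)"])
       (auto intro: polyfun.const simp: inner_diff_right algebra_simps)
next
  case (add f g)
  then obtain q r where "q \<in> polyfun" "\<And>t. f t - f (t - (x \<bullet> t) *\<^sub>R w) = complex_of_real (x \<bullet> t) * q t"
    "r \<in> polyfun" "\<And>t. g t - g (t - (x \<bullet> t) *\<^sub>R w) = complex_of_real (x \<bullet> t) * r t" by metis
  then have "f t + g t - (f (t - (x \<bullet> t) *\<^sub>R w) + g (t - (x \<bullet> t) *\<^sub>R w))
      = complex_of_real (x \<bullet> t) * (q t + r t)" for t
    by (metis add_diff_add distrib_left)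
  then show ?case
    by (intro bexI[of _ "\<lambda>t. q t + r t"] allI) (use \<open>q \<in> polyfun\<close> \<open>r \<in> polyfun\<close> in \<open>auto intro: polyfun.add\<close>)
next
  case (mult f g)
  from mult.IH(1) obtain q where q: "q \<in> polyfun" 
    "\<forall>t. f t - f (t - (x \<bullet> t) *\<^sub>R w) = complex_of_real (x \<bullet> t) * q t" by (rule bexE)
  from mult.IH(2) obtain r where r: "r \<in> polyfun" 
    "\<forall>t. g t - g (t - (x \<bullet> t) *\<^sub>R w) = complex_of_real (x \<bullet> t) * r t" by (rule bexE)
  have "f t * g t - f (t - (x \<bullet> t) *\<^sub>R w) * g (t - (x \<bullet> t) *\<^sub>R w)
      = (f t - f (t - (x \<bullet> t) *\<^sub>R w)) * g t + f (t - (x \<bullet> t) *\<^sub>R w) * (g t - g (t - (x \<bullet> t) *\<^sub>R w))" for t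
    by (simp add: algebra_simps)
  then have "f t * g t - f (t - (x \<bullet> t) *\<^sub>R w) * g (t - (x \<bullet> t) *\<^sub>R w)
      = complex_of_real (x \<bullet> t) * (q t * g t + f (t - (x \<bullet> t) *\<^sub>R w) * r t)" for t
    using q(2)[rule_format, of t] r(2)[rule_format, of t] by (simp only: distrib_left mult.assoc mult.left_commute)
  moreover have "(\<lambda>t. q t * g t + f (t - (x \<bullet> t) *\<^sub>R w) * r t) \<in> polyfun"
    using q(1) r(1) mult.hyps polyfun_shear by (intro polyfun.add polyfun.mult)
  ultimately show ?case
    by (intro bexI[of _ "\<lambda>t. q t * g t + f (t - (x \<bullet> t) *\<^sub>R w) * r t"] allI)
qed

text \<open>Functions on a subspace \<open>W\<close> are extended by zero, so that functions on different subspaces share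
one type and two polynomial functions on \<open>W\<close> are equal as soon as they agree on \<open>W\<close>.\<close>

definition restrict_to :: "'a set \<Rightarrow> ('a \<Rightarrow> complex) \<Rightarrow> 'a \<Rightarrow> complex" where
  "restrict_to W f = (\<lambda>t. if t \<in> W then f t else 0)"

lemma restrict_to_in [simp]: "t \<in> W \<Longrightarrow> restrict_to W f t = f t" by (simp add: restrict_to_def)

definition polyfun_on :: "'a::euclidean_space set \<Rightarrow> ('a \<Rightarrow> complex) set" where
  "polyfun_on W = restrict_to W ` polyfun"

lemma polyfun_on_zero: "f \<in> polyfun_on W \<Longrightarrow> t \<notin> W \<Longrightarrow> f t = 0"
  by (auto simp: polyfun_on_def restrict_to_def)

lemma subspace_polyfun_on: "fn.subspace (polyfun_on W)"
proof (rule fn.subspaceI)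
  show "0 \<in> polyfun_on W"
    using polyfun.const[of 0] by (force simp: polyfun_on_def restrict_to_def)
next
  fix f g :: "'a \<Rightarrow> complex" assume "f \<in> polyfun_on W" "g \<in> polyfun_on W"
  then obtain f' g' where f': "f' \<in> polyfun" "f = restrict_to W f'" "g' \<in> polyfun" "g = restrict_to W g'" 
    by (auto simp: polyfun_on_def)
  then have "f + g = restrict_to W (\<lambda>t. f' t + g' t)" by (auto simp: restrict_to_def)
  then show "f + g \<in> polyfun_on W" using f' polyfun.add unfolding polyfun_on_def by blast
next
  fix c and f :: "'a \<Rightarrow> complex" assume "f \<in> polyfun_on W"
  then obtain f' where f': "f' \<in> polyfun" "f = restrict_to W f'" by (auto simp: polyfun_on_def)
  then have "fun_scale c f = restrict_to W (\<lambda>t. c * f' t)" by (auto simp: restrict_to_def fun_scale_def)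
  then show "fun_scale c f \<in> polyfun_on W" using f' polyfun.mult[OF polyfun.const] unfolding polyfun_on_def by blast
qed

lemma restrict_to_polyfun_on: "f \<in> polyfun_on W \<Longrightarrow> W' \<subseteq> W \<Longrightarrow> restrict_to W' f \<in> polyfun_on W'"
proof -
  assume "f \<in> polyfun_on W" "W' \<subseteq> W"
  then obtain f' where "f' \<in> polyfun" "f = restrict_to W f'" by (auto simp: polyfun_on_def)
  then have "restrict_to W' f = restrict_to W' f'" using \<open>W' \<subseteq> W\<close> by (auto simp: restrict_to_def fun_eq_iff)
  then show ?thesis using \<open>f' \<in> polyfun\<close> by (auto simp: polyfun_on_def)
qed

lemma polyfun_on_line:
  assumes "f \<in> polyfun_on W" "subspace W" "\<eta> \<in> W"
  shows "\<exists>P. \<forall>t\<in>W. \<forall>s. f (t + s *\<^sub>R \<eta>) = poly (P t) (complex_of_real s)"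
proof -
  obtain f' where f': "f' \<in> polyfun" "f = restrict_to W f'" using assms by (auto simp: polyfun_on_def)
  then obtain P where "\<And>t s. f' (t + s *\<^sub>R \<eta>) = poly (P t) (complex_of_real s)"
    using polyfun_line by metis
  then show ?thesis using f' assms 
    by (intro exI[of _ P]) (auto simp: subspace_add subspace_scale)
qed

section \<open>Degree along a direction\<close>

text \<open>For \<open>m = 0\<close> the condition says that \<open>f\<close> vanishes on \<open>W\<close>; truncated subtraction produces this case
in the degree bounds below.\<close>

definition dir_degree_less :: "'a::euclidean_space set \<Rightarrow> 'a \<Rightarrow> nat \<Rightarrow> ('a \<Rightarrow> complex) \<Rightarrow> bool" where
  "dir_degree_less W \<eta> m f \<longleftrightarrow> (\<forall>t\<in>W. \<exists>q. (\<forall>i\<ge>m. coeff q i = 0) \<and>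
     (\<forall>s. f (t + s *\<^sub>R \<eta>) = poly q (complex_of_real s)))"

lemma dir_degree_lessD:
  assumes "dir_degree_less W \<eta> m f" "t \<in> W" "\<And>s. f (t + s *\<^sub>R \<eta>) = poly q (complex_of_real s)" "i \<ge> m"
  shows "coeff q i = 0"
proof -
  obtain q' where q': "\<And>i. i \<ge> m \<Longrightarrow> coeff q' i = 0" "\<And>s. f (t + s *\<^sub>R \<eta>) = poly q' (complex_of_real s)"
    using assms unfolding dir_degree_less_def by blast
  then have "q' = q" using assms(3) line_poly_unique by metis
  then show ?thesis using q' assms by auto
qed

lemma dir_degree_less_mono: 
  assumes "dir_degree_less W \<eta> m f" "m \<le> k" shows "dir_degree_less W \<eta> k f"
  unfolding dir_degree_less_def
proof
  fix t assume "t \<in> W"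
  then obtain q where "\<forall>i\<ge>m. coeff q i = 0" "\<forall>s. f (t + s *\<^sub>R \<eta>) = poly q (complex_of_real s)"
    using assms unfolding dir_degree_less_def by metis
  then show "\<exists>q. (\<forall>i\<ge>k. coeff q i = 0) \<and> (\<forall>s. f (t + s *\<^sub>R \<eta>) = poly q (complex_of_real s))"
    using assms(2) by (intro exI[of _ q]) auto
qed

lemma dir_degree_less_0D: 
  assumes "dir_degree_less W \<eta> 0 f" "t \<in> W" shows "f t = 0"
proof -
  obtain q where q: "\<forall>i\<ge>0. coeff q i = 0" "\<forall>s. f (t + s *\<^sub>R \<eta>) = poly q (complex_of_real s)"
    using assms unfolding dir_degree_less_def by metis
  have "q = 0" by (rule poly_eqI) (simp add: q(1))
  then show ?thesis using q(2)[rule_format, of 0] by simp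
qed

lemma dir_degree_less_zero [simp]: "dir_degree_less W \<eta> m (\<lambda>_. 0)" "dir_degree_less W \<eta> m 0"
  unfolding dir_degree_less_def by (auto intro!: exI[of _ 0])

lemma dir_degree_less_add:
  assumes "dir_degree_less W \<eta> m f" "dir_degree_less W \<eta> m g" shows "dir_degree_less W \<eta> m (f + g)"
  unfolding dir_degree_less_def
proof
  fix t assume "t \<in> W"
  then obtain p q where "\<forall>i\<ge>m. coeff q i = 0" "\<forall>s. f (t + s *\<^sub>R \<eta>) = poly q (complex_of_real s)"
    "\<forall>i\<ge>m. coeff p i = 0" "\<forall>s. g (t + s *\<^sub>R \<eta>) = poly p (complex_of_real s)"
    using assms unfolding dir_degree_less_def by metis
  then show "\<exists>q. (\<forall>i\<ge>m. coeff q i = 0) \<and> (\<forall>s. (f + g) (t + s *\<^sub>R \<eta>) = poly q (complex_of_real s))"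
    by (intro exI[of _ "q + p"]) auto
qed

lemma dir_degree_less_scale:
  assumes "dir_degree_less W \<eta> m f" shows "dir_degree_less W \<eta> m (fun_scale c f)"
  unfolding dir_degree_less_def
proof
  fix t assume "t \<in> W"
  then obtain q where "\<forall>i\<ge>m. coeff q i = 0" "\<forall>s. f (t + s *\<^sub>R \<eta>) = poly q (complex_of_real s)"
    using assms unfolding dir_degree_less_def by metis
  then show "\<exists>q. (\<forall>i\<ge>m. coeff q i = 0) \<and> (\<forall>s. fun_scale c f (t + s *\<^sub>R \<eta>) = poly q (complex_of_real s))"
    by (intro exI[of _ "smult c q"]) (auto simp: fun_scale_def)
qed

lemma subspace_dir_degree_less: "fn.subspace {f. dir_degree_less W \<eta> m f}"
  by (rule fn.subspaceI) (auto intro: dir_degree_less_add dir_degree_less_scale)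

lemma dir_degree_less_scaled_direction:
  assumes "dir_degree_less W \<eta> m f" shows "dir_degree_less W (c *\<^sub>R \<eta>) m f"
  unfolding dir_degree_less_def
proof
  fix t assume "t \<in> W"
  then obtain q where q: "\<forall>i\<ge>m. coeff q i = 0" "\<forall>s. f (t + s *\<^sub>R \<eta>) = poly q (complex_of_real s)"
    using assms unfolding dir_degree_less_def by metis
  have "f (t + s *\<^sub>R (c *\<^sub>R \<eta>)) = poly (q \<circ>\<^sub>p [:0, complex_of_real c:]) (complex_of_real s)" for s
    using q(2)[rule_format, of "s * c"] by (simp add: poly_pcompose mult.commute)
  then show "\<exists>q. (\<forall>i\<ge>m. coeff q i = 0) \<and> (\<forall>s. f (t + s *\<^sub>R (c *\<^sub>R \<eta>)) = poly q (complex_of_real s))"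
    using q(1) by (intro exI[of _ "q \<circ>\<^sub>p [:0, complex_of_real c:]"]) (auto simp: coeff_pcompose_linear)
qed

text \<open>On a line along which the linear form is not constant, degrees add. On the other lines the form is a
constant, possibly zero; the lines where it is zero are covered because the coefficients are
polynomial functions of the base point.\<close>

lemma dir_degree_less_cancel_linear_factor:
  fixes x :: "'a::euclidean_space"
  assumes W: "subspace W" "\<eta> \<in> W" "w \<in> W" "x \<bullet> w \<noteq> 0" and q: "q \<in> polyfun_on W"
    and d: "dir_degree_less W \<eta> m (\<lambda>t. complex_of_real (x \<bullet> t) * q t)"
  shows "dir_degree_less W \<eta> (m - (if x \<bullet> \<eta> = 0 then 0 else 1)) q"
proof -
  obtain f where f: "f \<in> polyfun" "q = restrict_to W f" using q by (auto simp: polyfun_on_def)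
  obtain P where P: "\<And>i. (\<lambda>t. coeff (P t) i) \<in> polyfun"
      "\<And>t s. f (t + s *\<^sub>R \<eta>) = poly (P t) (complex_of_real s)"
    using polyfun_line[OF f(1)] by metis
  have qP: "q (t + s *\<^sub>R \<eta>) = poly (P t) (complex_of_real s)" if "t \<in> W" for t s
    using that W f P by (auto simp: subspace_add subspace_scale)
  define Q where "Q t = [:complex_of_real (x \<bullet> t), complex_of_real (x \<bullet> \<eta>):] * P t" for t
  have z: "coeff (Q t) i = 0" if "t \<in> W" "i \<ge> m" for t i
    by (rule dir_degree_lessD[OF d that(1) _ that(2)])
       (simp add: qP that Q_def inner_add_right algebra_simps)
  have "coeff (P t) i = 0" if t: "t \<in> W" and i: "i \<ge> m - (if x \<bullet> \<eta> = 0 then 0 else 1)" for t i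
  proof (cases "x \<bullet> \<eta> = 0")
    case True
    then have i: "i \<ge> m" using i by simp
    show ?thesis
    proof (rule polyfun_vanish_off_hyperplane[OF P(1) W(1,3,4) _ t])
      fix t assume "t \<in> W" "x \<bullet> t \<noteq> 0"
      then show "coeff (P t) i = 0" using z[OF _ i, of t] True by (simp add: Q_def)
    qed
  next
    case False
    show ?thesis
    proof (rule ccontr)
      assume ne: "coeff (P t) i \<noteq> 0"
      then have "P t \<noteq> 0" and "i \<le> degree (P t)" using le_degree by auto
      have l: "[:complex_of_real (x \<bullet> t), complex_of_real (x \<bullet> \<eta>):] \<noteq> 0"
        "degree [:complex_of_real (x \<bullet> t), complex_of_real (x \<bullet> \<eta>):] = 1" using False by auto
      have "Q t \<noteq> 0" "degree (Q t) = 1 + degree (P t)"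
        unfolding Q_def using \<open>P t \<noteq> 0\<close> l
        by (metis no_zero_divisors, metis degree_mult_eq)
      then have "coeff (Q t) (1 + degree (P t)) \<noteq> 0"
        using leading_coeff_0_iff by metis
      moreover have "1 + degree (P t) \<ge> m" using \<open>i \<le> degree (P t)\<close> i False by auto
      ultimately show False using z t by blast
    qed
  qed
  then show ?thesis unfolding dir_degree_less_def using qP by metis
qed

text \<open>Dilation by zero is excluded, so that no separate argument about the origin is needed when a
homogeneous function is divided by a linear form.\<close>

definition homogeneous_funs :: "nat \<Rightarrow> ('a::euclidean_space \<Rightarrow> complex) set" where
  "homogeneous_funs j = {f. \<forall>t c. c \<noteq> 0 \<longrightarrow> f (c *\<^sub>R t) = complex_of_real c ^ j * f t}"

lemma subspace_homogeneous_funs: "fn.subspace (homogeneous_funs j)"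
  by (rule fn.subspaceI) (auto simp: homogeneous_funs_def fun_scale_def algebra_simps)

lemma restrict_to_homogeneous_funs: 
  assumes "f \<in> homogeneous_funs j" "subspace W" shows "restrict_to W f \<in> homogeneous_funs j"
proof -
  have "c *\<^sub>R t \<in> W \<longleftrightarrow> t \<in> W" if "c \<noteq> 0" for c t
    using that assms(2) subspace_scale[OF assms(2), of "c *\<^sub>R t" "inverse c"] 
    by (auto simp: subspace_scale)
  then show ?thesis using assms by (auto simp: homogeneous_funs_def restrict_to_def)
qed

section \<open>Products of linear forms and spaces cut out by degree bounds\<close>

text \<open>Applied to a product of linear forms restricted to a line; the factors with \<open>b y = 0\<close> are those constant along it.\<close>

lemma degree_coeff_prod_linear:
  fixes a b :: "'b \<Rightarrow> complex"
  assumes "finite Y"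
  shows "degree (\<Prod>y\<in>Y. [:a y, b y:]) \<le> card {y\<in>Y. b y \<noteq> 0} \<and>
    coeff (\<Prod>y\<in>Y. [:a y, b y:]) (card {y\<in>Y. b y \<noteq> 0})
     = (\<Prod>y\<in>{y\<in>Y. b y \<noteq> 0}. b y) * (\<Prod>y\<in>{y\<in>Y. b y = 0}. a y)"
  using assms
proof (induction Y rule: finite_induct)
  case (insert y Y)
  let ?Q = "\<Prod>y\<in>Y. [:a y, b y:]" and ?k = "card {y\<in>Y. b y \<noteq> 0}"
  show ?case
  proof (cases "b y = 0")
    case True
    then have "{z\<in>insert y Y. b z \<noteq> 0} = {y\<in>Y. b y \<noteq> 0}" 
      "{z\<in>insert y Y. b z = 0} = insert y {y\<in>Y. b y = 0}" by auto
    moreover have "(\<Prod>y\<in>insert y Y. [:a y, b y:]) = smult (a y) ?Q"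
      using insert.hyps True by simp
    moreover have "degree (smult (a y) ?Q) \<le> ?k"
      using insert.IH degree_smult_le[of "a y" ?Q] by linarith
    ultimately show ?thesis
      using insert.IH insert.hyps True by simp
  next
    case False
    then have *: "{z\<in>insert y Y. b z \<noteq> 0} = insert y {y\<in>Y. b y \<noteq> 0}" 
      "{z\<in>insert y Y. b z = 0} = {y\<in>Y. b y = 0}" by auto
    have **: "(\<Prod>y\<in>insert y Y. [:a y, b y:]) = smult (a y) ?Q + pCons 0 (smult (b y) ?Q)"
      using insert.hyps False by simp
    have c: "card {z\<in>insert y Y. b z \<noteq> 0} = Suc ?k" unfolding * using insert.hyps by simp
    have "degree (pCons 0 (smult (b y) ?Q)) \<le> Suc ?k"
      using insert.IH degree_smult_le[of "b y" ?Q] degree_pCons_le[of 0 "smult (b y) ?Q"] by linarith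
    moreover have "degree (smult (a y) ?Q) \<le> Suc ?k"
      using insert.IH degree_smult_le[of "a y" ?Q] by linarith
    ultimately have "degree (\<Prod>y\<in>insert y Y. [:a y, b y:]) \<le> Suc ?k"
      unfolding ** using degree_add_le by blast
    moreover have "coeff ?Q (Suc ?k) = 0"
      using insert.IH by (intro coeff_eq_0) simp
    then have "coeff (\<Prod>y\<in>insert y Y. [:a y, b y:]) (Suc ?k) = b y * coeff ?Q ?k"
      unfolding ** by simp
    ultimately show ?thesis
      unfolding c using insert * by simp
  qed
qed simp

definition orth_section :: "'a::euclidean_space set \<Rightarrow> 'a \<Rightarrow> 'a set" where
  "orth_section W x = {t \<in> W. x \<bullet> t = 0}"

lemma subspace_orth_section: "subspace W \<Longrightarrow> subspace (orth_section W x)"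
  by (auto simp: orth_section_def subspace_def inner_add_right)

lemma orth_section_subset: "orth_section W x \<subseteq> W" by (auto simp: orth_section_def)

lemma dir_degree_less_restr:
  assumes "dir_degree_less W \<eta> m f" "W' \<subseteq> W" "subspace W'" "\<eta> \<in> W'"
  shows "dir_degree_less W' \<eta> m (restrict_to W' f)"
  unfolding dir_degree_less_def
proof
  fix t assume t: "t \<in> W'"
  then obtain q where "\<forall>i\<ge>m. coeff q i = 0" "\<forall>s. f (t + s *\<^sub>R \<eta>) = poly q (complex_of_real s)"
    using assms unfolding dir_degree_less_def by (metis subsetD)
  then show "\<exists>q. (\<forall>i\<ge>m. coeff q i = 0) \<and> (\<forall>s. restrict_to W' f (t + s *\<^sub>R \<eta>) = poly q (complex_of_real s))"
    using assms t by (intro exI[of _ q]) (auto simp: subspace_add subspace_scale)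
qed

locale vector_family =
  fixes v :: "'i \<Rightarrow> 'a::euclidean_space"
begin

text \<open>Linear algebra is done dually: a set of elements is seen through the vectors of \<open>W\<close> orthogonal to it.
Contracting \<open>x\<close> then means replacing \<open>W\<close> by its section with \<open>x\<^sup>\<bottom>\<close>, and the family of vectors never
changes. In particular \<open>S\<close> spans (modulo the complement of \<open>W\<close>) iff its annihilator is \<open>{0}\<close>.\<close>

definition annihilator :: "'a set \<Rightarrow> 'i set \<Rightarrow> 'a set" where
  "annihilator W S = {\<eta> \<in> W. \<forall>s\<in>S. v s \<bullet> \<eta> = 0}"

definition cocircuit :: "'i set \<Rightarrow> 'a \<Rightarrow> 'i set" where
  "cocircuit A \<eta> = {a \<in> A. v a \<bullet> \<eta> \<noteq> 0}"

text \<open>The condition on \<open>\<zeta>\<close> says that the elements of \<open>A\<close> orthogonal to \<open>\<eta>\<close> span a hyperplane.\<close>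

definition hyperplane_normals :: "'a set \<Rightarrow> 'i set \<Rightarrow> 'a set" where
  "hyperplane_normals W A = {\<eta> \<in> W. \<eta> \<noteq> 0 \<and> (\<forall>\<zeta> \<in> annihilator W (A - cocircuit A \<eta>). \<exists>c. \<zeta> = c *\<^sub>R \<eta>)}"

definition degree_drop :: "'i set \<Rightarrow> 'a \<Rightarrow> nat" where
  "degree_drop I \<eta> = (if cocircuit I \<eta> = {} then 0 else 1)"

text \<open>A bound on the degree along \<open>\<eta>\<close> says that a power of the directional derivative along \<open>\<eta>\<close> kills \<open>f\<close>,
so this is the homogeneous part of a joint kernel of differential operators.\<close>

definition kernel_space :: "'a set \<Rightarrow> 'i set \<Rightarrow> 'i set \<Rightarrow> nat \<Rightarrow> ('a \<Rightarrow> complex) set" where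
  "kernel_space W A I j = {f \<in> polyfun_on W \<inter> homogeneous_funs j. \<forall>\<eta>\<in>hyperplane_normals W A. dir_degree_less W \<eta> (card (cocircuit A \<eta>) - degree_drop I \<eta>) f}"

definition form_prod :: "'a set \<Rightarrow> 'i set \<Rightarrow> 'a \<Rightarrow> complex" where
  "form_prod W Y = restrict_to W (\<lambda>t. \<Prod>y\<in>Y. complex_of_real (v y \<bullet> t))"

definition graded_central :: "'a set \<Rightarrow> 'i set \<Rightarrow> nat \<Rightarrow> ('a \<Rightarrow> complex) set" where
  "graded_central W A j = fn.span {form_prod W Y | Y. Y \<subseteq> A \<and> card Y = j \<and> annihilator W (A - Y) = {0}}"

lemma annihilator_0: "subspace W \<Longrightarrow> 0 \<in> annihilator W S"
  by (auto simp: annihilator_def subspace_0)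

lemma subspace_annihilator: "subspace W \<Longrightarrow> subspace (annihilator W S)"
  by (auto simp: annihilator_def subspace_def inner_add_right)

lemma annihilator_anti: "S \<subseteq> T \<Longrightarrow> annihilator W T \<subseteq> annihilator W S"
  by (auto simp: annihilator_def)

lemma annihilator_sec: "annihilator (orth_section W (v x)) S = annihilator W (insert x S)"
  by (auto simp: annihilator_def orth_section_def)

lemma subspace_kernel_space: 
  "fn.subspace (kernel_space W A I j)"
proof -
  have "kernel_space W A I j = polyfun_on W \<inter> homogeneous_funs j \<inter> (\<Inter>\<eta>\<in>hyperplane_normals W A. {f. dir_degree_less W \<eta> (card (cocircuit A \<eta>) - degree_drop I \<eta>) f})"
    by (auto simp: kernel_space_def)
  then show ?thesis
    by (auto intro!: fn.subspace_inter fn.subspace_Int subspace_polyfun_on subspace_homogeneous_funs subspace_dir_degree_less)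
qed

lemma form_prod_polyfun_on: "form_prod W Y \<in> polyfun_on W"
  unfolding form_prod_def polyfun_on_def by (intro imageI polyfun_prod polyfun.lin)

lemma form_prod_hom: "subspace W \<Longrightarrow> form_prod W Y \<in> homogeneous_funs (card Y)"
  unfolding form_prod_def by (rule restrict_to_homogeneous_funs) (auto simp: homogeneous_funs_def prod.distrib)

lemma form_prod_line:
  assumes "subspace W" "t \<in> W" "\<eta> \<in> W"
  shows "form_prod W Y (t + s *\<^sub>R \<eta>) = 
    poly (\<Prod>y\<in>Y. [:complex_of_real (v y \<bullet> t), complex_of_real (v y \<bullet> \<eta>):]) (complex_of_real s)"
  using assms by (simp add: form_prod_def subspace_add subspace_scale poly_prod inner_add_right)

lemma form_prod_dir_degree_less:
  assumes "subspace W" "\<eta> \<in> W" "finite Y" "card (cocircuit Y \<eta>) < m"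
  shows "dir_degree_less W \<eta> m (form_prod W Y)"
  unfolding dir_degree_less_def
proof
  fix t assume t: "t \<in> W"
  let ?Q = "\<Prod>y\<in>Y. [:complex_of_real (v y \<bullet> t), complex_of_real (v y \<bullet> \<eta>):]"
  have "degree ?Q \<le> card (cocircuit Y \<eta>)"
    using degree_coeff_prod_linear[OF assms(3), of "\<lambda>y. complex_of_real (v y \<bullet> t)" "\<lambda>y. complex_of_real (v y \<bullet> \<eta>)"]
    by (simp add: cocircuit_def)
  then show "\<exists>q. (\<forall>i\<ge>m. coeff q i = 0) \<and> (\<forall>s. form_prod W Y (t + s *\<^sub>R \<eta>) = poly q (complex_of_real s))"
    using form_prod_line[OF assms(1) t assms(2)] assms(4) by (intro exI[of _ ?Q]) (auto intro: coeff_eq_0)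
qed

lemma cocircuit_nonempty: "annihilator W S = {0} \<Longrightarrow> \<eta> \<in> W \<Longrightarrow> \<eta> \<noteq> 0 \<Longrightarrow> cocircuit S \<eta> \<noteq> {}"
  by (auto simp: annihilator_def cocircuit_def)

text \<open>If \<open>A - Y\<close> spans then some element outside \<open>Y\<close> is not orthogonal to \<open>\<eta>\<close>. All
directions are covered, because a deletion may destroy spanned hyperplanes.\<close>

lemma graded_central_dir_degree_less:
  assumes "finite A" "subspace W" "\<eta> \<in> W" "\<eta> \<noteq> 0" "f \<in> graded_central W A j"
  shows "dir_degree_less W \<eta> (card (cocircuit A \<eta>)) f"
proof -
  have "dir_degree_less W \<eta> (card (cocircuit A \<eta>)) (form_prod W Y)" if Y: "Y \<subseteq> A" "annihilator W (A - Y) = {0}" for Y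
  proof (rule form_prod_dir_degree_less)
    show "finite Y" using Y assms finite_subset by auto
    have "cocircuit (A - Y) \<eta> \<noteq> {}" using cocircuit_nonempty[OF Y(2) assms(3,4)] .
    then have "cocircuit Y \<eta> \<subset> cocircuit A \<eta>" using Y by (auto simp: cocircuit_def)
    then show "card (cocircuit Y \<eta>) < card (cocircuit A \<eta>)"
      using assms(1) by (intro psubset_card_mono) (auto simp: cocircuit_def)
  qed (use assms in auto)
  then have "graded_central W A j \<subseteq> {f. dir_degree_less W \<eta> (card (cocircuit A \<eta>)) f}"
    unfolding graded_central_def by (intro fn.span_minimal subspace_dir_degree_less) auto
  then show ?thesis using assms by auto
qed

lemma graded_central_subset_homogeneous: "subspace W \<Longrightarrow> graded_central W A j \<subseteq> polyfun_on W \<inter> homogeneous_funs j"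
  unfolding graded_central_def
  by (intro fn.span_minimal fn.subspace_inter subspace_polyfun_on subspace_homogeneous_funs) (auto simp: form_prod_polyfun_on form_prod_hom)

lemma graded_central_subset_kernel_space:
  assumes "finite A" "subspace W"
  shows "graded_central W A j \<subseteq> kernel_space W A {} j"
  using graded_central_subset_homogeneous[OF assms(2)] graded_central_dir_degree_less[OF assms(1,2)] 
  by (fastforce simp: kernel_space_def hyperplane_normals_def degree_drop_def cocircuit_def)

lemma graded_central_finite_span:
  assumes "finite A" shows "\<exists>S. finite S \<and> graded_central W A j = fn.span S"
proof -
  have "{form_prod W Y | Y. Y \<subseteq> A \<and> card Y = j \<and> annihilator W (A - Y) = {0}} \<subseteq> form_prod W ` Pow A" by auto
  then show ?thesis unfolding graded_central_def using assms finite_subset by blast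
qed

lemma hyperplane_normals_mono: "A' \<subseteq> A \<Longrightarrow> hyperplane_normals W A' \<subseteq> hyperplane_normals W A"
  unfolding hyperplane_normals_def annihilator_def cocircuit_def by blast

lemma hyperplane_normals_sec: 
  assumes "x \<in> A" shows "hyperplane_normals (orth_section W (v x)) (A - {x}) \<subseteq> hyperplane_normals W A"
  using assms unfolding hyperplane_normals_def annihilator_def cocircuit_def orth_section_def by blast

lemma hyperplane_normals_loop: 
  assumes "\<And>t. t \<in> W \<Longrightarrow> v x \<bullet> t = 0" shows "hyperplane_normals W (A - {x}) = hyperplane_normals W A"
  using assms unfolding hyperplane_normals_def annihilator_def cocircuit_def by blast

lemma cocircuit_remove: "finite A \<Longrightarrow> x \<in> A \<Longrightarrow> 
  card (cocircuit A \<eta>) = card (cocircuit (A - {x}) \<eta>) + (if v x \<bullet> \<eta> = 0 then 0 else 1)"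
proof -
  assume "finite A" "x \<in> A"
  moreover have "cocircuit A \<eta> = (if v x \<bullet> \<eta> = 0 then cocircuit (A - {x}) \<eta> else insert x (cocircuit (A - {x}) \<eta>))"
    using \<open>x \<in> A\<close> by (auto simp: cocircuit_def)
  moreover have "finite (cocircuit (A - {x}) \<eta>)" "x \<notin> cocircuit (A - {x}) \<eta>" 
    using \<open>finite A\<close> by (auto simp: cocircuit_def)
  ultimately show ?thesis by (auto simp del: card.infinite)
qed

lemma degree_drop_remove: "v x \<bullet> \<eta> = 0 \<Longrightarrow> degree_drop (I - {x}) \<eta> = degree_drop I \<eta>"
  by (auto simp: degree_drop_def cocircuit_def)

lemma hyperplane_normals_coloop:
  assumes "subspace W" "x \<in> A" "finite A" "annihilator W A = {0}" "\<eta> \<in> annihilator W (A - {x})" "\<eta> \<noteq> 0"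
  shows "\<eta> \<in> hyperplane_normals W A" "card (cocircuit A \<eta>) = 1" "v x \<bullet> \<eta> \<noteq> 0"
proof -
  have W: "\<eta> \<in> W" using assms by (auto simp: annihilator_def)
  have a: "v a \<bullet> \<eta> = 0" if "a \<in> A" "a \<noteq> x" for a using assms that by (auto simp: annihilator_def)
  show x: "v x \<bullet> \<eta> \<noteq> 0"
  proof
    assume "v x \<bullet> \<eta> = 0"
    then have "\<eta> \<in> annihilator W A" using a W unfolding annihilator_def by blast
    then show False using assms by auto
  qed
  then have c: "cocircuit A \<eta> = {x}" using a assms by (auto simp: cocircuit_def)
  then show "card (cocircuit A \<eta>) = 1" by simp
  have "\<exists>c. \<zeta> = c *\<^sub>R \<eta>" if \<zeta>: "\<zeta> \<in> annihilator W (A - {x})" for \<zeta>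
  proof -
    let ?c = "(v x \<bullet> \<zeta>) / (v x \<bullet> \<eta>)"
    have "\<zeta> - ?c *\<^sub>R \<eta> \<in> annihilator W (A - {x})"
      using subspace_annihilator[OF assms(1)] \<zeta> assms(5) by (meson subspace_diff subspace_scale)
    moreover have "v x \<bullet> (\<zeta> - ?c *\<^sub>R \<eta>) = 0" using x by (simp add: inner_diff_right)
    ultimately have "\<zeta> - ?c *\<^sub>R \<eta> \<in> annihilator W A" unfolding annihilator_def by blast
    then show ?thesis using assms by auto
  qed
  then show "\<eta> \<in> hyperplane_normals W A" using W assms(6) c by (simp add: hyperplane_normals_def)
qed

lemma kernel_space_D:
  assumes "f \<in> kernel_space W A I j"
  shows "f \<in> polyfun_on W" "f \<in> homogeneous_funs j" "\<eta> \<in> hyperplane_normals W A \<Longrightarrow> dir_degree_less W \<eta> (card (cocircuit A \<eta>) - degree_drop I \<eta>) f"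
  using assms by (auto simp: kernel_space_def)

lemma kernel_space_loop:
  assumes "\<And>t. t \<in> W \<Longrightarrow> v x \<bullet> t = 0" 
  shows "kernel_space W (A - {x}) (I - {x}) j = kernel_space W A I j"
proof -
  have "cocircuit (S - {x}) \<eta> = cocircuit S \<eta>" if "\<eta> \<in> hyperplane_normals W A" for S \<eta>
    using that assms by (auto simp: hyperplane_normals_def cocircuit_def)
  moreover have "hyperplane_normals W (A - {x}) = hyperplane_normals W A" using hyperplane_normals_loop assms by blast
  ultimately show ?thesis unfolding kernel_space_def degree_drop_def by (intro Collect_cong) simp
qed

text \<open>Hyperplanes spanned in the contraction are the hyperplanes of \<open>A\<close> through \<open>x\<close>, and no element other
than \<open>x\<close> changes sides.\<close>

lemma kernel_space_restr:
  assumes "subspace W" "x \<in> A" "f \<in> kernel_space W A I j"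
  shows "restrict_to (orth_section W (v x)) f \<in> kernel_space (orth_section W (v x)) (A - {x}) (I - {x}) j"
proof -
  have "dir_degree_less (orth_section W (v x)) \<eta> (card (cocircuit (A - {x}) \<eta>) - degree_drop (I - {x}) \<eta>) (restrict_to (orth_section W (v x)) f)"
    if \<eta>: "\<eta> \<in> hyperplane_normals (orth_section W (v x)) (A - {x})" for \<eta>
  proof -
    have *: "v x \<bullet> \<eta> = 0" "\<eta> \<in> orth_section W (v x)" using \<eta> by (auto simp: hyperplane_normals_def orth_section_def)
    then have "cocircuit (A - {x}) \<eta> = cocircuit A \<eta>" by (auto simp: cocircuit_def)
    then have "dir_degree_less W \<eta> (card (cocircuit (A - {x}) \<eta>) - degree_drop (I - {x}) \<eta>) f"
      using kernel_space_D(3)[OF assms(3), of \<eta>] hyperplane_normals_sec[OF assms(2)] \<eta> degree_drop_remove[OF *(1)] by auto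
    then show ?thesis
      by (rule dir_degree_less_restr[OF _ orth_section_subset subspace_orth_section[OF assms(1)] *(2)])
  qed
  then show ?thesis
    using restrict_to_polyfun_on[OF kernel_space_D(1)[OF assms(3)] orth_section_subset] restrict_to_homogeneous_funs[OF kernel_space_D(2)[OF assms(3)] subspace_orth_section[OF assms(1)]]
    unfolding kernel_space_def by blast
qed

text \<open>If \<open>A - {x}\<close> spans only a hyperplane, functions in the space are constant along its normal, which
is transversal to \<open>x\<^sup>\<bottom>\<close>.\<close>

lemma kernel_space_kernel_coloop:
  assumes W: "subspace W" and A: "finite A" "x \<in> A" "annihilator W A = {0}" "annihilator W (A - {x}) \<noteq> {0}"
    and f: "f \<in> kernel_space W A I j" and z: "\<And>t. t \<in> orth_section W (v x) \<Longrightarrow> f t = 0"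
  shows "f = 0"
proof -
  obtain \<eta> where \<eta>: "\<eta> \<in> annihilator W (A - {x})" "\<eta> \<noteq> 0" using A(4) annihilator_0[OF W] by blast
  note h = hyperplane_normals_coloop[OF W A(2,1,3) \<eta>]
  have "dir_degree_less W \<eta> 1 f" using kernel_space_D(3)[OF f h(1)] h(2) by (auto intro: dir_degree_less_mono)
  have \<eta>W: "\<eta> \<in> W" using \<eta> by (auto simp: annihilator_def)
  have "f t = 0" if t: "t \<in> W" for t
  proof -
    obtain q where q: "\<forall>i\<ge>1. coeff q i = 0" "\<forall>s. f (t + s *\<^sub>R \<eta>) = poly q (complex_of_real s)"
      using \<open>dir_degree_less W \<eta> 1 f\<close> t unfolding dir_degree_less_def by metis
    have "q = [:coeff q 0:]" by (rule poly_eqI) (use q(1) in \<open>auto simp: coeff_pCons split: nat.splits\<close>)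
    then have "f (t + s *\<^sub>R \<eta>) = coeff q 0" for s using q(2) by (metis mult_zero_right poly_0 poly_pCons add.right_neutral)
    then have "f (t + 0 *\<^sub>R \<eta>) = f (t + (- (v x \<bullet> t) / (v x \<bullet> \<eta>)) *\<^sub>R \<eta>)" by metis
    moreover have "t + (- (v x \<bullet> t) / (v x \<bullet> \<eta>)) *\<^sub>R \<eta> \<in> orth_section W (v x)"
      using h(3) t \<eta>W W by (auto simp: orth_section_def inner_add_right inner_diff_right subspace_add subspace_scale subspace_diff)
    ultimately show ?thesis using z by simp
  qed
  then show ?thesis using polyfun_on_zero[OF kernel_space_D(1)[OF f]] by (auto simp: fun_eq_iff)
qed

text \<open>The bound along the normal of the hyperplane spanned by the other elements is \<open>1 - 1 = 0\<close>.\<close>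

lemma kernel_space_coloop:
  assumes W: "subspace W" and A: "finite A" "x \<in> A" "annihilator W A = {0}" "annihilator W (A - {x}) \<noteq> {0}"
    and f: "f \<in> kernel_space W A I j" and "x \<in> I"
  shows "f = 0"
proof -
  obtain \<eta> where \<eta>: "\<eta> \<in> annihilator W (A - {x})" "\<eta> \<noteq> 0" using A(4) annihilator_0[OF W] by blast
  note h = hyperplane_normals_coloop[OF W A(2,1,3) \<eta>]
  have "degree_drop I \<eta> = 1" using h(3) assms(7) by (auto simp: degree_drop_def cocircuit_def)
  then have "dir_degree_less W \<eta> 0 f" using kernel_space_D(3)[OF f h(1)] h(2) by simp
  then show ?thesis using dir_degree_less_0D polyfun_on_zero[OF kernel_space_D(1)[OF f]] by (metis ext zero_fun_apply)
qed

text \<open>The deletion part of the deletion-contraction sequence: a function in the kernel of the restriction to \<open>x\<^sup>\<bottom>\<close>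
is divisible by \<open>p\<^sub>x\<close>, and dividing lowers the degree by one along exactly those normals for which the deletion
lowers the bound. When \<open>x\<close> lies in \<open>I\<close>, the assumption \<open>I = A\<close> keeps the drop in the degree
bound the same before and after the deletion, since both \<open>A\<close> and \<open>A - {x}\<close> span.\<close>

lemma kernel_space_kernel:
  assumes W: "subspace W" and A: "finite A" "x \<in> A" "annihilator W (A - {x}) = {0}"
    and w: "w \<in> W" "v x \<bullet> w \<noteq> 0"
    and I: "x \<in> I \<Longrightarrow> I = A"
    and f: "f \<in> kernel_space W A I j" and z: "\<And>t. t \<in> orth_section W (v x) \<Longrightarrow> f t = 0"
  shows "\<exists>q \<in> kernel_space W (A - {x}) (I - {x}) (j - 1). (\<forall>t. f t = complex_of_real (v x \<bullet> t) * q t) \<and> (j = 0 \<longrightarrow> q = 0)"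
proof -
  obtain f0 where f0: "f0 \<in> polyfun" "f = restrict_to W f0" using kernel_space_D(1)[OF f] by (auto simp: polyfun_on_def)
  \<comment> \<open>Normalised so that \<open>t - (v x \<bullet> t) u\<close> is the projection to \<open>x\<^sup>\<bottom>\<close> along \<open>u\<close>.\<close>
  define u where "u = (1 / (v x \<bullet> w)) *\<^sub>R w"
  have u: "u \<in> W" "v x \<bullet> u = 1" using w W by (auto simp: u_def subspace_scale)
  obtain q0 where q0: "q0 \<in> polyfun" 
    "\<And>t. f0 t - f0 (t - (v x \<bullet> t) *\<^sub>R u) = complex_of_real (v x \<bullet> t) * q0 t"
    using polyfun_divide[OF f0(1)] by metis
  define q where "q = restrict_to W q0"
  have q: "q \<in> polyfun_on W" using q0 by (auto simp: q_def polyfun_on_def)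
  have fq: "f t = complex_of_real (v x \<bullet> t) * q t" for t
  proof (cases "t \<in> W")
    case True
    have 1: "t - (v x \<bullet> t) *\<^sub>R u \<in> orth_section W (v x)"
      using True u W by (auto simp: orth_section_def inner_diff_right subspace_diff subspace_scale)
    then have "t - (v x \<bullet> t) *\<^sub>R u \<in> W" using orth_section_subset by blast
    then have "f0 (t - (v x \<bullet> t) *\<^sub>R u) = 0" using z[OF 1] f0 by simp
    then show ?thesis using q0(2)[of t] True by (simp add: f0 q_def)
  qed (simp add: f0 q_def restrict_to_def)
  have hom: "f (c *\<^sub>R t) = complex_of_real c ^ j * f t" if "c \<noteq> 0" for c t
    using kernel_space_D(2)[OF f] that by (auto simp: homogeneous_funs_def)
  have j0: "q = 0" if "j = 0"
  proof -
    have f0: "f t = 0" if t: "t \<in> W" for t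
    proof -
      obtain P where P: "\<forall>t'\<in>W. \<forall>s. f (t' + s *\<^sub>R t) = poly (P t') (complex_of_real s)"
        using polyfun_on_line[OF kernel_space_D(1)[OF f] W t] by metis
      have 0: "0 \<in> W" using W subspace_0 by auto
      have "poly (P 0 - [:f t:]) (complex_of_real s) = 0" if "s \<notin> {0}" for s
        using P[rule_format, OF 0, of s] hom[of s t] that \<open>j = 0\<close> by simp
      then have "P 0 - [:f t:] = 0"
        using poly_zero_off_finite[of "{0}" "P 0 - [:f t:]"] by blast
      then have "f 0 = f t" using P[rule_format, OF 0, of 0] by simp
      moreover have "f 0 = 0" by (rule z) (auto simp: orth_section_def 0)
      ultimately show ?thesis by simp
    qed
    have "q0 t = 0" if t: "t \<in> W" for t
    proof (rule polyfun_vanish_off_hyperplane[OF q0(1) W w _ t])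
      fix t assume "t \<in> W" "v x \<bullet> t \<noteq> 0"
      then show "q0 t = 0" using fq[of t] f0[of t] by (simp add: q_def)
    qed
    then show ?thesis by (auto simp: q_def restrict_to_def)
  qed
  have "q \<in> homogeneous_funs (j - 1)"
  proof (cases "j = 0")
    case False
    have "restrict_to W q0 (c *\<^sub>R t) = complex_of_real c ^ (j - 1) * restrict_to W q0 t" if c: "c \<noteq> 0" for c t
    proof (cases "t \<in> W")
      case True
      define g where "g t = q0 (c *\<^sub>R t) + (- (complex_of_real c ^ (j - 1))) * q0 t" for t
      have "g \<in> polyfun" unfolding g_def by (intro polyfun.add polyfun.mult polyfun.const polyfun_dilate q0)
      moreover have "g t = 0" if t: "t \<in> W" "v x \<bullet> t \<noteq> 0" for t
      proof -
        have ct: "c *\<^sub>R t \<in> W" using t W subspace_scale by blast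
        have "complex_of_real (c * (v x \<bullet> t)) * q0 (c *\<^sub>R t) = complex_of_real c ^ j * (complex_of_real (v x \<bullet> t) * q0 t)"
          using hom[OF c, of t] fq[of t] fq[of "c *\<^sub>R t"] t ct by (simp add: q_def)
        then have "q0 (c *\<^sub>R t) * complex_of_real c = complex_of_real c ^ j * q0 t"
          using t by (simp add: mult.commute)
        also have "complex_of_real c ^ j = complex_of_real c ^ (j - 1) * complex_of_real c"
          using False by (cases j) (simp_all add: mult.commute)
        finally show ?thesis using c by (simp add: g_def)
      qed
      ultimately have "g t = 0" using polyfun_vanish_off_hyperplane[OF _ W w _ True] by blast
      then show ?thesis using True W by (simp add: g_def subspace_scale)
    next
      case False
      have "c *\<^sub>R t \<notin> W" using False c subspace_scale[OF W, of "c *\<^sub>R t" "inverse c"] by auto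
      then show ?thesis using False by (simp add: restrict_to_def)
    qed
    then show ?thesis unfolding homogeneous_funs_def q_def by blast
  qed (use j0 in \<open>auto simp: homogeneous_funs_def\<close>)
  moreover have "dir_degree_less W \<eta> (card (cocircuit (A - {x}) \<eta>) - degree_drop (I - {x}) \<eta>) q" if \<eta>: "\<eta> \<in> hyperplane_normals W (A - {x})" for \<eta>
  proof -
    have \<eta>': "\<eta> \<in> hyperplane_normals W A" "\<eta> \<in> W" "\<eta> \<noteq> 0" using \<eta> hyperplane_normals_mono[of "A - {x}" A W] by (auto simp: hyperplane_normals_def)
    have "dir_degree_less W \<eta> (card (cocircuit A \<eta>) - degree_drop I \<eta>) (\<lambda>t. complex_of_real (v x \<bullet> t) * q t)"
    proof -
      have "f = (\<lambda>t. complex_of_real (v x \<bullet> t) * q t)" using fq by (rule ext)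
      then show ?thesis using kernel_space_D(3)[OF f \<eta>'(1)] by argo
    qed
    then have *: "dir_degree_less W \<eta> (card (cocircuit A \<eta>) - degree_drop I \<eta> - (if v x \<bullet> \<eta> = 0 then 0 else 1)) q"
      by (rule dir_degree_less_cancel_linear_factor[OF W \<eta>'(2) w q])
    have "degree_drop I \<eta> = degree_drop (I - {x}) \<eta>"
    proof (cases "x \<in> I")
      case True
      have "cocircuit (A - {x}) \<eta> \<noteq> {}" using cocircuit_nonempty[OF A(3) \<eta>'(2,3)] .
      then show ?thesis using I[OF True] by (auto simp: degree_drop_def cocircuit_def)
    qed auto
    then have "card (cocircuit A \<eta>) - degree_drop I \<eta> - (if v x \<bullet> \<eta> = 0 then 0 else 1)
      = card (cocircuit (A - {x}) \<eta>) - degree_drop (I - {x}) \<eta>"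
      using cocircuit_remove[OF A(1,2), of \<eta>] by auto
    then show ?thesis using * by simp
  qed
  ultimately have "q \<in> kernel_space W (A - {x}) (I - {x}) (j - 1)" using q by (auto simp: kernel_space_def)
  then show ?thesis using fq j0 by blast
qed

section \<open>Degree bounds characterise the central space\<close>

definition mult_form :: "'i \<Rightarrow> ('a \<Rightarrow> complex) \<Rightarrow> 'a \<Rightarrow> complex" where
  "mult_form x f = (\<lambda>t. complex_of_real (v x \<bullet> t) * f t)"

lemma mult_form_linear: "mult_form x (f + g) = mult_form x f + mult_form x g" "mult_form x (fun_scale c f) = fun_scale c (mult_form x f)" "mult_form x 0 = 0"
  by (auto simp: mult_form_def fun_scale_def algebra_simps)

lemma restrict_to_linear: "restrict_to W (f + g) = restrict_to W f + restrict_to W g" "restrict_to W (fun_scale c f) = fun_scale c (restrict_to W f)"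
  "restrict_to W 0 = 0"
  by (auto simp: restrict_to_def fun_scale_def)

lemma graded_central_deletion:
  assumes "subspace W" shows "graded_central W (A - {x}) j \<subseteq> graded_central W A j"
  unfolding graded_central_def
proof (rule fn.span_mono, safe)
  fix Y assume "Y \<subseteq> A - {x}" "annihilator W (A - {x} - Y) = {0}"
  then show "\<exists>Y'. form_prod W Y = form_prod W Y' \<and> Y' \<subseteq> A \<and> card Y' = card Y \<and> annihilator W (A - Y') = {0}"
    using annihilator_anti[of "A - {x} - Y" "A - Y" W] annihilator_0[OF assms, of "A - Y"] 
    by (intro exI[of _ Y]) auto
qed

lemma graded_central_mul:
  assumes "finite A" "x \<in> A" "q \<in> graded_central W (A - {x}) j"
  shows "mult_form x q \<in> graded_central W A (Suc j)"
proof -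
  have "graded_central W (A - {x}) j \<subseteq> {q. mult_form x q \<in> graded_central W A (Suc j)}"
    unfolding graded_central_def[of W "A - {x}"]
  proof (rule fn.span_minimal)
    show "fn.subspace {q. mult_form x q \<in> graded_central W A (Suc j)}"
      by (rule fn.subspaceI)
         (auto simp: mult_form_linear graded_central_def fn.span_zero fn.span_add fn.span_scale)
    show "{form_prod W Y |Y. Y \<subseteq> A - {x} \<and> card Y = j \<and> annihilator W (A - {x} - Y) = {0}} \<subseteq> {q. mult_form x q \<in> graded_central W A (Suc j)}"
    proof safe
      fix Y assume Y: "Y \<subseteq> A - {x}" "annihilator W (A - {x} - Y) = {0}" "j = card Y"
      have fin: "finite Y" "x \<notin> Y" using Y assms finite_subset[of Y A] by auto
      have "mult_form x (form_prod W Y) = form_prod W (insert x Y)"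
        using fin by (auto simp: mult_form_def form_prod_def restrict_to_def fun_eq_iff)
      moreover have "A - insert x Y = A - {x} - Y" by auto
      ultimately show "mult_form x (form_prod W Y) \<in> graded_central W A (Suc (card Y))"
        unfolding graded_central_def using Y fin assms by (intro fn.span_base) auto
    qed
  qed
  then show ?thesis using assms by auto
qed

text \<open>A generator of the contracted space is the restriction of the product over the same set \<open>Y\<close>, because
the complement of \<open>Y\<close> in \<open>A\<close> regains \<open>x\<close>.\<close>

lemma graded_central_lift:
  assumes "x \<in> A" "f \<in> graded_central (orth_section W (v x)) (A - {x}) j"
  shows "\<exists>g\<in>graded_central W A j. restrict_to (orth_section W (v x)) g = f"
proof -
  let ?W = "orth_section W (v x)"
  have "graded_central ?W (A - {x}) j \<subseteq> {f. \<exists>g\<in>graded_central W A j. restrict_to ?W g = f}"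
    unfolding graded_central_def[of ?W]
  proof (rule fn.span_minimal)
    show "fn.subspace {f. \<exists>g\<in>graded_central W A j. restrict_to ?W g = f}"
    proof (rule fn.subspaceI)
      show "0 \<in> {f. \<exists>g\<in>graded_central W A j. restrict_to ?W g = f}"
        using restrict_to_linear(3) fn.span_zero by (auto simp: graded_central_def)
    next
      fix a b assume "a \<in> {f. \<exists>g\<in>graded_central W A j. restrict_to ?W g = f}" "b \<in> {f. \<exists>g\<in>graded_central W A j. restrict_to ?W g = f}"
      then obtain g h where "g \<in> graded_central W A j" "restrict_to ?W g = a" "h \<in> graded_central W A j" "restrict_to ?W h = b" by auto
      then show "a + b \<in> {f. \<exists>g\<in>graded_central W A j. restrict_to ?W g = f}"
        using restrict_to_linear(1)[of ?W g h] fn.span_add by (auto simp: graded_central_def intro!: bexI[of _ "g + h"])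
    next
      fix c a assume "a \<in> {f. \<exists>g\<in>graded_central W A j. restrict_to ?W g = f}"
      then obtain g where "g \<in> graded_central W A j" "restrict_to ?W g = a" by auto
      then show "fun_scale c a \<in> {f. \<exists>g\<in>graded_central W A j. restrict_to ?W g = f}"
        using restrict_to_linear(2)[of ?W c g] fn.span_scale by (auto simp: graded_central_def intro!: bexI[of _ "fun_scale c g"])
    qed
    show "{form_prod ?W Y |Y. Y \<subseteq> A - {x} \<and> card Y = j \<and> annihilator ?W (A - {x} - Y) = {0}} \<subseteq> {f. \<exists>g\<in>graded_central W A j. restrict_to ?W g = f}"
    proof safe
      fix Y assume Y: "Y \<subseteq> A - {x}" "annihilator ?W (A - {x} - Y) = {0}" "j = card Y"
      have "insert x (A - {x} - Y) = A - Y" using Y assms by auto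
      then have "annihilator W (A - Y) = {0}" using Y(2) annihilator_sec by metis
      then have "form_prod W Y \<in> graded_central W A (card Y)" unfolding graded_central_def using Y by (intro fn.span_base) auto
      moreover have "restrict_to ?W (form_prod W Y) = form_prod ?W Y"
        using orth_section_subset by (auto simp: form_prod_def restrict_to_def fun_eq_iff)
      ultimately show "\<exists>g\<in>graded_central W A (card Y). restrict_to ?W g = form_prod ?W Y" by blast
    qed
  qed
  then show ?thesis using assms by auto
qed

lemma kernel_space_empty:
  assumes "f \<in> kernel_space {0} {} I j"
  shows "f = fun_scale (f 0) (form_prod {0} {})" "j \<noteq> 0 \<Longrightarrow> f 0 = 0"
proof -
  show "f = fun_scale (f 0) (form_prod {0} {})"
    using polyfun_on_zero[OF kernel_space_D(1)[OF assms]] by (auto simp: fun_scale_def form_prod_def restrict_to_def)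
  assume j: "j \<noteq> 0"
  \<comment> \<open>The origin is fixed by the dilation by 2.\<close>
  have "f (2 *\<^sub>R 0) = complex_of_real 2 ^ j * f 0"
    using kernel_space_D(2)[OF assms] unfolding homogeneous_funs_def by (metis (mono_tags, lifting) mem_Collect_eq zero_neq_numeral)
  then have "f 0 * (1 - 2 ^ j) = 0" by (simp add: algebra_simps)
  moreover have "(2::complex) ^ j \<noteq> 1"
  proof
    assume "(2::complex) ^ j = 1"
    then have "norm ((2::complex) ^ j) = 1" by simp
    then have "(2::real) ^ j = 1" by (simp add: norm_power)
    then show False using j one_less_power[of "2::real" j] by simp
  qed
  ultimately show "f 0 = 0" by simp
qed

text \<open>Five-lemma argument: the restriction to \<open>x\<^sup>\<bottom>\<close> is a combination of products by induction and lifts to such a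
combination; the difference vanishes on \<open>x\<^sup>\<bottom>\<close>, so it is \<open>p\<^sub>x\<close> times an element of the deletion's
space, to which the induction applies again.\<close>

lemma kernel_space_subset_graded_central:
  assumes "finite A" "subspace W" "annihilator W A = {0}"
  shows "kernel_space W A {} j \<subseteq> graded_central W A j"
  using assms
proof (induction "card A" arbitrary: A W j)
  case 0
  then have A: "A = {}" "W = {0}" by (auto simp: annihilator_def)
  show ?case
  proof
    fix f assume f: "f \<in> kernel_space W A {} j"
    then have f0: "f = fun_scale (f 0) (form_prod W {})" "j \<noteq> 0 \<Longrightarrow> f 0 = 0" using kernel_space_empty unfolding A by blast+
    show "f \<in> graded_central W A j"
    proof (cases "j = 0")
      case True
      have "form_prod W {} \<in> graded_central W A j" unfolding graded_central_def using A True by (intro fn.span_base) (auto simp: annihilator_def)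
      then have "fun_scale (f 0) (form_prod W {}) \<in> graded_central W A j" unfolding graded_central_def by (rule fn.span_scale)
      then show ?thesis using f0(1) by argo
    next
      case False
      then have "fun_scale (f 0) (form_prod W {}) = 0" using f0(2) by (simp add: fun_scale_def zero_fun_def)
      then have "f = 0" using f0(1) by argo
      then show ?thesis by (simp add: graded_central_def fn.span_zero)
    qed
  qed
next
  case (Suc n)
  then obtain x where x: "x \<in> A" by (metis card.empty equals0I nat.distinct(1))
  have card: "n = card (A - {x})" and fin: "finite (A - {x})" using Suc x by auto
  show ?case
  proof (cases "\<forall>t\<in>W. v x \<bullet> t = 0")
    case True
    have "annihilator W (A - {x}) = annihilator W A" using True by (auto simp: annihilator_def)
    then have "kernel_space W (A - {x}) {} j \<subseteq> graded_central W (A - {x}) j" using Suc.hyps(1)[OF card fin] Suc.prems by auto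
    moreover have "kernel_space W (A - {x}) {} j = kernel_space W A {} j" using kernel_space_loop[of W x A "{}" j] True by auto
    ultimately show ?thesis using graded_central_deletion[OF Suc.prems(2)] by blast
  next
    case False
    then obtain w where w: "w \<in> W" "v x \<bullet> w \<noteq> 0" by auto
    let ?W = "orth_section W (v x)"
    show ?thesis
    proof
      fix f assume f: "f \<in> kernel_space W A {} j"
      have "restrict_to ?W f \<in> kernel_space ?W (A - {x}) {} j" using kernel_space_restr[OF Suc.prems(2) x f] by simp
      moreover have "annihilator ?W (A - {x}) = {0}" unfolding annihilator_sec using x Suc.prems by (simp add: insert_absorb)
      ultimately have "restrict_to ?W f \<in> graded_central ?W (A - {x}) j"
        using Suc.hyps(1)[OF card fin subspace_orth_section] Suc.prems by blast
      then obtain g where g: "g \<in> graded_central W A j" "restrict_to ?W g = restrict_to ?W f" using graded_central_lift[OF x] by metis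
      have fg: "f - g \<in> kernel_space W A {} j"
        using fn.subspace_diff[OF subspace_kernel_space f] graded_central_subset_kernel_space[OF Suc.prems(1,2)] g by blast
      have z: "(f - g) t = 0" if "t \<in> ?W" for t using fun_cong[OF g(2), of t] that by simp
      have "f - g \<in> graded_central W A j"
      proof (cases "annihilator W (A - {x}) = {0}")
        case True
        obtain q where q: "q \<in> kernel_space W (A - {x}) ({} - {x}) (j - 1)"
          "\<forall>t. (f - g) t = complex_of_real (v x \<bullet> t) * q t" "j = 0 \<longrightarrow> q = 0"
          using kernel_space_kernel[OF Suc.prems(2,1) x True w _ fg z] by auto
        have fgq: "f - g = mult_form x q" using q(2) by (auto simp: mult_form_def)
        show ?thesis
        proof (cases "j = 0")
          case True
          then show ?thesis using q fgq mult_form_linear(3) by (simp add: graded_central_def fn.span_zero)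
        next
          case False
          have "q \<in> graded_central W (A - {x}) (j - 1)"
            using Suc.hyps(1)[OF card fin Suc.prems(2) True] q by auto
          then show ?thesis using graded_central_mul[OF Suc.prems(1) x] False fgq by fastforce
        qed
      next
        case False
        have "f - g = 0" by (rule kernel_space_kernel_coloop[OF Suc.prems(2,1) x Suc.prems(3) False fg z])
        then show ?thesis unfolding graded_central_def by (metis fn.span_zero)
      qed
      then have "(f - g) + g \<in> graded_central W A j" using g fn.span_add unfolding graded_central_def by blast
      then show "f \<in> graded_central W A j" by simp
    qed
  qed
qed

section \<open>Internal bases relative to a subspace\<close>

definition closure_in :: "'a set \<Rightarrow> 'i set \<Rightarrow> 'i set" where
  "closure_in W S = {y. \<forall>\<eta>\<in>annihilator W S. v y \<bullet> \<eta> = 0}"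

text \<open>A minimal spanning set, phrased dually.\<close>

definition rel_basis :: "'a set \<Rightarrow> 'i set \<Rightarrow> 'i set \<Rightarrow> bool" where
  "rel_basis W A B \<longleftrightarrow> B \<subseteq> A \<and> annihilator W B = {0} \<and> (\<forall>b\<in>B. annihilator W (B - {b}) \<noteq> {0})"

definition rel_active :: "'a set \<Rightarrow> 'i set \<Rightarrow> 'i set \<Rightarrow> ('i \<times> 'i) set \<Rightarrow> 'i set \<Rightarrow> 'i \<Rightarrow> bool" where
  "rel_active W A I r B b \<longleftrightarrow> b \<in> B \<and> b \<in> I \<and> (\<forall>y\<in>A - {b}. y \<notin> closure_in W (B - {b}) \<longrightarrow> (y, b) \<in> r)"

definition rel_valuation :: "'a set \<Rightarrow> 'i set \<Rightarrow> ('i \<times> 'i) set \<Rightarrow> 'i set \<Rightarrow> nat" where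
  "rel_valuation W A r B = card {x \<in> A - B. x \<notin> closure_in W {b\<in>B. (b, x) \<in> r}}"

definition rel_internal_bases :: "'a set \<Rightarrow> 'i set \<Rightarrow> 'i set \<Rightarrow> ('i \<times> 'i) set \<Rightarrow> nat \<Rightarrow> 'i set set" where
  "rel_internal_bases W A I r j = {B. rel_basis W A B \<and> (\<forall>b\<in>B. \<not> rel_active W A I r B b) \<and> rel_valuation W A r B = j}"

lemma finite_rel_internal_bases: "finite A \<Longrightarrow> finite (rel_internal_bases W A I r j)"
  by (rule finite_subset[of _ "Pow A"]) (auto simp: rel_internal_bases_def rel_basis_def)

lemma closure_in_sec: "closure_in (orth_section W (v x)) S = closure_in W (insert x S)"
  by (simp add: closure_in_def annihilator_sec)

lemma rel_internal_bases_loop: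
  assumes loop: "\<And>t. t \<in> W \<Longrightarrow> v x \<bullet> t = 0"
  shows "rel_internal_bases W (A - {x}) (I - {x}) r j = rel_internal_bases W A I r j"
proof -
  have c: "x \<in> closure_in W S" for S using loop by (auto simp: closure_in_def annihilator_def)
  have A: "annihilator W (B - {x}) = annihilator W B" for B using loop by (auto simp: annihilator_def)
  have b: "x \<notin> B" if "rel_basis W A' B" for A' B
  proof
    assume "x \<in> B"
    then have "annihilator W (B - {x}) \<noteq> {0}" "annihilator W B = {0}" using that by (auto simp: rel_basis_def)
    then show False using A by simp
  qed
  have "B \<in> rel_internal_bases W (A - {x}) (I - {x}) r j \<longleftrightarrow> B \<in> rel_internal_bases W A I r j" if x: "x \<notin> B" for B
  proof -
    have "rel_basis W (A - {x}) B \<longleftrightarrow> rel_basis W A B" using x by (auto simp: rel_basis_def)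
    moreover have "{y \<in> A - {x} - B. y \<notin> closure_in W {b\<in>B. (b, y) \<in> r}} = {y \<in> A - B. y \<notin> closure_in W {b\<in>B. (b, y) \<in> r}}"
      using c by auto
    then have "rel_valuation W (A - {x}) r B = rel_valuation W A r B" by (simp add: rel_valuation_def)
    moreover have "rel_active W (A - {x}) (I - {x}) r B b \<longleftrightarrow> rel_active W A I r B b" if "b \<in> B" for b
      using that x c unfolding rel_active_def by blast
    ultimately show ?thesis by (auto simp: rel_internal_bases_def)
  qed
  moreover have "x \<notin> B" if "B \<in> rel_internal_bases W A' I' r j" for A' I' B using that b by (auto simp: rel_internal_bases_def)
  ultimately show ?thesis by blast
qed

text \<open>A basis of the contraction has one element too few to span \<open>W\<close>. The witness is obtained from \<open>w\<close> by
subtracting its expansion in the dual basis of \<open>B\<close>.\<close>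

lemma annihilator_of_contracted_basis:
  assumes W: "subspace W" and w: "w \<in> W" "v x \<bullet> w \<noteq> 0" and B: "rel_basis (orth_section W (v x)) A B" and "finite A"
  shows "annihilator W B \<noteq> {0}"
proof -
  let ?W = "orth_section W (v x)"
  have finB: "finite B" using B assms(5) finite_subset by (auto simp: rel_basis_def)
  have "\<exists>\<eta>. \<eta> \<in> annihilator ?W (B - {b}) \<and> v b \<bullet> \<eta> \<noteq> 0" if b: "b \<in> B" for b
  proof -
    obtain \<eta> where \<eta>: "\<eta> \<in> annihilator ?W (B - {b})" "\<eta> \<noteq> 0"
      using B b annihilator_0[OF subspace_orth_section[OF W]] unfolding rel_basis_def by blast
    have "v b \<bullet> \<eta> \<noteq> 0"
    proof
      assume "v b \<bullet> \<eta> = 0"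
      then have "\<eta> \<in> annihilator ?W B" using \<eta> by (auto simp: annihilator_def)
      then show False using \<eta> B by (auto simp: rel_basis_def)
    qed
    then show ?thesis using \<eta> by auto
  qed
  then obtain e where e: "\<And>b. b \<in> B \<Longrightarrow> e b \<in> annihilator ?W (B - {b})" "\<And>b. b \<in> B \<Longrightarrow> v b \<bullet> e b \<noteq> 0"
    by metis
  define u where "u = w - (\<Sum>b\<in>B. ((v b \<bullet> w) / (v b \<bullet> e b)) *\<^sub>R e b)"
  have eW: "e b \<in> W" "v x \<bullet> e b = 0" if "b \<in> B" for b
    using e(1)[OF that] by (auto simp: annihilator_def orth_section_def)
  have "u \<in> W" unfolding u_def
    using W w eW by (intro subspace_diff subspace_sum subspace_scale) auto
  moreover have "v c \<bullet> u = 0" if c: "c \<in> B" for c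
  proof -
    have "(\<Sum>b\<in>B. ((v b \<bullet> w) / (v b \<bullet> e b)) * (v c \<bullet> e b)) = (\<Sum>b\<in>B. if b = c then v c \<bullet> w else 0)"
      using e c by (intro sum.cong refl) (auto simp: annihilator_def)
    also have "\<dots> = v c \<bullet> w" using c finB by simp
    finally show ?thesis by (simp add: u_def inner_diff_right inner_sum_right)
  qed
  moreover have "v x \<bullet> u = v x \<bullet> w"
    using eW by (simp add: u_def inner_diff_right inner_sum_right)
  then have "u \<noteq> 0" using w by auto
  ultimately show ?thesis by (auto simp: annihilator_def)
qed

text \<open>The smallest element \<open>x\<close> is preceded by no element of \<open>B\<close>, so it always contributes to the
valuation of a basis avoiding it.\<close>

lemma rel_internal_bases_deletion:
  assumes W: "w \<in> W" "v x \<bullet> w \<noteq> 0" and x: "x \<in> A" "x \<notin> B" "finite A"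
    and r: "trans r" "irrefl r" "\<And>y. y \<in> A - {x} \<Longrightarrow> (x, y) \<in> r"
  shows "B \<in> rel_internal_bases W A I r j \<longleftrightarrow> j \<noteq> 0 \<and> B \<in> rel_internal_bases W (A - {x}) (I - {x}) r (j - 1)"
proof (cases "rel_basis W A B")
  case True
  then have BA: "B \<subseteq> A" by (simp add: rel_basis_def)
  have b: "rel_basis W (A - {x}) B \<longleftrightarrow> rel_basis W A B" using x by (auto simp: rel_basis_def)
  have "{b\<in>B. (b, x) \<in> r} = {}"
    using r x BA unfolding irrefl_def trans_def by blast
  then have xc: "x \<notin> closure_in W {b\<in>B. (b, x) \<in> r}" using W by (auto simp: closure_in_def annihilator_def)
  have "{y \<in> A - B. y \<notin> closure_in W {b\<in>B. (b, y) \<in> r}} = insert x {y \<in> A - {x} - B. y \<notin> closure_in W {b\<in>B. (b, y) \<in> r}}"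
    using xc x by auto
  then have rel_valuation: "rel_valuation W A r B = Suc (rel_valuation W (A - {x}) r B)"
    using x by (simp add: rel_valuation_def)
  have rel_active: "rel_active W A I r B b \<longleftrightarrow> rel_active W (A - {x}) (I - {x}) r B b" if "b \<in> B" for b
    using that x r(3) BA unfolding rel_active_def by blast
  show ?thesis using b rel_valuation rel_active by (auto simp: rel_internal_bases_def)
qed (use x in \<open>auto simp: rel_internal_bases_def rel_basis_def\<close>)

text \<open>The smallest element \<open>x\<close> precedes every other element and so takes part in every closure used for the
valuation, exactly as in the contraction. It could be active only if no other element lay outside
the span of \<open>B\<close>, which the last assumption excludes.\<close>

lemma rel_internal_bases_contraction:
  assumes W: "subspace W" "w \<in> W" "v x \<bullet> w \<noteq> 0" and x: "x \<in> A" "x \<notin> B" "finite A"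
    and r: "trans r" "irrefl r" "\<And>y. y \<in> A - {x} \<Longrightarrow> (x, y) \<in> r"
    and I: "x \<in> I \<Longrightarrow> annihilator W (A - {x}) = {0}"
  shows "insert x B \<in> rel_internal_bases W A I r j \<longleftrightarrow> B \<in> rel_internal_bases (orth_section W (v x)) (A - {x}) (I - {x}) r j"
proof -
  let ?W = "orth_section W (v x)"
  have rem: "insert x B - {b} = insert x (B - {b})" if "b \<in> B" for b using x that by auto
  have b: "rel_basis W A (insert x B) \<longleftrightarrow> rel_basis ?W (A - {x}) B"
  proof
    assume "rel_basis W A (insert x B)"
    then show "rel_basis ?W (A - {x}) B" using x rem unfolding rel_basis_def annihilator_sec by auto
  next
    assume B: "rel_basis ?W (A - {x}) B"
    have "insert x B - {x} = B" using x by auto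
    then show "rel_basis W A (insert x B)"
      using annihilator_of_contracted_basis[OF W B] B x rem unfolding rel_basis_def annihilator_sec by auto
  qed
  show ?thesis
  proof (cases "rel_basis W A (insert x B)")
    case True
    then have BA: "B \<subseteq> A - {x}" using b by (simp add: rel_basis_def)
    have "{b \<in> insert x B. (b, y) \<in> r} = insert x {b \<in> B. (b, y) \<in> r}" if "y \<in> A - insert x B" for y
      using r(3) that by auto
    then have "{y \<in> A - insert x B. y \<notin> closure_in W {b\<in>insert x B. (b, y) \<in> r}} =
        {y \<in> A - {x} - B. y \<notin> closure_in ?W {b\<in>B. (b, y) \<in> r}}"
      unfolding closure_in_sec by auto
    then have rel_valuation: "rel_valuation W A r (insert x B) = rel_valuation ?W (A - {x}) r B" by (simp add: rel_valuation_def)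
    have rel_active: "rel_active W A I r (insert x B) b \<longleftrightarrow> rel_active ?W (A - {x}) (I - {x}) r B b" if "b \<in> B" for b
    proof -
      have "x \<in> closure_in W (insert x (B - {b}))" by (auto simp: closure_in_def annihilator_def)
      then show ?thesis
        using that BA unfolding rel_active_def closure_in_sec rem[OF that] by blast
    qed
    have "\<not> rel_active W A I r (insert x B) x"
    proof
      assume a: "rel_active W A I r (insert x B) x"
      have "insert x B - {x} = B" using x by auto
      then have "y \<in> closure_in W B" if "y \<in> A - {x}" for y
        using a that r unfolding rel_active_def irrefl_def trans_def by metis
      then have "annihilator W B \<subseteq> annihilator W (A - {x})" by (auto simp: annihilator_def closure_in_def)
      moreover have "annihilator W B \<noteq> {0}" using True x by (auto simp: rel_basis_def)
      moreover have "0 \<in> annihilator W B" by (rule annihilator_0[OF W(1)])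
      ultimately show False using I a by (auto simp: rel_active_def)
    qed
    then show ?thesis using b rel_valuation rel_active by (auto simp: rel_internal_bases_def)
  qed (use b in \<open>auto simp: rel_internal_bases_def\<close>)
qed

lemma card_rel_internal_bases_split:
  assumes W: "subspace W" "w \<in> W" "v x \<bullet> w \<noteq> 0" and x: "x \<in> A" "finite A"
    and r: "trans r" "irrefl r" "\<And>y. y \<in> A - {x} \<Longrightarrow> (x, y) \<in> r"
    and I: "x \<in> I \<Longrightarrow> annihilator W (A - {x}) = {0}"
  shows "card (rel_internal_bases W A I r j) = (if j = 0 then 0 else card (rel_internal_bases W (A - {x}) (I - {x}) r (j - 1))) +
    card (rel_internal_bases (orth_section W (v x)) (A - {x}) (I - {x}) r j)"
proof -
  let ?D = "if j = 0 then {} else rel_internal_bases W (A - {x}) (I - {x}) r (j - 1)"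
  let ?C = "rel_internal_bases (orth_section W (v x)) (A - {x}) (I - {x}) r j"
  have xD: "x \<notin> B" if "B \<in> ?D" for B using that by (auto simp: rel_internal_bases_def rel_basis_def split: if_splits)
  have xC: "x \<notin> B" if "B \<in> ?C" for B using that by (auto simp: rel_internal_bases_def rel_basis_def)
  have del: "B \<in> rel_internal_bases W A I r j \<longleftrightarrow> B \<in> ?D" if "x \<notin> B" for B
    using rel_internal_bases_deletion[OF W(2,3) x(1) that x(2) r] by auto
  have con: "insert x B \<in> rel_internal_bases W A I r j \<longleftrightarrow> B \<in> ?C" if "x \<notin> B" for B
    using rel_internal_bases_contraction[OF W x(1) that x(2) r I] .
  have "rel_internal_bases W A I r j = ?D \<union> insert x ` ?C"
  proof (rule set_eqI)
    fix B
    show "B \<in> rel_internal_bases W A I r j \<longleftrightarrow> B \<in> ?D \<union> insert x ` ?C"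
    proof (cases "x \<in> B")
      case True
      then obtain B' where B': "B = insert x B'" "x \<notin> B'" by (meson mk_disjoint_insert)
      have "B \<notin> ?D" using True xD by blast
      moreover have "B \<in> insert x ` ?C \<longleftrightarrow> B' \<in> ?C"
      proof
        assume "B \<in> insert x ` ?C"
        then obtain C where C: "C \<in> ?C" "insert x B' = insert x C" using B' by blast
        then have "B' = C" using insert_ident[OF B'(2) xC[OF C(1)]] by simp
        then show "B' \<in> ?C" using C by simp
      qed (use B' in blast)
      ultimately show ?thesis using con[OF B'(2), folded B'(1)] unfolding Un_iff by argo
    next
      case False
      then have "B \<notin> insert x ` ?C" by blast
      then show ?thesis using del[OF False] by blast
    qed
  qed
  moreover have "?D \<inter> insert x ` ?C = {}" using xD by blast
  moreover have "finite ?D" "finite ?C" using finite_rel_internal_bases x by auto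
  moreover have "inj_on (insert x) ?C"
  proof (rule inj_onI)
    fix C C' assume "C \<in> ?C" "C' \<in> ?C" "insert x C = insert x C'"
    then show "C = C'" using insert_ident[OF xC xC] by blast
  qed
  ultimately show ?thesis by (simp add: card_Un_disjoint card_image)
qed

section \<open>The upper bound\<close>

lemma kernel_space_mono_empty: "kernel_space W A I j \<subseteq> kernel_space W A {} j"
proof -
  have "degree_drop {} \<eta> = 0" for \<eta> by (simp add: degree_drop_def cocircuit_def)
  then show ?thesis unfolding kernel_space_def by (auto intro: dir_degree_less_mono)
qed

lemma kernel_space_finite_span:
  assumes "finite A" "subspace W" "annihilator W A = {0}"
  shows "\<exists>S. finite S \<and> kernel_space W A I j \<subseteq> fn.span S"
  using kernel_space_mono_empty kernel_space_subset_graded_central[OF assms] graded_central_finite_span[OF assms(1)] by (metis order_trans)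

lemma dim_zero: "U \<subseteq> {0} \<Longrightarrow> fn.dim U = 0"
  using fn.dim_le_card[of U "{}"] by simp

lemma mult_form_eq_0: 
  assumes "subspace W" "w \<in> W" "v x \<bullet> w \<noteq> 0" "q \<in> polyfun_on W" "mult_form x q = 0"
  shows "q = 0"
proof -
  obtain q0 where q0: "q0 \<in> polyfun" "q = restrict_to W q0" using assms by (auto simp: polyfun_on_def)
  have "q0 t = 0" if t: "t \<in> W" for t
  proof (rule polyfun_vanish_off_hyperplane[OF q0(1) assms(1-3) _ t])
    fix t assume "t \<in> W" "v x \<bullet> t \<noteq> 0"
    then show "q0 t = 0" using fun_cong[OF assms(5), of t] q0 by (simp add: mult_form_def)
  qed
  then show ?thesis using q0 by (auto simp: restrict_to_def)
qed

definition order_on :: "'i set \<Rightarrow> ('i \<times> 'i) set \<Rightarrow> bool" where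
  "order_on A r \<longleftrightarrow> trans r \<and> irrefl r \<and> total_on A r"

lemma order_on_min:
  assumes "order_on A r" "finite A" "A \<noteq> {}"
  obtains x where "x \<in> A" "\<And>y. y \<in> A - {x} \<Longrightarrow> (x, y) \<in> r"
proof -
  have "\<exists>x\<in>A. \<forall>y\<in>A - {x}. (x, y) \<in> r"
    using assms(2,3,1)
  proof (induction A rule: finite_ne_induct)
    case (singleton x)
    then show ?case by auto
  next
    case (insert a A)
    then have "order_on A r" by (auto simp: order_on_def total_on_def)
    then obtain x where x: "x \<in> A" "\<forall>y\<in>A - {x}. (x, y) \<in> r" using insert by auto
    have "(a, x) \<in> r \<or> (x, a) \<in> r" using insert x by (auto simp: order_on_def total_on_def)
    then show ?case
    proof
      assume "(a, x) \<in> r"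
      then have "\<forall>y\<in>insert a A - {a}. (a, y) \<in> r"
        using x insert.prems unfolding order_on_def trans_def by blast
      then show ?thesis by blast
    qed (use x in blast)
  qed
  then show ?thesis using that by blast
qed

lemma order_on_subset: "order_on A r \<Longrightarrow> A' \<subseteq> A \<Longrightarrow> order_on A' r"
  unfolding order_on_def by (meson total_on_subset)

text \<open>Unlike independence, this property is inherited by deletion, by contraction, and by removing the smallest element of \<open>I\<close>.\<close>

definition terminal :: "'i set \<Rightarrow> ('i \<times> 'i) set \<Rightarrow> 'i set \<Rightarrow> bool" where
  "terminal A r I \<longleftrightarrow> I \<subseteq> A \<and> (\<forall>y\<in>A - I. \<forall>z\<in>I. (y, z) \<in> r)"

lemma dim_kernel_space_empty: "fn.dim (kernel_space {0} {} {} j) = card (rel_internal_bases {0} {} {} r j)"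
proof (cases "j = 0")
  case True
  have "rel_internal_bases {0} {} {} r 0 = {{}}"
    by (auto simp: rel_internal_bases_def rel_basis_def rel_valuation_def annihilator_def)
  moreover have "fn.dim (kernel_space {0} {} {} 0) = 1"
  proof (rule fn.dim_unique[of "{form_prod {0} {}}"])
    show "{form_prod {0} {}} \<subseteq> kernel_space {0} {} {} 0"
      using form_prod_polyfun_on form_prod_hom[of "{0}" "{}"] by (auto simp: kernel_space_def hyperplane_normals_def subspace_single_0)
    show "kernel_space {0} {} {} 0 \<subseteq> fn.span {form_prod {0} {}}"
    proof
      fix f assume "f \<in> kernel_space {0} {} {} 0"
      from kernel_space_empty(1)[OF this] show "f \<in> fn.span {form_prod {0} {}}" by (auto simp: fn.span_singleton)
    qed
    have "form_prod {0} {} 0 \<noteq> 0" by (simp add: form_prod_def)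
    then have "form_prod {0} {} \<noteq> 0" by (metis zero_fun_apply)
    then show "fn.independent {form_prod {0} {}}" by (simp add: fn.dependent_single)
  qed auto
  ultimately show ?thesis using True by simp
next
  case False
  have "rel_internal_bases {0} {} {} r j = {}" using False by (auto simp: rel_internal_bases_def rel_basis_def rel_valuation_def)
  moreover have "kernel_space {0} {} {} j \<subseteq> {0}"
  proof
    fix f assume f: "f \<in> kernel_space {0} {} {} j"
    have "fun_scale (f 0) (form_prod {0} {}) = 0" using kernel_space_empty(2)[OF f False] by (simp add: fun_scale_def zero_fun_def)
    then show "f \<in> {0}" using kernel_space_empty(1)[OF f] by simp
  qed
  ultimately show ?thesis using dim_zero by simp
qed

text \<open>Deletion-contraction along the smallest element gives the inequality; for empty \<open>I\<close> the lifting
property of products makes the sequence exact, so that the inequality becomes an equality.\<close>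

lemma dim_kernel_space_upper:
  assumes "finite A" "subspace W" "annihilator W A = {0}" "order_on A r" "terminal A r I"
  shows "fn.dim (kernel_space W A I j) \<le> card (rel_internal_bases W A I r j) \<and> (I = {} \<longrightarrow> fn.dim (kernel_space W A I j) = card (rel_internal_bases W A I r j))"
  using assms
proof (induction "card A" arbitrary: A W I j)
  case 0
  then have "A = {}" "W = {0}" "I = {}" by (auto simp: annihilator_def terminal_def)
  then show ?case using dim_kernel_space_empty by simp
next
  case (Suc n)
  then have "A \<noteq> {}" by auto
  then obtain x where x: "x \<in> A" "\<And>y. y \<in> A - {x} \<Longrightarrow> (x, y) \<in> r"
    using order_on_min Suc.prems by metis
  have card: "n = card (A - {x})" and fin: "finite (A - {x})" using Suc x by auto
  have ord: "order_on (A - {x}) r" using Suc.prems order_on_subset by blast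
  have ter: "terminal (A - {x}) r (I - {x})" using Suc.prems by (auto simp: terminal_def)
  note IH = Suc.hyps(1)[OF card fin _ _ ord ter]
  note W = Suc.prems(2)
  show ?case
  proof (cases "\<forall>t\<in>W. v x \<bullet> t = 0")
    case True
    have "annihilator W (A - {x}) = annihilator W A" using True by (auto simp: annihilator_def)
    then show ?thesis
      using IH[OF W, of j] kernel_space_loop[of W x A I j] rel_internal_bases_loop[of W x A I r j] True Suc.prems by auto
  next
    case False
    then obtain w where w: "w \<in> W" "v x \<bullet> w \<noteq> 0" by auto
    let ?W = "orth_section W (v x)"
    let ?U = "kernel_space W A I j"
    have ro: "trans r" "irrefl r" using Suc.prems by (auto simp: order_on_def)
    have IA: "I = A" if "x \<in> I"
    proof (rule ccontr)
      assume "I \<noteq> A"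
      then obtain y where "y \<in> A - I" using Suc.prems by (auto simp: terminal_def)
      then have "(y, x) \<in> r" "(x, y) \<in> r" using that x Suc.prems by (auto simp: terminal_def)
      then show False using ro unfolding trans_def irrefl_def by blast
    qed
    show ?thesis
    proof (cases "x \<in> I \<and> annihilator W (A - {x}) \<noteq> {0}")
      case True
      then have "?U \<subseteq> {0}" using kernel_space_coloop[OF W Suc.prems(1) x(1) Suc.prems(3)] by blast
      then have "fn.dim ?U = 0" by (rule dim_zero)
      then show ?thesis using True by auto
    next
      case nc: False
      have AW: "annihilator ?W (A - {x}) = {0}" unfolding annihilator_sec using x Suc.prems by (simp add: insert_absorb)
      note IHc = IH[OF subspace_orth_section[OF W] AW]
      have split: "card (rel_internal_bases W A I r j) = (if j = 0 then 0 else card (rel_internal_bases W (A - {x}) (I - {x}) r (j - 1))) +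
          card (rel_internal_bases ?W (A - {x}) (I - {x}) r j)"
        using card_rel_internal_bases_split[OF W w x(1) Suc.prems(1) ro x(2)] nc by auto
      obtain S where S: "finite S" "?U \<subseteq> fn.span S" using kernel_space_finite_span Suc.prems by metis
      have rn: "fn.dim ?U = fn.dim {f \<in> ?U. restrict_to ?W f = 0} + fn.dim (restrict_to ?W ` ?U)"
        by (rule fn_pair.rank_nullity_on[OF subspace_kernel_space S]) (auto simp: restrict_to_linear)
      have im: "restrict_to ?W ` ?U \<subseteq> kernel_space ?W (A - {x}) (I - {x}) j" using kernel_space_restr[OF W x(1)] by blast
      obtain S' where S': "finite S'" "kernel_space ?W (A - {x}) (I - {x}) j \<subseteq> fn.span S'"
        using kernel_space_finite_span[OF fin subspace_orth_section[OF W] AW] by metis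
      have d_im: "fn.dim (restrict_to ?W ` ?U) \<le> card (rel_internal_bases ?W (A - {x}) (I - {x}) r j)"
        using fn.dim_mono_in_finite_span[OF im S'(2,1)] IHc[of j] by linarith
      have d_im_eq: "fn.dim (restrict_to ?W ` ?U) = card (rel_internal_bases ?W (A - {x}) (I - {x}) r j)" if "I = {}"
      proof -
        have "kernel_space ?W (A - {x}) {} j \<subseteq> restrict_to ?W ` kernel_space W A {} j"
        proof
          fix f assume "f \<in> kernel_space ?W (A - {x}) {} j"
          then have "f \<in> graded_central ?W (A - {x}) j" using kernel_space_subset_graded_central[OF fin subspace_orth_section[OF W] AW] by blast
          then obtain g where "g \<in> graded_central W A j" "restrict_to ?W g = f" using graded_central_lift[OF x(1)] by blast
          then show "f \<in> restrict_to ?W ` kernel_space W A {} j" using graded_central_subset_kernel_space[OF Suc.prems(1) W] by blast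
        qed
        then have "restrict_to ?W ` ?U = kernel_space ?W (A - {x}) (I - {x}) j" using im that by auto
        then show ?thesis using IHc[of j] that by simp
      qed
      let ?N = "{f \<in> ?U. restrict_to ?W f = 0}"
      have Nz: "f t = 0" if "f \<in> ?N" "t \<in> ?W" for f t
      proof -
        have "restrict_to ?W f t = 0" using that by simp
        then show ?thesis using that by simp
      qed
      show ?thesis
      proof (cases "annihilator W (A - {x}) = {0}")
        case False
        have "?N \<subseteq> {0}" 
          proof
          fix f assume f: "f \<in> ?N"
          then have "f \<in> ?U" by blast
          from kernel_space_kernel_coloop[OF W Suc.prems(1) x(1) Suc.prems(3) False this Nz[OF f]]
          show "f \<in> {0}" by simp
        qed
        then have "fn.dim ?N = 0" by (rule dim_zero)
        moreover have "rel_internal_bases W (A - {x}) (I - {x}) r (j - 1) = {}"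
        proof -
          have "\<not> rel_basis W (A - {x}) B" for B
            using annihilator_anti[of B "A - {x}" W] False annihilator_0[OF W] by (fastforce simp: rel_basis_def)
          then show ?thesis by (auto simp: rel_internal_bases_def)
        qed
        ultimately show ?thesis using rn d_im d_im_eq split by auto
      next
        case True
        let ?D = "kernel_space W (A - {x}) (I - {x}) (j - 1)"
        obtain T where T: "finite T" "?D \<subseteq> fn.span T" using kernel_space_finite_span[OF fin W True] by metis
        have "fn.dim ?D = fn.dim {q \<in> ?D. mult_form x q = 0} + fn.dim (mult_form x ` ?D)"
          by (rule fn_pair.rank_nullity_on[OF subspace_kernel_space T]) (auto simp: mult_form_linear)
        moreover have "{q \<in> ?D. mult_form x q = 0} \<subseteq> {0}"
          using mult_form_eq_0[OF W w] kernel_space_D(1) by blast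
        ultimately have dm: "fn.dim (mult_form x ` ?D) = fn.dim ?D" using dim_zero by simp
        have IHd: "fn.dim ?D \<le> card (rel_internal_bases W (A - {x}) (I - {x}) r (j - 1))"
          "I = {} \<Longrightarrow> fn.dim ?D = card (rel_internal_bases W (A - {x}) (I - {x}) r (j - 1))"
          using IH[OF W True, of "j - 1"] by auto
        have NK: "\<exists>q\<in>?D. f = mult_form x q \<and> (j = 0 \<longrightarrow> q = 0)" if f: "f \<in> ?N" for f
        proof -
          have "\<exists>q\<in>?D. (\<forall>t. f t = complex_of_real (v x \<bullet> t) * q t) \<and> (j = 0 \<longrightarrow> q = 0)"
            using f by (intro kernel_space_kernel[OF W Suc.prems(1) x(1) True w IA _ Nz[OF f]]) auto
          then show ?thesis unfolding mult_form_def by (metis ext)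
        qed
        show ?thesis
        proof (cases "j = 0")
          case True
          have "?N \<subseteq> {0}" using NK True mult_form_linear(3) by blast
          then have "fn.dim ?N = 0" by (rule dim_zero)
          then show ?thesis using rn d_im d_im_eq split True by auto
        next
          case j: False
          have sub: "?N \<subseteq> mult_form x ` ?D" using NK by blast
          obtain B where "finite B" "mult_form x ` ?D \<subseteq> fn.span B"
          proof -
            have "Vector_Spaces.linear fun_scale fun_scale (mult_form x)"
              by (auto simp: Vector_Spaces.linear_iff mult_form_linear fn.vector_space_axioms)
            then have "mult_form x ` ?D \<subseteq> fn.span (mult_form x ` T)"
              using fn_pair.linear_span_image[of "mult_form x" T] T by blast
            then show ?thesis using that T by blast
          qed
          then have "fn.dim ?N \<le> fn.dim (mult_form x ` ?D)" using fn.dim_mono_in_finite_span[OF sub] by blast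
          moreover have "?N = mult_form x ` ?D" if I: "I = {}"
          proof
            show "mult_form x ` ?D \<subseteq> ?N"
            proof
              fix f assume "f \<in> mult_form x ` ?D"
              then obtain q where q: "q \<in> kernel_space W (A - {x}) {} (j - 1)" "f = mult_form x q" using I by auto
              then have "q \<in> graded_central W (A - {x}) (j - 1)" using kernel_space_subset_graded_central[OF fin W True] by blast
              then have "f \<in> graded_central W A j" using graded_central_mul[OF Suc.prems(1) x(1)] q j by fastforce
              then have "f \<in> ?U" using graded_central_subset_kernel_space[OF Suc.prems(1) W] I by blast
              moreover have "restrict_to ?W f = 0" using q by (auto simp: restrict_to_def mult_form_def orth_section_def)
              ultimately show "f \<in> ?N" by blast
            qed
          qed (rule sub)
          ultimately show ?thesis using rn d_im d_im_eq split dm IHd j by auto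
        qed
      qed
    qed
  qed
qed

section \<open>Leading coefficients along the normal of a hyperplane\<close>

text \<open>The coefficient is constant along \<open>\<eta>\<close> for functions of degree at most \<open>k\<close>, so restricting it to
the section orthogonal to \<open>\<eta>\<close> loses nothing.\<close>

definition top_coeff :: "'a set \<Rightarrow> 'a \<Rightarrow> nat \<Rightarrow> ('a \<Rightarrow> complex) \<Rightarrow> 'a \<Rightarrow> complex" where
  "top_coeff W \<eta> k f = 
     restrict_to (orth_section W \<eta>) (\<lambda>t. coeff (THE q. \<forall>s. f (t + s *\<^sub>R \<eta>) = poly q (complex_of_real s)) k)"

lemma the_line_poly:
  assumes "\<And>s. f (t + s *\<^sub>R \<eta>) = poly q (complex_of_real s)"
  shows "(THE q. \<forall>s. f (t + s *\<^sub>R \<eta>) = poly q (complex_of_real s)) = q"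
  using assms line_poly_unique by (intro the_equality) metis+

lemma top_coeff_eq:
  assumes "\<And>s. f (t + s *\<^sub>R \<eta>) = poly q (complex_of_real s)" "t \<in> orth_section W \<eta>"
  shows "top_coeff W \<eta> k f t = coeff q k"
  using assms(2) by (simp add: top_coeff_def the_line_poly[of f t \<eta> q, OF assms(1)])

lemma top_coeff_outside: "t \<notin> orth_section W \<eta> \<Longrightarrow> top_coeff W \<eta> k f t = 0"
  by (simp add: top_coeff_def restrict_to_def)

lemma top_coeff_linear:
  assumes "subspace W" "\<eta> \<in> W" "f \<in> polyfun_on W"
  shows "g \<in> polyfun_on W \<Longrightarrow> top_coeff W \<eta> k (f + g) = top_coeff W \<eta> k f + top_coeff W \<eta> k g"
    and "top_coeff W \<eta> k (fun_scale c f) = fun_scale c (top_coeff W \<eta> k f)"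
proof -
  obtain P where P: "\<And>t s. t \<in> W \<Longrightarrow> f (t + s *\<^sub>R \<eta>) = poly (P t) (complex_of_real s)"
    using polyfun_on_line[OF assms(3,1,2)] by metis
  note S = subsetD[OF orth_section_subset]
  show "top_coeff W \<eta> k (f + g) = top_coeff W \<eta> k f + top_coeff W \<eta> k g" if "g \<in> polyfun_on W"
  proof
    fix t
    obtain Q where Q: "\<And>t s. t \<in> W \<Longrightarrow> g (t + s *\<^sub>R \<eta>) = poly (Q t) (complex_of_real s)"
      using polyfun_on_line[OF \<open>g \<in> polyfun_on W\<close> assms(1,2)] by metis
    show "top_coeff W \<eta> k (f + g) t = (top_coeff W \<eta> k f + top_coeff W \<eta> k g) t"
    proof (cases "t \<in> orth_section W \<eta>")
      case True
      have "top_coeff W \<eta> k (f + g) t = coeff (P t + Q t) k"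
        by (rule top_coeff_eq[OF _ True]) (simp add: P Q S[OF True])
      then show ?thesis
        using top_coeff_eq[of f t \<eta> "P t" W k] top_coeff_eq[of g t \<eta> "Q t" W k] P Q S[OF True] True by simp
    qed (simp add: top_coeff_outside)
  qed
  show "top_coeff W \<eta> k (fun_scale c f) = fun_scale c (top_coeff W \<eta> k f)"
  proof
    fix t
    show "top_coeff W \<eta> k (fun_scale c f) t = fun_scale c (top_coeff W \<eta> k f) t"
    proof (cases "t \<in> orth_section W \<eta>")
      case True
      have "top_coeff W \<eta> k (fun_scale c f) t = coeff (smult c (P t)) k"
        by (rule top_coeff_eq[OF _ True]) (simp add: P S[OF True] fun_scale_def)
      then show ?thesis
        using top_coeff_eq[of f t \<eta> "P t" W k] P S[OF True] True by (simp add: fun_scale_def)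
    qed (simp add: top_coeff_outside fun_scale_def)
  qed
qed

text \<open>Factors not orthogonal to \<open>\<eta>\<close> contribute a scalar each, the others survive unchanged.\<close>

lemma top_coeff_form_prod:
  assumes W: "subspace W" "\<eta> \<in> W" "finite Y" and k: "card (cocircuit Y \<eta>) \<le> k"
  shows "top_coeff W \<eta> k (form_prod W Y) = (if card (cocircuit Y \<eta>) = k 
     then fun_scale (\<Prod>y\<in>cocircuit Y \<eta>. complex_of_real (v y \<bullet> \<eta>)) (form_prod (orth_section W \<eta>) (Y - cocircuit Y \<eta>)) else 0)"
proof
  fix t
  let ?Q = "\<Prod>y\<in>Y. [:complex_of_real (v y \<bullet> t), complex_of_real (v y \<bullet> \<eta>):]"
  show "top_coeff W \<eta> k (form_prod W Y) t = (if card (cocircuit Y \<eta>) = k 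
     then fun_scale (\<Prod>y\<in>cocircuit Y \<eta>. complex_of_real (v y \<bullet> \<eta>)) (form_prod (orth_section W \<eta>) (Y - cocircuit Y \<eta>)) else 0) t"
  proof (cases "t \<in> orth_section W \<eta>")
    case True
    then have t: "t \<in> W" using orth_section_subset by blast
    have 1: "top_coeff W \<eta> k (form_prod W Y) t = coeff ?Q k"
      by (rule top_coeff_eq[OF _ True]) (rule form_prod_line[OF W(1) t W(2)])
    have c: "{y\<in>Y. complex_of_real (v y \<bullet> \<eta>) \<noteq> 0} = cocircuit Y \<eta>" by (auto simp: cocircuit_def)
    have c': "{y\<in>Y. complex_of_real (v y \<bullet> \<eta>) = 0} = Y - cocircuit Y \<eta>" by (auto simp: cocircuit_def)
    have 2: "degree ?Q \<le> card (cocircuit Y \<eta>)" 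
      "coeff ?Q (card (cocircuit Y \<eta>)) = (\<Prod>y\<in>cocircuit Y \<eta>. complex_of_real (v y \<bullet> \<eta>)) * (\<Prod>y\<in>Y - cocircuit Y \<eta>. complex_of_real (v y \<bullet> t))"
      using degree_coeff_prod_linear[OF W(3), of "\<lambda>y. complex_of_real (v y \<bullet> t)" "\<lambda>y. complex_of_real (v y \<bullet> \<eta>)"]
      unfolding c c' by auto
    show ?thesis
    proof (cases "card (cocircuit Y \<eta>) = k")
      case True
      then show ?thesis using 1 2 \<open>t \<in> orth_section W \<eta>\<close> by (simp add: fun_scale_def form_prod_def)
    next
      case False
      then have "coeff ?Q k = 0" using 2(1) k by (intro coeff_eq_0) auto
      then show ?thesis using 1 False by simp
    qed
  qed (simp add: top_coeff_outside fun_scale_def form_prod_def restrict_to_def)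
qed

text \<open>The coefficient in question is nonzero only if \<open>Y\<close> misses a single element \<open>a\<close> of the cocircuit. Then the
remaining elements outside \<open>Y\<close>, all of them orthogonal to \<open>\<eta>\<close>, must span the hyperplane, for
together with \<open>a\<close> they span everything.\<close>

lemma top_coeff_graded_central:
  assumes "finite A" "subspace W" "\<eta> \<in> W" "\<eta> \<noteq> 0" and f: "f \<in> graded_central W A j" and k: "k = card (cocircuit A \<eta>) - 1"
  shows "top_coeff W \<eta> k f \<in> (if k \<le> j then graded_central (orth_section W \<eta>) (A - cocircuit A \<eta>) (j - k) else {0})"
proof -
  let ?W = "orth_section W \<eta>" and ?H = "A - cocircuit A \<eta>"
  let ?T = "if k \<le> j then graded_central ?W ?H (j - k) else {0}"
  have sT: "fn.subspace ?T" by (simp add: graded_central_def)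
  have gen: "top_coeff W \<eta> k (form_prod W Y) \<in> ?T" if Y: "Y \<subseteq> A" "card Y = j" "annihilator W (A - Y) = {0}" for Y
  proof -
    have fin: "finite Y" "finite (cocircuit A \<eta>)" "finite (cocircuit Y \<eta>)"
      using finite_subset[OF Y(1) assms(1)] assms(1) by (auto simp: cocircuit_def)
    have ne: "cocircuit (A - Y) \<eta> \<noteq> {}" using cocircuit_nonempty[OF Y(3) assms(3,4)] .
    have un: "cocircuit A \<eta> = cocircuit Y \<eta> \<union> cocircuit (A - Y) \<eta>" "cocircuit Y \<eta> \<inter> cocircuit (A - Y) \<eta> = {}"
      using Y by (auto simp: cocircuit_def)
    then have cu: "card (cocircuit A \<eta>) = card (cocircuit Y \<eta>) + card (cocircuit (A - Y) \<eta>)"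
      using fin by (metis card_Un_disjoint finite_Un)
    moreover have "card (cocircuit (A - Y) \<eta>) > 0" using ne fin un by (metis card_gt_0_iff finite_Un)
    ultimately have le: "card (cocircuit Y \<eta>) \<le> k" using k by linarith
    show ?thesis
    proof (cases "card (cocircuit Y \<eta>) = k")
      case False
      then have "top_coeff W \<eta> k (form_prod W Y) = 0" using top_coeff_form_prod[OF assms(2,3) fin(1) le] by simp
      then show ?thesis using fn.subspace_0[OF sT] by argo
    next
      case True
      let ?Y = "Y - cocircuit Y \<eta>"
      have cY: "cocircuit Y \<eta> \<subseteq> Y" by (auto simp: cocircuit_def)
      have kj: "k \<le> j" using True cY fin Y by (metis card_mono)
      have cardY: "card ?Y = j - k" using True cY fin Y by (simp add: card_Diff_subset)
      have "card (cocircuit (A - Y) \<eta>) = 1" using cu True k \<open>card (cocircuit (A - Y) \<eta>) > 0\<close> by linarith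
      then obtain a where a: "cocircuit (A - Y) \<eta> = {a}" using card_1_singletonE by blast
      have "annihilator ?W (?H - ?Y) \<subseteq> {0}"
      proof
        fix \<xi> assume \<xi>: "\<xi> \<in> annihilator ?W (?H - ?Y)"
        have \<xi>W: "\<xi> \<in> W" "\<eta> \<bullet> \<xi> = 0" using \<xi> by (auto simp: annihilator_def orth_section_def)
        have a\<eta>: "v a \<bullet> \<eta> \<noteq> 0" using a by (auto simp: cocircuit_def)
        \<comment> \<open>Corrected by a multiple of \<open>\<eta>\<close> to be orthogonal to \<open>a\<close> as well.\<close>
        let ?\<zeta> = "\<xi> - ((v a \<bullet> \<xi>) / (v a \<bullet> \<eta>)) *\<^sub>R \<eta>"
        have "v b \<bullet> ?\<zeta> = 0" if b: "b \<in> A - Y" for b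
        proof (cases "b = a")
          case True
          then show ?thesis using a\<eta> by (simp add: inner_diff_right)
        next
          case False
          then have b0: "v b \<bullet> \<eta> = 0" using a b by (auto simp: cocircuit_def)
          then have "b \<in> ?H - ?Y" using b by (auto simp: cocircuit_def)
          then show ?thesis using \<xi> b0 by (simp add: inner_diff_right annihilator_def)
        qed
        then have "?\<zeta> \<in> annihilator W (A - Y)"
          using \<xi>W assms by (auto simp: annihilator_def subspace_diff subspace_scale)
        then have "\<xi> = ((v a \<bullet> \<xi>) / (v a \<bullet> \<eta>)) *\<^sub>R \<eta>" using Y(3) by auto
        then have "\<eta> \<bullet> \<xi> = ((v a \<bullet> \<xi>) / (v a \<bullet> \<eta>)) * (\<eta> \<bullet> \<eta>)" by (metis inner_scaleR_right)
        then have "(v a \<bullet> \<xi>) / (v a \<bullet> \<eta>) = 0" using \<xi>W assms(4) by simp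
        then have "\<xi> = 0" using \<open>\<xi> = _ *\<^sub>R \<eta>\<close> by (metis scaleR_zero_left)
        then show "\<xi> \<in> {0}" by simp
      qed
      then have "annihilator ?W (?H - ?Y) = {0}" using annihilator_0[OF subspace_orth_section[OF assms(2)]] by blast
      moreover have "?Y \<subseteq> ?H" using Y by (auto simp: cocircuit_def)
      ultimately have "form_prod ?W ?Y \<in> graded_central ?W ?H (j - k)" unfolding graded_central_def using cardY by (intro fn.span_base) auto
      then have "fun_scale (\<Prod>y\<in>cocircuit Y \<eta>. complex_of_real (v y \<bullet> \<eta>)) (form_prod ?W ?Y) \<in> graded_central ?W ?H (j - k)"
        unfolding graded_central_def by (rule fn.span_scale)
      then show ?thesis using top_coeff_form_prod[OF assms(2,3) fin(1) le] True kj by simp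
    qed
  qed
  let ?G = "{form_prod W Y | Y. Y \<subseteq> A \<and> card Y = j \<and> annihilator W (A - Y) = {0}}"
  let ?V = "{f \<in> polyfun_on W. top_coeff W \<eta> k f \<in> ?T}"
  have "fn.subspace ?V"
  proof (rule fn.subspaceI)
    have 0: "0 \<in> polyfun_on W" using subspace_polyfun_on fn.subspace_0 by blast
    have "top_coeff W \<eta> k (fun_scale 0 0) = fun_scale 0 (top_coeff W \<eta> k 0)"
      using top_coeff_linear(2)[OF assms(2,3) 0] .
    then have "top_coeff W \<eta> k 0 = 0" by (simp add: fn.scale_zero_left)
    then show "0 \<in> ?V" using 0 fn.subspace_0[OF sT] by simp
  next
    fix a b assume "a \<in> ?V" "b \<in> ?V"
    then show "a + b \<in> ?V"
      using top_coeff_linear(1)[OF assms(2,3), of a b k] fn.subspace_add[OF sT] fn.subspace_add[OF subspace_polyfun_on]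
      by auto
  next
    fix c a assume "a \<in> ?V"
    then show "fun_scale c a \<in> ?V"
      using top_coeff_linear(2)[OF assms(2,3), of a k c] fn.subspace_scale[OF sT] fn.subspace_scale[OF subspace_polyfun_on]
      by auto
  qed
  moreover have "?G \<subseteq> ?V" using gen form_prod_polyfun_on by blast
  ultimately have "fn.span ?G \<subseteq> ?V" by (rule fn.span_minimal[rotated])
  then show ?thesis using f unfolding graded_central_def by blast
qed

text \<open>Imposing the sharper bounds for a single \<open>b\<close> in \<open>I\<close> already gives the degree bounds of \<open>A - {b}\<close>,
hence membership in its central space.\<close>

lemma kernel_space_subset_graded_central_remove:
  assumes "finite A" "subspace W" "annihilator W A = {0}" "b \<in> A" "b \<in> I" "f \<in> kernel_space W A I j"
  shows "f \<in> graded_central W (A - {b}) j"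
proof (cases "annihilator W (A - {b}) = {0}")
  case False
  then have "f = 0" using kernel_space_coloop[OF assms(2,1,4,3) False assms(6,5)] by simp
  then show ?thesis by (simp add: graded_central_def fn.span_zero)
next
  case True
  have "dir_degree_less W \<eta> (card (cocircuit (A - {b}) \<eta>) - degree_drop {} \<eta>) f" if \<eta>: "\<eta> \<in> hyperplane_normals W (A - {b})" for \<eta>
  proof -
    have "\<eta> \<in> hyperplane_normals W A" using \<eta> hyperplane_normals_mono[of "A - {b}" A W] by auto
    then have "dir_degree_less W \<eta> (card (cocircuit A \<eta>) - degree_drop I \<eta>) f" using kernel_space_D(3)[OF assms(6)] by blast
    moreover have "v b \<bullet> \<eta> \<noteq> 0 \<Longrightarrow> degree_drop I \<eta> = 1" using assms(5) by (auto simp: degree_drop_def cocircuit_def)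
    ultimately show ?thesis
      using cocircuit_remove[OF assms(1,4), of \<eta>]
      by (auto intro: dir_degree_less_mono simp: degree_drop_def cocircuit_def split: if_splits)
  qed
  then have "f \<in> kernel_space W (A - {b}) {} j" using kernel_space_D[OF assms(6)] by (auto simp: kernel_space_def)
  then show ?thesis using kernel_space_subset_graded_central[OF _ assms(2) True] assms(1) by blast
qed

text \<open>Converse direction: if \<open>I\<close> is not contained in a hyperplane, some \<open>b\<close> in \<open>I\<close> lies outside, and
removing this \<open>b\<close> lowers the bound by one.\<close>

lemma in_kernel_space_of_dir_degree_less_remove:
  assumes "finite A" "I \<subseteq> A" "f \<in> polyfun_on W" "f \<in> homogeneous_funs j" 
    and A: "\<And>\<eta>. \<eta> \<in> W \<Longrightarrow> \<eta> \<noteq> 0 \<Longrightarrow> dir_degree_less W \<eta> (card (cocircuit A \<eta>)) f"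
    and I: "\<And>\<eta> b. \<eta> \<in> W \<Longrightarrow> \<eta> \<noteq> 0 \<Longrightarrow> b \<in> I \<Longrightarrow> dir_degree_less W \<eta> (card (cocircuit (A - {b}) \<eta>)) f"
  shows "f \<in> kernel_space W A I j"
proof -
  have "dir_degree_less W \<eta> (card (cocircuit A \<eta>) - degree_drop I \<eta>) f" if \<eta>: "\<eta> \<in> hyperplane_normals W A" for \<eta>
  proof (cases "cocircuit I \<eta> = {}")
    case True
    then show ?thesis using A \<eta> by (auto simp: degree_drop_def hyperplane_normals_def)
  next
    case False
    then obtain b where b: "b \<in> I" "v b \<bullet> \<eta> \<noteq> 0" by (auto simp: cocircuit_def)
    then have "dir_degree_less W \<eta> (card (cocircuit (A - {b}) \<eta>)) f"
      using I \<eta> by (auto simp: hyperplane_normals_def)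
    moreover have "b \<in> A" using b assms(2) by auto
    ultimately show ?thesis using cocircuit_remove[OF assms(1) \<open>b \<in> A\<close>, of \<eta>] b False by (simp add: degree_drop_def)
  qed
  then show ?thesis using assms(3,4) by (auto simp: kernel_space_def)
qed

lemma in_kernel_space_of_graded_central_remove:
  assumes "finite A" "subspace W" "I \<subseteq> A" "f \<in> graded_central W A j" "\<And>b. b \<in> I \<Longrightarrow> f \<in> graded_central W (A - {b}) j"
  shows "f \<in> kernel_space W A I j"
  using graded_central_subset_homogeneous[OF assms(2)] assms(1,4) graded_central_dir_degree_less[OF assms(1,2)] 
    graded_central_dir_degree_less[OF _ assms(2) _ _ assms(5)] by (intro in_kernel_space_of_dir_degree_less_remove assms) auto

text \<open>Taking the coefficient maps central spaces to central spaces. The semi-internal bounds follow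
because \<open>J\<close> lies in the hyperplane, so that removing an element of \<open>J\<close> does not change the cocircuit.\<close>

lemma top_coeff_kernel_space:
  assumes "finite A" "subspace W" "annihilator W A = {0}" "\<eta> \<in> W" "\<eta> \<noteq> 0" 
    and J: "J \<subseteq> A - cocircuit A \<eta>" and f: "f \<in> kernel_space W A J j" and k: "k = card (cocircuit A \<eta>) - 1"
  shows "top_coeff W \<eta> k f \<in> (if k \<le> j then kernel_space (orth_section W \<eta>) (A - cocircuit A \<eta>) J (j - k) else {0})"
proof -
  have P: "f \<in> graded_central W A j" using kernel_space_subset_graded_central[OF assms(1-3)] kernel_space_mono_empty f by blast
  note T = top_coeff_graded_central[OF assms(1,2,4,5) P k]
  show ?thesis
  proof (cases "k \<le> j")
    case True
    have "top_coeff W \<eta> k f \<in> kernel_space (orth_section W \<eta>) (A - cocircuit A \<eta>) J (j - k)"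
    proof (rule in_kernel_space_of_graded_central_remove[OF _ subspace_orth_section[OF assms(2)] J])
      show "top_coeff W \<eta> k f \<in> graded_central (orth_section W \<eta>) (A - cocircuit A \<eta>) (j - k)" using T True by simp
      fix b assume b: "b \<in> J"
      have "f \<in> graded_central W (A - {b}) j" using kernel_space_subset_graded_central_remove[OF assms(1-3) _ b f] b J by blast
      moreover have "cocircuit (A - {b}) \<eta> = cocircuit A \<eta>" using b J by (auto simp: cocircuit_def)
      moreover have "A - {b} - cocircuit A \<eta> = A - cocircuit A \<eta> - {b}" by auto
      ultimately show "top_coeff W \<eta> k f \<in> graded_central (orth_section W \<eta>) (A - cocircuit A \<eta> - {b}) (j - k)"
        using top_coeff_graded_central[of "A - {b}" W \<eta> f j k] assms True by simp
    qed (use assms in auto)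
    then show ?thesis using True by simp
  qed (use T in auto)
qed

text \<open>The leading coefficient is constant along each line parallel to \<open>\<eta>\<close>, so it is enough that it vanishes
where the line meets the orthogonal section.\<close>

lemma dir_degree_less_of_top_coeff_zero:
  assumes W: "subspace W" "\<eta> \<in> W" "\<eta> \<noteq> 0" and d: "dir_degree_less W \<eta> m f" and f: "f \<in> polyfun_on W"
    and z: "top_coeff W \<eta> (m - 1) f = 0"
  shows "dir_degree_less W \<eta> (m - 1) f"
proof (cases "m = 0")
  case False
  obtain P where P: "\<And>t s. t \<in> W \<Longrightarrow> f (t + s *\<^sub>R \<eta>) = poly (P t) (complex_of_real s)"
    using polyfun_on_line[OF f W(1,2)] by metis
  have hi: "coeff (P t) i = 0" if "t \<in> W" "i \<ge> m" for t i
    using dir_degree_lessD[OF d that(1) _ that(2)] P that by blast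
  have "coeff (P t) (m - 1) = 0" if t: "t \<in> W" for t
  proof -
    define c where "c = (\<eta> \<bullet> t) / (\<eta> \<bullet> \<eta>)"
    define t' where "t' = t - c *\<^sub>R \<eta>"
    have t': "t' \<in> W" "t' \<in> orth_section W \<eta>" using t W 
      by (auto simp: t'_def c_def orth_section_def subspace_diff subspace_scale inner_diff_right)
    have "coeff (P t') (m - 1) = 0"
      using top_coeff_eq[of f t' \<eta> "P t'" W "m - 1"] P t' z by simp
    then have "coeff (P t') i = 0" if "i \<ge> m - 1" for i
      using hi[OF t'(1), of i] that False by (cases "i = m - 1") auto
    then have deg: "P t' = 0 \<or> degree (P t') < m - 1" by (metis leading_coeff_0_iff not_le)
    have "P t = P t' \<circ>\<^sub>p [:complex_of_real c, 1:]"
    proof (rule line_poly_unique)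
      fix s
      have "f (t + s *\<^sub>R \<eta>) = f (t' + (c + s) *\<^sub>R \<eta>)" by (simp add: t'_def algebra_simps)
      then show "poly (P t) (complex_of_real s) = poly (P t' \<circ>\<^sub>p [:complex_of_real c, 1:]) (complex_of_real s)"
        using P[OF t] P[OF t'(1)] by (simp add: poly_pcompose)
    qed
    moreover have "coeff (P t' \<circ>\<^sub>p [:complex_of_real c, 1:]) (m - 1) = 0" if "P t' \<noteq> 0"
      using deg that by (intro coeff_eq_0) (simp add: degree_pcompose)
    ultimately show ?thesis by (cases "P t' = 0") auto
  qed
  then have "coeff (P t) i = 0" if "t \<in> W" "i \<ge> m - 1" for t i
    using hi[OF that(1), of i] that by (cases "i = m - 1") auto
  then show ?thesis unfolding dir_degree_less_def using P by blast
qed (use d in simp)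

section \<open>The lower bound\<close>

lemma orth_section_decompose:
  assumes "subspace W" "\<eta> \<in> W" "\<eta> \<noteq> 0" "\<zeta> \<in> W"
  shows "\<exists>c. \<zeta> - c *\<^sub>R \<eta> \<in> orth_section W \<eta>"
  using assms by (intro exI[of _ "(\<eta> \<bullet> \<zeta>) / (\<eta> \<bullet> \<eta>)"])
    (auto simp: orth_section_def subspace_diff subspace_scale inner_diff_right)

context
  fixes W :: "'a set" and A :: "'i set" and \<eta> :: 'a and b :: 'i
  assumes W: "subspace W" and \<eta>: "\<eta> \<in> W" "\<eta> \<noteq> 0" and b: "b \<in> cocircuit A \<eta>"
begin

text \<open>Adding a multiple of \<open>\<eta>\<close> to a functional changes nothing on the hyperplane and can be used to make
it vanish at \<open>b\<close>.\<close>

lemma annihilator_insert_lift: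
  assumes "\<zeta> \<in> annihilator (orth_section W \<eta>) S" "S \<subseteq> A - cocircuit A \<eta>"
  shows "\<exists>\<zeta>'\<in>annihilator W (insert b S). (\<zeta> \<noteq> 0 \<longrightarrow> \<zeta>' \<noteq> 0) \<and> (\<forall>y\<in>A - cocircuit A \<eta>. v y \<bullet> \<zeta>' = v y \<bullet> \<zeta>)"
proof -
  let ?c = "(v b \<bullet> \<zeta>) / (v b \<bullet> \<eta>)"
  have b\<eta>: "v b \<bullet> \<eta> \<noteq> 0" using b by (auto simp: cocircuit_def)
  have \<zeta>: "\<zeta> \<in> W" "\<eta> \<bullet> \<zeta> = 0" "\<And>s. s \<in> S \<Longrightarrow> v s \<bullet> \<zeta> = 0" using assms(1) by (auto simp: annihilator_def orth_section_def)
  have y: "v y \<bullet> (\<zeta> - ?c *\<^sub>R \<eta>) = v y \<bullet> \<zeta>" if "y \<in> A - cocircuit A \<eta>" for y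
    using that by (auto simp: cocircuit_def inner_diff_right)
  have "v s \<bullet> (\<zeta> - ?c *\<^sub>R \<eta>) = 0" if "s \<in> insert b S" for s
  proof (cases "s = b")
    case True
    then show ?thesis using b\<eta> by (simp add: inner_diff_right)
  next
    case False
    then show ?thesis using that y[of s] \<zeta>(3)[of s] assms(2) by auto
  qed
  then have "\<zeta> - ?c *\<^sub>R \<eta> \<in> annihilator W (insert b S)"
    using \<zeta> W \<eta> unfolding annihilator_def by (auto simp: subspace_diff subspace_scale)
  moreover have "\<zeta> - ?c *\<^sub>R \<eta> \<noteq> 0" if "\<zeta> \<noteq> 0"
  proof
    assume "\<zeta> - ?c *\<^sub>R \<eta> = 0"
    then have "\<zeta> \<bullet> \<zeta> = \<zeta> \<bullet> (?c *\<^sub>R \<eta>)" by simp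
    also have "\<dots> = 0" using \<zeta>(2) by (simp add: inner_commute)
    finally show False using that by simp
  qed
  ultimately show ?thesis using y by blast
qed

lemma annihilator_project:
  assumes "\<zeta> \<in> annihilator W S" "S \<subseteq> A - cocircuit A \<eta>"
  shows "\<exists>c. \<zeta> - c *\<^sub>R \<eta> \<in> annihilator (orth_section W \<eta>) S"
proof -
  have "\<zeta> \<in> W" using assms by (auto simp: annihilator_def)
  then obtain c where c: "\<zeta> - c *\<^sub>R \<eta> \<in> orth_section W \<eta>" using orth_section_decompose[OF W \<eta>] by blast
  have "v s \<bullet> (\<zeta> - c *\<^sub>R \<eta>) = 0" if "s \<in> S" for s
    using that assms by (auto simp: annihilator_def cocircuit_def inner_diff_right)
  then show ?thesis using c by (auto simp: annihilator_def)
qed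

lemma closure_in_hyperplane:
  assumes "y \<in> A - cocircuit A \<eta>" "S \<subseteq> A - cocircuit A \<eta>"
  shows "y \<in> closure_in W S \<longleftrightarrow> y \<in> closure_in (orth_section W \<eta>) S" "y \<in> closure_in W (insert b S) \<longleftrightarrow> y \<in> closure_in (orth_section W \<eta>) S"
proof -
  have 1: "y \<in> closure_in W (insert b S)" if "y \<in> closure_in W S" using that by (auto simp: closure_in_def annihilator_def)
  have 2: "y \<in> closure_in (orth_section W \<eta>) S" if y: "y \<in> closure_in W (insert b S)"
    unfolding closure_in_def
  proof safe
    fix \<zeta> assume "\<zeta> \<in> annihilator (orth_section W \<eta>) S"
    then obtain \<zeta>' where "\<zeta>' \<in> annihilator W (insert b S)" "v y \<bullet> \<zeta>' = v y \<bullet> \<zeta>"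
      using annihilator_insert_lift[OF _ assms(2)] assms(1) by blast
    then show "v y \<bullet> \<zeta> = 0" using y by (auto simp: closure_in_def)
  qed
  have 3: "y \<in> closure_in W S" if y: "y \<in> closure_in (orth_section W \<eta>) S"
    unfolding closure_in_def
  proof safe
    fix \<zeta> assume "\<zeta> \<in> annihilator W S"
    then obtain c where "\<zeta> - c *\<^sub>R \<eta> \<in> annihilator (orth_section W \<eta>) S" using annihilator_project[OF _ assms(2)] by blast
    then have "v y \<bullet> (\<zeta> - c *\<^sub>R \<eta>) = 0" using y by (auto simp: closure_in_def)
    then show "v y \<bullet> \<zeta> = 0" using assms(1) by (auto simp: cocircuit_def inner_diff_right)
  qed
  show "y \<in> closure_in W S \<longleftrightarrow> y \<in> closure_in (orth_section W \<eta>) S" "y \<in> closure_in W (insert b S) \<longleftrightarrow> y \<in> closure_in (orth_section W \<eta>) S"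
    using 1 2 3 by blast+
qed

lemma rel_basis_insert_hyperplane:
  assumes B: "rel_basis (orth_section W \<eta>) (A - cocircuit A \<eta>) B"
  shows "rel_basis W A (insert b B)" "\<zeta> \<in> annihilator W B \<Longrightarrow> \<exists>c. \<zeta> = c *\<^sub>R \<eta>" "\<eta> \<in> annihilator W B" "b \<notin> B"
proof -
  have BH: "B \<subseteq> A - cocircuit A \<eta>" and B0: "annihilator (orth_section W \<eta>) B = {0}" using B by (auto simp: rel_basis_def)
  show bB: "b \<notin> B" using BH b by auto
  show line: "\<exists>c. \<zeta> = c *\<^sub>R \<eta>" if "\<zeta> \<in> annihilator W B" for \<zeta>
    using annihilator_project[OF that BH] B0 by auto
  show \<eta>B: "\<eta> \<in> annihilator W B" using BH \<eta> by (auto simp: annihilator_def cocircuit_def)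
  have "annihilator W (insert b B) \<subseteq> {0}"
  proof
    fix \<zeta> assume \<zeta>: "\<zeta> \<in> annihilator W (insert b B)"
    then have "\<zeta> \<in> annihilator W B" by (auto simp: annihilator_def)
    then obtain c where c: "\<zeta> = c *\<^sub>R \<eta>" using line by blast
    then show "\<zeta> \<in> {0}" using \<zeta> b by (auto simp: annihilator_def cocircuit_def)
  qed
  then have "annihilator W (insert b B) = {0}" using annihilator_0[OF W] by blast
  moreover have "annihilator W (insert b B - {b'}) \<noteq> {0}" if "b' \<in> insert b B" for b'
  proof (cases "b' = b")
    case True
    then have "insert b B - {b'} = B" using bB by auto
    then show ?thesis using \<eta>B \<eta> by auto
  next
    case False
    then have b': "b' \<in> B" "insert b B - {b'} = insert b (B - {b'})" using that by auto
    then obtain \<zeta> where "\<zeta> \<in> annihilator (orth_section W \<eta>) (B - {b'})" "\<zeta> \<noteq> 0"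
      using B annihilator_0[OF subspace_orth_section[OF W]] unfolding rel_basis_def by blast
    then obtain \<zeta>' where "\<zeta>' \<in> annihilator W (insert b (B - {b'}))" "\<zeta>' \<noteq> 0"
      using annihilator_insert_lift[of \<zeta> "B - {b'}"] BH by blast
    then show ?thesis using b' by auto
  qed
  ultimately show "rel_basis W A (insert b B)" using BH b by (auto simp: rel_basis_def cocircuit_def)
qed

text \<open>All of \<open>J\<close> lies in the hyperplane, so \<open>b\<close> is the largest element outside it and is active. The other
elements outside precede \<open>b\<close>; each is outside the span of the basis elements before it and adds
one to the valuation. Inside the hyperplane, the presence of \<open>b\<close> does not affect any closure.\<close>

lemma rel_internal_bases_insert_hyperplane:
  assumes fin: "finite A" and ord: "order_on A r"
    and J: "J \<subseteq> A - cocircuit A \<eta>" "\<And>y. y \<in> A - insert b J \<Longrightarrow> (y, b) \<in> r"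
    and k: "k = card (cocircuit A \<eta>) - 1" "k \<le> j"
    and B: "B \<in> rel_internal_bases (orth_section W \<eta>) (A - cocircuit A \<eta>) J r (j - k)"
  shows "insert b B \<in> rel_internal_bases W A J r j" "rel_active W A (insert b J) r (insert b B) b"
proof -
  let ?W = "orth_section W \<eta>" and ?H = "A - cocircuit A \<eta>"
  have bas: "rel_basis ?W ?H B" using B by (simp add: rel_internal_bases_def)
  note bi = rel_basis_insert_hyperplane[OF bas]
  have BH: "B \<subseteq> ?H" using bas by (simp add: rel_basis_def)
  have bA: "b \<in> A" using b by (auto simp: cocircuit_def)
  have rem: "insert b B - {b} = B" using bi(4) by auto
  show rel_active: "rel_active W A (insert b J) r (insert b B) b"
    unfolding rel_active_def rem
  proof (intro conjI ballI impI)
    fix y assume y: "y \<in> A - {b}" "y \<notin> closure_in W B"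
    have "y \<notin> J"
    proof
      assume "y \<in> J"
      then have "v y \<bullet> \<eta> = 0" using J(1) by (auto simp: cocircuit_def)
      then have "y \<in> closure_in W B" using bi(2) by (force simp: closure_in_def)
      then show False using y by simp
    qed
    then show "(y, b) \<in> r" using J(2) y by auto
  qed auto
  have "\<not> rel_active W A J r (insert b B) b'" if b': "b' \<in> insert b B" for b'
  proof
    assume a: "rel_active W A J r (insert b B) b'"
    then have "b' \<noteq> b" using J(1) b by (auto simp: rel_active_def)
    then have b'B: "b' \<in> B" and rem': "insert b B - {b'} = insert b (B - {b'})" using b' by auto
    have "rel_active ?W ?H J r B b'"
      unfolding rel_active_def
    proof (intro conjI ballI impI)
      show "b' \<in> B" by (rule b'B)
      show "b' \<in> J" using a by (simp add: rel_active_def)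
      fix y assume y: "y \<in> ?H - {b'}" "y \<notin> closure_in ?W (B - {b'})"
      then have "y \<notin> closure_in W (insert b (B - {b'}))" using closure_in_hyperplane(2)[of y "B - {b'}"] BH by blast
      then show "(y, b') \<in> r" using a y unfolding rel_active_def rem' by blast
    qed
    then show False using B b'B by (auto simp: rel_internal_bases_def)
  qed
  moreover have "rel_valuation W A r (insert b B) = j"
  proof -
    let ?S = "\<lambda>x. {b'\<in>insert b B. (b', x) \<in> r}"
    have "x \<notin> closure_in W (?S x)" if x: "x \<in> cocircuit A \<eta> - {b}" for x
    proof -
      have "x \<notin> insert b J" using x J(1) by auto
      then have "(x, b) \<in> r" using J(2) x by (auto simp: cocircuit_def)
      then have "(b, x) \<notin> r" using ord unfolding order_on_def trans_def irrefl_def by blast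
      then have "?S x \<subseteq> B" by auto
      then have "\<eta> \<in> annihilator W (?S x)" using bi(3) by (auto simp: annihilator_def)
      moreover have "v x \<bullet> \<eta> \<noteq> 0" using x by (auto simp: cocircuit_def)
      ultimately show ?thesis by (auto simp: closure_in_def)
    qed
    moreover have "x \<in> closure_in W (?S x) \<longleftrightarrow> x \<in> closure_in ?W {b'\<in>B. (b', x) \<in> r}" if x: "x \<in> ?H" for x
    proof (cases "(b, x) \<in> r")
      case True
      then have "?S x = insert b {b'\<in>B. (b', x) \<in> r}" by auto
      then show ?thesis using closure_in_hyperplane(2)[OF x, of "{b'\<in>B. (b', x) \<in> r}"] BH by auto
    next
      case False
      then have "?S x = {b'\<in>B. (b', x) \<in> r}" by auto
      then show ?thesis using closure_in_hyperplane(1)[OF x, of "{b'\<in>B. (b', x) \<in> r}"] BH by auto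
    qed
    ultimately have "{x \<in> A - insert b B. x \<notin> closure_in W (?S x)} =
       (cocircuit A \<eta> - {b}) \<union> {x \<in> ?H - B. x \<notin> closure_in ?W {b'\<in>B. (b', x) \<in> r}}"
      using b BH by (auto simp: cocircuit_def)
    moreover have "(cocircuit A \<eta> - {b}) \<inter> {x \<in> ?H - B. x \<notin> closure_in ?W {b'\<in>B. (b', x) \<in> r}} = {}" by auto
    moreover have "finite (cocircuit A \<eta>)" using fin by (auto simp: cocircuit_def)
    ultimately have "rel_valuation W A r (insert b B) = card (cocircuit A \<eta> - {b}) + rel_valuation ?W ?H r B"
      using fin by (simp add: rel_valuation_def card_Un_disjoint)
    also have "\<dots> = k + (j - k)" using B b k by (simp add: rel_internal_bases_def)
    finally show ?thesis using k by simp
  qed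
  ultimately show "insert b B \<in> rel_internal_bases W A J r j" using bi(1) by (simp add: rel_internal_bases_def)
qed

end

lemma rel_internal_bases_insert_eq:
  "rel_internal_bases W A (insert b J) r j = rel_internal_bases W A J r j - {B. rel_active W A (insert b J) r B b}"
proof -
  have "rel_active W A (insert b J) r B b' \<longleftrightarrow> rel_active W A J r B b' \<or> (b' = b \<and> rel_active W A (insert b J) r B b)" for B b'
    by (auto simp: rel_active_def)
  moreover have "rel_active W A (insert b J) r B b \<Longrightarrow> b \<in> B" for B by (auto simp: rel_active_def)
  ultimately show ?thesis unfolding rel_internal_bases_def by blast
qed

text \<open>The linear conditions that cut \<open>kernel_space W A (insert b J) j\<close> out of \<open>kernel_space W A J j\<close> are indexed
by the hyperplanes that contain \<open>J\<close> and avoid \<open>b\<close>. Their ranks are bounded by numbers of bases of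
these hyperplanes, and adjoining \<open>b\<close> embeds all these bases disjointly into the set of bases that
cease to be internal.\<close>

lemma dim_kernel_space_insert:
  assumes fin: "finite A" and W: "subspace W" and A: "annihilator W A = {0}" and ord: "order_on A r"
    and ter: "terminal A r (insert b J)" and bJ: "b \<notin> J" "\<And>z. z \<in> J \<Longrightarrow> (b, z) \<in> r"
    and IH: "card (rel_internal_bases W A J r j) \<le> fn.dim (kernel_space W A J j)"
  shows "card (rel_internal_bases W A (insert b J) r j) \<le> fn.dim (kernel_space W A (insert b J) j)"
proof -
  let ?I = "insert b J"
  define F where "F = {H. J \<subseteq> H \<and> b \<notin> H \<and> (\<exists>\<eta>\<in>hyperplane_normals W A. H = A - cocircuit A \<eta>)}"
  have "\<forall>H\<in>F. \<exists>\<eta>. \<eta> \<in> hyperplane_normals W A \<and> H = A - cocircuit A \<eta>" by (auto simp: F_def)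
  \<comment> \<open>A hyperplane has many proportional normals; one is chosen for each.\<close>
  then obtain e where e: "\<And>H. H \<in> F \<Longrightarrow> e H \<in> hyperplane_normals W A" "\<And>H. H \<in> F \<Longrightarrow> H = A - cocircuit A (e H)" by metis
  have eW: "e H \<in> W" "e H \<noteq> 0" if "H \<in> F" for H using e(1)[OF that] by (auto simp: hyperplane_normals_def)
  have finF: "finite F" using fin by (rule_tac finite_subset[of _ "Pow A"]) (auto simp: F_def)
  define k where "k H = card (cocircuit A (e H)) - 1" for H
  define L where "L H = top_coeff W (e H) (k H)" for H
  define V where "V H = (if k H \<le> j then kernel_space (orth_section W (e H)) H J (j - k H) else {0})" for H
  define \<kappa> where "\<kappa> H = (if k H \<le> j then card (rel_internal_bases (orth_section W (e H)) H J r (j - k H)) else 0)" for H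
  have bA: "b \<in> A" and JA: "J \<subseteq> A" using ter by (auto simp: terminal_def)
  have yb: "(y, b) \<in> r" if "y \<in> A - insert b J" for y using that ter by (auto simp: terminal_def)
  obtain S where S: "finite S" "kernel_space W A J j \<subseteq> fn.span S" using kernel_space_finite_span[OF fin W A] by metis
  have lin: "L H (f + g) = L H f + L H g" "L H (fun_scale c f) = fun_scale c (L H f)"
    if "H \<in> F" "f \<in> kernel_space W A J j" "g \<in> kernel_space W A J j" for H f g c
    unfolding L_def using that kernel_space_D(1) by (auto intro!: top_coeff_linear W eW)
  have rank: "L H ` kernel_space W A J j \<subseteq> V H \<and> fn.dim (V H) \<le> \<kappa> H \<and> (\<exists>T. finite T \<and> V H \<subseteq> fn.span T)"
    if H: "H \<in> F" for H
  proof -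
    have JH: "J \<subseteq> H" using H by (simp add: F_def)
    have HA: "H \<subseteq> A" using e(2)[OF H] by blast
    have JH': "J \<subseteq> A - cocircuit A (e H)" using JH e(2)[OF H] by argo
    have 1: "L H ` kernel_space W A J j \<subseteq> V H"
    proof
      fix g assume "g \<in> L H ` kernel_space W A J j"
      then obtain f where "f \<in> kernel_space W A J j" "g = L H f" by auto
      then show "g \<in> V H"
        using top_coeff_kernel_space[OF fin W A eW[OF H] JH' _ k_def[of H], of f j, folded e(2)[OF H]]
        unfolding L_def V_def by argo
    qed
    have sub: "subspace (orth_section W (e H))" by (rule subspace_orth_section[OF W])
    have "annihilator (orth_section W (e H)) H \<subseteq> {0}"
    proof
      fix \<zeta> assume \<zeta>: "\<zeta> \<in> annihilator (orth_section W (e H)) H"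
      then have "\<zeta> \<in> annihilator W (A - cocircuit A (e H))" using e(2)[OF H] by (auto simp: annihilator_def orth_section_def)
      then obtain c where c: "\<zeta> = c *\<^sub>R e H" using e(1)[OF H] by (auto simp: hyperplane_normals_def)
      have "e H \<bullet> \<zeta> = 0" using \<zeta> by (auto simp: annihilator_def orth_section_def)
      then show "\<zeta> \<in> {0}" using c eW[OF H] by auto
    qed
    then have AH: "annihilator (orth_section W (e H)) H = {0}" using annihilator_0[OF sub] by blast
    have finH: "finite H" using HA fin finite_subset by blast
    have ordH: "order_on H r" using order_on_subset[OF ord HA] .
    have terH: "terminal H r J"
      using ter HA JH H by (auto simp: terminal_def F_def)
    have 2: "fn.dim (V H) \<le> \<kappa> H"
      using dim_kernel_space_upper[OF finH sub AH ordH terH] dim_zero[of "{0}"] by (auto simp: V_def \<kappa>_def)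
    have "\<exists>T. finite T \<and> V H \<subseteq> fn.span T"
    proof (cases "k H \<le> j")
      case True
      then show ?thesis using kernel_space_finite_span[OF finH sub AH] by (auto simp: V_def)
    next
      case False
      then show ?thesis by (intro exI[of _ "{}"]) (auto simp: V_def)
    qed
    then show ?thesis using 1 2 by blast
  qed
  have "fn.dim (kernel_space W A J j) \<le> fn.dim {f \<in> kernel_space W A J j. \<forall>H\<in>F. L H f = 0} + (\<Sum>H\<in>F. \<kappa> H)"
    by (rule fn_pair.dim_le_common_kernel_plus_ranks[OF finF subspace_kernel_space S lin(1) lin(2) rank])
  moreover have "fn.dim {f \<in> kernel_space W A J j. \<forall>H\<in>F. L H f = 0} \<le> fn.dim (kernel_space W A ?I j)"
  proof -
    have "{f \<in> kernel_space W A J j. \<forall>H\<in>F. L H f = 0} \<subseteq> kernel_space W A ?I j"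
    proof safe
      fix f assume f: "f \<in> kernel_space W A J j" and z: "\<forall>H\<in>F. L H f = 0"
      have "dir_degree_less W \<eta> (card (cocircuit A \<eta>) - degree_drop ?I \<eta>) f" if \<eta>: "\<eta> \<in> hyperplane_normals W A" for \<eta>
      proof (cases "degree_drop ?I \<eta> = degree_drop J \<eta>")
        case True
        then show ?thesis using kernel_space_D(3)[OF f \<eta>] by simp
      next
        case False
        then have c: "cocircuit J \<eta> = {}" "v b \<bullet> \<eta> \<noteq> 0" "degree_drop ?I \<eta> = 1"
          by (auto simp: degree_drop_def cocircuit_def split: if_splits)
        let ?H = "A - cocircuit A \<eta>"
        have H: "?H \<in> F" using \<eta> c JA bA by (auto simp: F_def cocircuit_def)
        \<comment> \<open>The bounds for \<open>insert b J\<close> and \<open>J\<close> differ here, so the hyperplane is one of those in \<open>F\<close>.\<close>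
        let ?e = "e ?H"
        have eq: "?H = A - cocircuit A ?e" by (rule e(2)[OF H])
        have ceq: "cocircuit A \<eta> = cocircuit A ?e" using eq by (auto simp: cocircuit_def)
        have "\<eta> \<in> annihilator W (A - cocircuit A ?e)" unfolding ceq[symmetric] using \<eta> by (auto simp: annihilator_def cocircuit_def hyperplane_normals_def)
        then obtain s where s: "\<eta> = s *\<^sub>R ?e" using e(1)[OF H] by (auto simp: hyperplane_normals_def)
        have "degree_drop J ?e = 0" using ceq c(1) JA by (auto simp: degree_drop_def cocircuit_def)
        then have "dir_degree_less W ?e (card (cocircuit A ?e)) f" using kernel_space_D(3)[OF f e(1)[OF H]] by simp
        then have "dir_degree_less W ?e (card (cocircuit A ?e) - 1) f"
          using dir_degree_less_of_top_coeff_zero[OF W eW[OF H] _ kernel_space_D(1)[OF f]] z H by (auto simp: L_def k_def)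
        then have "dir_degree_less W (s *\<^sub>R ?e) (card (cocircuit A ?e) - 1) f" by (rule dir_degree_less_scaled_direction)
        then show ?thesis using s ceq c(3) by metis
      qed
      then show "f \<in> kernel_space W A ?I j" using kernel_space_D[OF f] by (auto simp: kernel_space_def)
    qed
    moreover obtain T where "finite T" "kernel_space W A ?I j \<subseteq> fn.span T" using kernel_space_finite_span[OF fin W A] by metis
    ultimately show ?thesis using fn.dim_mono_in_finite_span by blast
  qed
  moreover have "(\<Sum>H\<in>F. \<kappa> H) \<le> card {B \<in> rel_internal_bases W A J r j. rel_active W A ?I r B b}"
  proof -
    let ?F = "{H \<in> F. k H \<le> j}"
    let ?X = "Sigma ?F (\<lambda>H. rel_internal_bases (orth_section W (e H)) H J r (j - k H))"
    have finX: "finite (rel_internal_bases (orth_section W (e H)) H J r (j - k H))" if "H \<in> ?F" for H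
      using that fin by (intro finite_rel_internal_bases) (auto simp: F_def)
    have bc: "b \<in> cocircuit A (e H)" if "H \<in> F" for H
      using that e(2)[OF that] bA by (auto simp: F_def)
    have bas: "rel_basis (orth_section W (e H)) (A - cocircuit A (e H)) B" 
      if "(H, B) \<in> ?X" for H B using that e(2)[of H] by (auto simp: rel_internal_bases_def)
    have "(\<Sum>H\<in>F. \<kappa> H) = (\<Sum>H\<in>?F. card (rel_internal_bases (orth_section W (e H)) H J r (j - k H)))"
      unfolding \<kappa>_def using finF by (simp add: sum.inter_filter)
    also have "\<dots> = card ?X" using finX finF by (subst card_SigmaI) auto
    also have "\<dots> = card ((\<lambda>(H, B). insert b B) ` ?X)"
    proof (rule card_image[symmetric], rule inj_onI, clarify)
      fix H B H' B'
      assume X: "H \<in> F" "k H \<le> j" "B \<in> rel_internal_bases (orth_section W (e H)) H J r (j - k H)"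
        "H' \<in> F" "k H' \<le> j" "B' \<in> rel_internal_bases (orth_section W (e H')) H' J r (j - k H')" and eq: "insert b B = insert b B'"
      note B = rel_basis_insert_hyperplane[OF W eW[OF X(1)] bc[OF X(1)] bas[of H B]]
      note B' = rel_basis_insert_hyperplane[OF W eW[OF X(4)] bc[OF X(4)] bas[of H' B']]
      have "b \<notin> B" "b \<notin> B'" using B(4) B'(4) X by auto
      then have BB: "B = B'" using eq by (simp add: insert_ident)
      have "e H' \<in> annihilator W B" using B'(3) X BB by auto
      then obtain c where c: "e H' = c *\<^sub>R e H" using B(2) X by auto
      then have "c \<noteq> 0" using eW[OF X(4)] by auto
      then have "cocircuit A (e H') = cocircuit A (e H)" using c by (auto simp: cocircuit_def)
      then show "H = H' \<and> B = B'" using e(2)[OF X(1)] e(2)[OF X(4)] BB by simp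
    qed
    also have "\<dots> \<le> card {B \<in> rel_internal_bases W A J r j. rel_active W A ?I r B b}"
    proof (rule card_mono)
      show "finite {B \<in> rel_internal_bases W A J r j. rel_active W A ?I r B b}" using finite_rel_internal_bases[OF fin] by simp
      show "(\<lambda>(H, B). insert b B) ` ?X \<subseteq> {B \<in> rel_internal_bases W A J r j. rel_active W A ?I r B b}"
      proof clarify
        fix H B assume X: "H \<in> F" "k H \<le> j" "B \<in> rel_internal_bases (orth_section W (e H)) H J r (j - k H)"
        have J: "J \<subseteq> A - cocircuit A (e H)" using X(1) e(2)[OF X(1)] by (auto simp: F_def)
        have B: "B \<in> rel_internal_bases (orth_section W (e H)) (A - cocircuit A (e H)) J r (j - k H)" using X(3) e(2)[OF X(1)] by simp
        show "insert b B \<in> rel_internal_bases W A J r j \<and> rel_active W A ?I r (insert b B) b"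
          using rel_internal_bases_insert_hyperplane[OF W eW[OF X(1)] bc[OF X(1)] fin ord J yb k_def X(2) B] by blast
      qed
    qed
    finally show ?thesis .
  qed
  moreover have "card (rel_internal_bases W A J r j) = card (rel_internal_bases W A ?I r j) + card {B \<in> rel_internal_bases W A J r j. rel_active W A ?I r B b}"
  proof -
    have "rel_internal_bases W A J r j = rel_internal_bases W A ?I r j \<union> {B \<in> rel_internal_bases W A J r j. rel_active W A ?I r B b}"
      "rel_internal_bases W A ?I r j \<inter> {B \<in> rel_internal_bases W A J r j. rel_active W A ?I r B b} = {}"
      unfolding rel_internal_bases_insert_eq by blast+
    then show ?thesis using finite_rel_internal_bases[OF fin] by (metis (no_types, lifting) card_Un_disjoint finite_Un)
  qed
  ultimately show ?thesis using IH by linarith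
qed

text \<open>Elements are adjoined to \<open>I\<close> from the largest downwards, so that the set stays terminal.\<close>

lemma dim_kernel_space_lower:
  assumes fin: "finite A" and W: "subspace W" and A: "annihilator W A = {0}" and ord: "order_on A r"
    and "terminal A r I"
  shows "card (rel_internal_bases W A I r j) \<le> fn.dim (kernel_space W A I j)"
  using assms(5)
proof (induction "card I" arbitrary: I)
  case 0
  then have "I = {}" using finite_subset[OF _ fin, of I] by (auto simp: terminal_def)
  then show ?case using dim_kernel_space_upper[OF fin W A ord 0(2)] by simp
next
  case (Suc n)
  have IA: "I \<subseteq> A" using Suc.prems by (simp add: terminal_def)
  then have "finite I" "I \<noteq> {}" "order_on I r"
    using Suc fin finite_subset order_on_subset[OF ord] by auto
  then obtain b where b: "b \<in> I" "\<And>y. y \<in> I - {b} \<Longrightarrow> (b, y) \<in> r" using order_on_min by metis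
  let ?J = "I - {b}"
  have I: "insert b ?J = I" using b by auto
  have "terminal A r ?J" using Suc.prems b by (auto simp: terminal_def)
  moreover have "n = card ?J" using Suc b \<open>finite I\<close> by simp
  ultimately have "card (rel_internal_bases W A ?J r j) \<le> fn.dim (kernel_space W A ?J j)" using Suc.hyps(1) by blast
  then show ?case using dim_kernel_space_insert[OF fin W A ord, of b ?J j] I Suc.prems b by auto
qed

lemma dim_kernel_space:
  assumes "finite A" "subspace W" "annihilator W A = {0}" "order_on A r" "terminal A r I"
  shows "fn.dim (kernel_space W A I j) = card (rel_internal_bases W A I r j)"
  using dim_kernel_space_upper[OF assms] dim_kernel_space_lower[OF assms] by (simp add: le_antisym)

end

section \<open>Formal polynomials and polynomial functions\<close>

definition monomial_fun :: "('n::finite \<Rightarrow>\<^sub>0 nat) \<Rightarrow> real ^ 'n \<Rightarrow> complex" where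
  "monomial_fun m t = (\<Prod>i\<in>UNIV. complex_of_real (t $ i) ^ Poly_Mapping.lookup m i)"

definition poly_to_fun :: "'n::finite cpoly \<Rightarrow> real ^ 'n \<Rightarrow> complex" where
  "poly_to_fun p = (\<lambda>t. \<Sum>m\<in>Poly_Mapping.keys p. Poly_Mapping.lookup p m * monomial_fun m t)"

lemma monomial_fun_add: "monomial_fun (m + k) t = monomial_fun m t * monomial_fun k t"
  by (simp add: monomial_fun_def lookup_add power_add prod.distrib)

lemma monomial_fun_0 [simp]: "monomial_fun 0 t = 1"
  by (simp add: monomial_fun_def)

lemma poly_to_fun_add: "poly_to_fun (p + q) = poly_to_fun p + poly_to_fun q"
proof
  fix t show "poly_to_fun (p + q) t = (poly_to_fun p + poly_to_fun q) t"
    using setsum_keys_plus_distrib[of "\<lambda>m c. c * monomial_fun m t" p q]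
    by (simp add: poly_to_fun_def distrib_right)
qed

lemma poly_to_fun_0 [simp]: "poly_to_fun 0 = 0"
  by (simp add: poly_to_fun_def fun_eq_iff)

lemma poly_to_fun_sum: "poly_to_fun (\<Sum>x\<in>A. f x) = (\<Sum>x\<in>A. poly_to_fun (f x))"
  by (induction A rule: infinite_finite_induct) (auto simp: poly_to_fun_add)

lemma poly_to_fun_single: "poly_to_fun (Poly_Mapping.single m c) t = c * monomial_fun m t"
  by (simp add: poly_to_fun_def)

lemma poly_mapping_eq_sum_single:
  "p = (\<Sum>m\<in>Poly_Mapping.keys p. Poly_Mapping.single m (Poly_Mapping.lookup p m))"
proof (rule poly_mapping_eqI)
  fix k
  show "Poly_Mapping.lookup p k =
    Poly_Mapping.lookup (\<Sum>m\<in>Poly_Mapping.keys p. Poly_Mapping.single m (Poly_Mapping.lookup p m)) k"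
    by (simp add: lookup_sum lookup_single when_def in_keys_iff)
qed

lemma poly_to_fun_mult: "poly_to_fun (p * q) t = poly_to_fun p t * poly_to_fun q t"
proof -
  have "p * q = (\<Sum>m\<in>Poly_Mapping.keys p. \<Sum>k\<in>Poly_Mapping.keys q. 
      Poly_Mapping.single (m + k) (Poly_Mapping.lookup p m * Poly_Mapping.lookup q k))"
    by (subst poly_mapping_eq_sum_single[of p], subst poly_mapping_eq_sum_single[of q])
       (simp add: sum_product mult_single)
  then have "poly_to_fun (p * q) t = (\<Sum>m\<in>Poly_Mapping.keys p. \<Sum>k\<in>Poly_Mapping.keys q. 
      (Poly_Mapping.lookup p m * Poly_Mapping.lookup q k) * monomial_fun (m + k) t)"
    by (simp add: poly_to_fun_sum poly_to_fun_single sum_fun_at)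
  also have "\<dots> = poly_to_fun p t * poly_to_fun q t"
    by (simp add: poly_to_fun_def sum_product monomial_fun_add mult_ac)
  finally show ?thesis .
qed

lemma poly_to_fun_scale: "poly_to_fun (cpoly_scale c p) = fun_scale c (poly_to_fun p)"
  by (rule ext) (simp add: cpoly_scale_def poly_to_fun_mult poly_to_fun_single fun_scale_def)

lemma poly_to_fun_linear: "Vector_Spaces.linear cpoly_scale fun_scale poly_to_fun"
  by (simp add: Vector_Spaces.linear_iff poly_to_fun_add poly_to_fun_scale cpoly.vector_space_axioms fn.vector_space_axioms)

text \<open>Monomials are distinct multiplicative characters of \<open>\<real>\<^sup>n\<close>, hence linearly independent.\<close>

lemma monomial_fun_independent:
  fixes S :: "('n::finite \<Rightarrow>\<^sub>0 nat) set"
  assumes "finite S" "\<And>t. (\<Sum>m\<in>S. c m * monomial_fun m t) = 0" "m \<in> S"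
  shows "c m = 0"
  using assms
proof (induction S arbitrary: c m rule: finite_induct)
  case (insert m0 S)
  have S0: "c m1 = 0" if m1: "m1 \<in> S" for m1
  proof -
    have "m1 \<noteq> m0" using m1 insert.hyps by auto
    then obtain i where i: "Poly_Mapping.lookup m1 i \<noteq> Poly_Mapping.lookup m0 i"
      by (meson poly_mapping_eqI)
    \<comment> \<open>A point at which the characters of \<open>m1\<close> and \<open>m0\<close> differ.\<close>
    define u :: "real ^ 'n" where "u = (\<chi> k. if k = i then 2 else 1)"
    have u: "monomial_fun m u = 2 ^ Poly_Mapping.lookup m i" for m
    proof -
      have "monomial_fun m u = (\<Prod>k\<in>UNIV. if k = i then 2 ^ Poly_Mapping.lookup m i else 1)"
        unfolding monomial_fun_def u_def by (intro prod.cong) auto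
      then show ?thesis by simp
    qed
    have mult_form: "monomial_fun m (\<chi> k. u $ k * t $ k) = monomial_fun m u * monomial_fun m t" for m t
      by (simp add: monomial_fun_def power_mult_distrib prod.distrib)
    have "(\<Sum>m\<in>S. c m * (monomial_fun m u - monomial_fun m0 u) * monomial_fun m t) = 0" for t
    proof -
      have "(\<Sum>m\<in>insert m0 S. c m * monomial_fun m (\<chi> k. u $ k * t $ k)) 
          - monomial_fun m0 u * (\<Sum>m\<in>insert m0 S. c m * monomial_fun m t) = 0"
        using insert.prems(1) by simp
      moreover have "(\<Sum>m\<in>insert m0 S. c m * monomial_fun m (\<chi> k. u $ k * t $ k)) 
          - monomial_fun m0 u * (\<Sum>m\<in>insert m0 S. c m * monomial_fun m t)
          = (\<Sum>m\<in>insert m0 S. c m * (monomial_fun m u - monomial_fun m0 u) * monomial_fun m t)"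
        unfolding sum_distrib_left sum_subtractf[symmetric] mult_form
        by (intro sum.cong) (auto simp: algebra_simps)
      ultimately show ?thesis using insert.hyps by simp
    qed
    then have "c m1 * (monomial_fun m1 u - monomial_fun m0 u) = 0" 
      using insert.IH[of "\<lambda>m. c m * (monomial_fun m u - monomial_fun m0 u)" m1] m1 by blast
    moreover have "monomial_fun m1 u \<noteq> monomial_fun m0 u"
    proof
      assume "monomial_fun m1 u = monomial_fun m0 u"
      then have "norm ((2::complex) ^ Poly_Mapping.lookup m1 i) = norm ((2::complex) ^ Poly_Mapping.lookup m0 i)"
        unfolding u by simp
      then show False using i by (simp add: norm_power)
    qed
    ultimately show ?thesis by simp
  qed
  have one: "monomial_fun m0 (\<chi> k. 1) = 1" by (simp add: monomial_fun_def)
  have "(\<Sum>m\<in>insert m0 S. c m * monomial_fun m (\<chi> k. 1)) = c m0"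
    using insert.hyps S0 one by simp
  then have "c m0 = 0" using insert.prems(1) by simp
  then show ?case using S0 insert.prems by auto
qed simp

lemma inj_poly_to_fun: "inj poly_to_fun"
proof -
  interpret cf: vector_space_pair cpoly_scale fun_scale by unfold_locales
  have "p = 0" if "poly_to_fun p = 0" for p :: "'n::finite cpoly"
  proof (rule poly_mapping_eqI)
    fix m
    have "(\<Sum>m\<in>Poly_Mapping.keys p. Poly_Mapping.lookup p m * monomial_fun m t) = 0" for t
      using fun_cong[OF that, of t] by (simp add: poly_to_fun_def)
    then show "Poly_Mapping.lookup p m = Poly_Mapping.lookup 0 m"
      using monomial_fun_independent[of "Poly_Mapping.keys p" "Poly_Mapping.lookup p" m]
      by (cases "m \<in> Poly_Mapping.keys p") (auto simp: in_keys_iff)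
  qed
  then show ?thesis using cf.linear_inj_iff_eq_0[OF poly_to_fun_linear] by blast
qed

lemma dim_poly_to_fun_image: "cpoly.dim S = fn.dim (poly_to_fun ` S)"
proof -
  interpret cf: vector_space_pair cpoly_scale fun_scale by unfold_locales
  obtain B where B: "B \<subseteq> S" "cpoly.independent B" "S \<subseteq> cpoly.span B" "card B = cpoly.dim S"
    using cpoly.basis_exists .
  have "fn.dim (poly_to_fun ` S) = card B"
  proof (rule fn.dim_unique)
    show "poly_to_fun ` B \<subseteq> poly_to_fun ` S" using B by auto
    show "poly_to_fun ` S \<subseteq> fn.span (poly_to_fun ` B)" using cf.linear_spans_image[OF poly_to_fun_linear] B by blast
    show "fn.independent (poly_to_fun ` B)"
      using cf.linear_independent_injective_image[OF poly_to_fun_linear B(2)] inj_poly_to_fun inj_on_subset by blast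
    show "card (poly_to_fun ` B) = card B" using inj_poly_to_fun by (intro card_image) (rule inj_on_subset, auto)
  qed
  then show ?thesis using B by simp
qed

lemma poly_to_fun_linear_form: "poly_to_fun (linear_form x) t = complex_of_real (x \<bullet> t)"
proof -
  have "monomial_fun (Poly_Mapping.single i 1) t = complex_of_real (t $ i)" for i
  proof -
    have "monomial_fun (Poly_Mapping.single i 1) t = (\<Prod>k\<in>UNIV. if k = i then complex_of_real (t $ i) else 1)"
      unfolding monomial_fun_def by (intro prod.cong) (auto simp: lookup_single when_def)
    then show ?thesis by simp
  qed
  then show ?thesis
    by (simp add: linear_form_def poly_to_fun_sum sum_fun_at poly_to_fun_single inner_vec_def)
qed

lemma poly_to_fun_prod_form: "poly_to_fun (prod_form v Y) t = (\<Prod>y\<in>Y. complex_of_real (v y \<bullet> t))"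
proof (induction Y rule: infinite_finite_induct)
  case empty
  have "poly_to_fun (Poly_Mapping.single 0 1) t = 1" unfolding poly_to_fun_single by simp
  then show ?case by (simp add: prod_form_def single_one)
next
  case (infinite Y)
  have "poly_to_fun (Poly_Mapping.single 0 1) t = 1" unfolding poly_to_fun_single by simp
  then show ?case using infinite by (simp add: prod_form_def single_one)
next
  case (insert y Y)
  then show ?case by (simp add: prod_form_def poly_to_fun_mult poly_to_fun_linear_form)
qed

lemma poly_to_fun_pf: "poly_to_fun p \<in> polyfun"
proof -
  have pow: "(\<lambda>t. f t ^ k) \<in> polyfun" if "f \<in> polyfun" for f :: "real ^ 'n \<Rightarrow> complex" and k
    by (induction k) (auto intro: polyfun.intros that)
  have "(\<lambda>t :: real ^ 'n. complex_of_real (t $ i)) \<in> polyfun" for i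
    using polyfun.lin[of "axis i 1 :: real ^ 'n"] by (simp add: inner_axis')
  then show ?thesis
    unfolding poly_to_fun_def monomial_fun_def by (intro polyfun_sum polyfun.mult polyfun.const polyfun_prod pow)
qed

lemma poly_to_fun_hom:
  assumes "p \<in> homogeneous_polys j" shows "poly_to_fun p \<in> homogeneous_funs j"
proof -
  have "monomial_fun m (c *\<^sub>R t) = complex_of_real c ^ j * monomial_fun m t" if "m \<in> Poly_Mapping.keys p" for m c t
  proof -
    have "(\<Sum>i\<in>UNIV. Poly_Mapping.lookup m i) = j" using assms that by (simp add: homogeneous_polys_def)
    then show ?thesis by (simp add: monomial_fun_def power_mult_distrib prod.distrib power_sum[symmetric])
  qed
  then show ?thesis
    by (auto simp: homogeneous_funs_def poly_to_fun_def sum_distrib_left intro!: sum.cong)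
qed

lemma subspace_homogeneous_polys: "cpoly.subspace (homogeneous_polys j)"
proof (rule cpoly.subspaceI)
  fix p q :: "'a cpoly" assume "p \<in> homogeneous_polys j" "q \<in> homogeneous_polys j"
  then show "p + q \<in> homogeneous_polys j"
    using keys_add[of p q] by (fastforce simp: homogeneous_polys_def)
next
  fix c and p :: "'a cpoly" assume "p \<in> homogeneous_polys j"
  then show "cpoly_scale c p \<in> homogeneous_polys j"
    using keys_mult[of "Poly_Mapping.single 0 c" p]
    by (fastforce simp: homogeneous_polys_def cpoly_scale_def split: if_splits)
qed (simp add: homogeneous_polys_def)

lemma homogeneous_mult:
  assumes "p \<in> homogeneous_polys i" "q \<in> homogeneous_polys j"
  shows "p * q \<in> homogeneous_polys (i + j)"
  using keys_mult[of p q] assms by (fastforce simp: homogeneous_polys_def lookup_add sum.distrib)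

lemma homogeneous_linear_form: "linear_form x \<in> homogeneous_polys 1"
  unfolding linear_form_def
  by (intro cpoly.subspace_sum subspace_homogeneous_polys)
     (auto simp: homogeneous_polys_def lookup_single when_def)

lemma homogeneous_prod_form: "finite Y \<Longrightarrow> prod_form v Y \<in> homogeneous_polys (card Y)"
proof (induction Y rule: finite_induct)
  case empty
  then show ?case by (simp add: prod_form_def homogeneous_polys_def)
next
  case (insert y Y)
  then show ?case using homogeneous_mult[OF homogeneous_linear_form[of "v y"]] by (simp add: prod_form_def)
qed

section \<open>The theorem\<close>

lemma restrict_to_UNIV [simp]: "restrict_to UNIV f = f"
  by (simp add: restrict_to_def)

context
  fixes v :: "'i \<Rightarrow> real ^ 'n"
begin

interpretation vector_family v .

lemma closure_in_UNIV_iff: "y \<in> closure_in UNIV S \<longleftrightarrow> v y \<in> span (v ` S)"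
proof
  assume "v y \<in> span (v ` S)"
  then have "\<eta> \<bullet> v y = 0" if "\<eta> \<in> annihilator UNIV S" for \<eta>
    using that by (induction rule: span_induct_alt) (auto simp: annihilator_def inner_add_right inner_commute)
  then show "y \<in> closure_in UNIV S" by (auto simp: closure_in_def inner_commute)
next
  assume y: "y \<in> closure_in UNIV S"
  obtain a z where az: "a \<in> span (v ` S)" "\<And>w. w \<in> span (v ` S) \<Longrightarrow> orthogonal z w" "v y = a + z"
    using orthogonal_subspace_decomp_exists[of "v ` S" "v y"] by metis
  have "v s \<bullet> z = 0" if "s \<in> S" for s
    using az(2)[of "v s"] that span_base[of "v s" "v ` S"] by (simp add: orthogonal_def inner_commute)
  then have "z \<in> annihilator UNIV S" by (simp add: annihilator_def)
  then have "v y \<bullet> z = 0" using y by (auto simp: closure_in_def)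
  moreover have "a \<bullet> z = 0" using az(1,2) by (metis inner_commute orthogonal_def)
  ultimately have "z = 0" using az(3) by (simp add: inner_add_left)
  then show "v y \<in> span (v ` S)" using az by simp
qed

lemma annihilator_UNIV_iff: "annihilator UNIV S = {0} \<longleftrightarrow> span (v ` S) = UNIV"
proof
  assume A: "annihilator UNIV S = {0}"
  show "span (v ` S) = UNIV"
  proof (rule ccontr)
    assume "span (v ` S) \<noteq> UNIV"
    then obtain a where a: "a \<noteq> 0" "\<And>x. x \<in> span (v ` S) \<Longrightarrow> a \<bullet> x = 0"
      using span_not_UNIV_orthogonal by blast
    have "v s \<bullet> a = 0" if "s \<in> S" for s
      using a(2)[of "v s"] that span_base[of "v s" "v ` S"] by (simp add: inner_commute)
    then have "a \<in> annihilator UNIV S" by (simp add: annihilator_def)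
    then show False using A a by auto
  qed
next
  assume S: "span (v ` S) = UNIV"
  have "\<eta> = 0" if \<eta>: "\<eta> \<in> annihilator UNIV S" for \<eta>
  proof -
    have "\<eta> \<bullet> x = 0" if "x \<in> span (v ` S)" for x
      using that \<eta> by (induction rule: span_induct_alt) (auto simp: annihilator_def inner_add_right inner_commute)
    then show ?thesis using S by (metis UNIV_I inner_eq_zero_iff)
  qed
  then show "annihilator UNIV S = {0}" by (auto simp: annihilator_def)
qed

lemma bases_iff: "B \<in> bases v X \<longleftrightarrow> rel_basis UNIV X B"
proof
  assume B: "B \<in> bases v X"
  then have *: "B \<subseteq> X" "inj_on v B" "independent (v ` B)" "span (v ` B) = UNIV"
    by (auto simp: bases_def indep_subsets_def)
  have "span (v ` (B - {b})) \<noteq> UNIV" if b: "b \<in> B" for b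
  proof
    assume "span (v ` (B - {b})) = UNIV"
    moreover have "v ` (B - {b}) = v ` B - {v b}" using *(2) b by (auto simp: inj_on_def)
    ultimately show False using *(3) b unfolding dependent_def by auto
  qed
  then show "rel_basis UNIV X B" using * unfolding rel_basis_def annihilator_UNIV_iff by blast
next
  assume "rel_basis UNIV X B"
  then have B: "B \<subseteq> X" "span (v ` B) = UNIV" "\<And>b. b \<in> B \<Longrightarrow> span (v ` (B - {b})) \<noteq> UNIV"
    unfolding rel_basis_def annihilator_UNIV_iff by auto
  have nb: "v b \<notin> span (v ` (B - {b}))" if b: "b \<in> B" for b
  proof
    assume "v b \<in> span (v ` (B - {b}))"
    then have "span (insert (v b) (v ` (B - {b}))) = span (v ` (B - {b}))" by (rule span_redundant)
    moreover have "insert (v b) (v ` (B - {b})) = v ` B" using b by auto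
    ultimately show False using B(2) B(3)[OF b] by argo
  qed
  have "inj_on v B"
  proof (rule inj_onI, rule ccontr)
    fix b c assume "b \<in> B" "c \<in> B" "v b = v c" "b \<noteq> c"
    then have "v b \<in> v ` (B - {b})" by auto
    then have "v b \<in> span (v ` (B - {b}))" by (rule span_base)
    then show False using nb[OF \<open>b \<in> B\<close>] by contradiction
  qed
  moreover have "independent (v ` B)"
    unfolding dependent_def
  proof safe
    fix b assume b: "b \<in> B" "v b \<in> span (v ` B - {v b})"
    have "v ` B - {v b} \<subseteq> v ` (B - {b})" by auto
    then have "span (v ` B - {v b}) \<subseteq> span (v ` (B - {b}))" by (rule span_mono)
    then show False using nb[OF b(1)] b(2) by blast
  qed
  ultimately show "B \<in> bases v X" using B by (auto simp: bases_def indep_subsets_def)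
qed

lemma internal_bases_eq: "{B \<in> internal_bases v X r I. valuation v X r B = j} = rel_internal_bases UNIV X I r j"
proof -
  have rel_active: "internally_active v X r I B b \<longleftrightarrow> rel_active UNIV X I r B b" if B: "rel_basis UNIV X B" and b: "b \<in> B" for B b
  proof -
    have "b \<notin> closure_in UNIV (B - {b})"
    proof
      assume "b \<in> closure_in UNIV (B - {b})"
      then have "annihilator UNIV (B - {b}) \<subseteq> annihilator UNIV B" by (auto simp: closure_in_def annihilator_def)
      then show False using B b by (auto simp: rel_basis_def annihilator_def)
    qed
    moreover have "b \<in> X" using B b by (auto simp: rel_basis_def)
    ultimately show ?thesis
      unfolding internally_active_def rel_active_def Let_def closure_in_UNIV_iff by blast
  qed
  have "valuation v X r B = rel_valuation UNIV X r B" for B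
    unfolding valuation_def rel_valuation_def closure_in_UNIV_iff ..
  then show ?thesis using rel_active unfolding rel_internal_bases_def internal_bases_def bases_iff by auto
qed

lemma rank_full_iff: "dim (v ` S) = CARD('n) \<longleftrightarrow> annihilator UNIV S = {0}"
  unfolding annihilator_UNIV_iff using dim_eq_full[of "v ` S"] by simp

lemma poly_to_fun_prod_form_eq: "poly_to_fun (prod_form v Y) = form_prod UNIV Y"
  by (rule ext) (simp add: poly_to_fun_prod_form form_prod_def)

lemma graded_central_subset_poly_to_fun_image:
  assumes "finite A"
  shows "graded_central UNIV A j \<subseteq> poly_to_fun ` (central_space v A \<inter> homogeneous_polys j)"
proof -
  interpret cf: vector_space_pair cpoly_scale fun_scale by unfold_locales
  let ?G = "{prod_form v Y | Y. Y \<subseteq> A \<and> card Y = j \<and> annihilator UNIV (A - Y) = {0}}"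
  have "{form_prod UNIV Y | Y. Y \<subseteq> A \<and> card Y = j \<and> annihilator UNIV (A - Y) = {0}} = poly_to_fun ` ?G"
    by (auto simp: poly_to_fun_prod_form_eq[symmetric])
  then have "graded_central UNIV A j = poly_to_fun ` cpoly.span ?G"
    unfolding graded_central_def by (simp only: cf.linear_span_image[OF poly_to_fun_linear])
  moreover have "cpoly.span ?G \<subseteq> central_space v A"
    unfolding central_space_def rank_full_iff by (rule cpoly.span_mono) auto
  moreover have "cpoly.span ?G \<subseteq> homogeneous_polys j"
  proof (rule cpoly.span_minimal[OF _ subspace_homogeneous_polys], safe)
    fix Y assume "Y \<subseteq> A"
    then show "prod_form v Y \<in> homogeneous_polys (card Y)"
      using homogeneous_prod_form finite_subset[OF _ assms] by blast
  qed
  ultimately show ?thesis by blast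
qed

lemma central_space_dir_degree_less:
  assumes "finite A" "p \<in> central_space v A" "\<eta> \<noteq> 0"
  shows "dir_degree_less UNIV \<eta> (card (cocircuit A \<eta>)) (poly_to_fun p)"
proof -
  interpret cf: vector_space_pair cpoly_scale fun_scale by unfold_locales
  have "dir_degree_less UNIV \<eta> (card (cocircuit A \<eta>)) (poly_to_fun (prod_form v Y))" if Y: "Y \<subseteq> A" "annihilator UNIV (A - Y) = {0}" for Y
  proof -
    have "form_prod UNIV Y \<in> graded_central UNIV A (card Y)" unfolding graded_central_def using Y by (intro fn.span_base) auto
    then show ?thesis unfolding poly_to_fun_prod_form_eq using graded_central_dir_degree_less[OF assms(1) _ _ assms(3)] by auto
  qed
  then have "central_space v A \<subseteq> {p. poly_to_fun p \<in> {f. dir_degree_less UNIV \<eta> (card (cocircuit A \<eta>)) f}}"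
    unfolding central_space_def rank_full_iff
    by (intro cpoly.span_minimal cf.linear_subspace_linear_preimage[OF poly_to_fun_linear] subspace_dir_degree_less) auto
  then show ?thesis using assms by auto
qed

lemma poly_to_fun_semi_internal_space:
  assumes "finite X" "I \<subseteq> X" "annihilator UNIV X = {0}"
  shows "poly_to_fun ` (semi_internal_space v X I \<inter> homogeneous_polys j) = kernel_space UNIV X I j"
proof
  show "poly_to_fun ` (semi_internal_space v X I \<inter> homogeneous_polys j) \<subseteq> kernel_space UNIV X I j"
  proof safe
    fix p assume p: "p \<in> semi_internal_space v X I" "p \<in> homogeneous_polys j"
    have b: "dir_degree_less UNIV \<eta> (card (cocircuit (X - {b}) \<eta>)) (poly_to_fun p)" if "b \<in> I" "\<eta> \<noteq> 0" for b \<eta>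
      using p(1) that assms(1) by (intro central_space_dir_degree_less) (auto simp: semi_internal_space_def split: if_splits)
    have "dir_degree_less UNIV \<eta> (card (cocircuit X \<eta>)) (poly_to_fun p)" if \<eta>: "\<eta> \<noteq> 0" for \<eta>
    proof (cases "I = {}")
      case True
      then show ?thesis using p(1) \<eta> assms(1) by (intro central_space_dir_degree_less) (auto simp: semi_internal_space_def)
    next
      case False
      then obtain b' where b': "b' \<in> I" by auto
      have "card (cocircuit (X - {b'}) \<eta>) \<le> card (cocircuit X \<eta>)"
        using assms(1) by (intro card_mono) (auto simp: cocircuit_def)
      then show ?thesis using b[OF b' \<eta>] dir_degree_less_mono by blast
    qed
    moreover have "poly_to_fun p \<in> polyfun_on UNIV" using poly_to_fun_pf[of p] by (force simp: polyfun_on_def)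
    ultimately show "poly_to_fun p \<in> kernel_space UNIV X I j"
      using b poly_to_fun_hom[OF p(2)] assms by (intro in_kernel_space_of_dir_degree_less_remove) auto
  qed
  show "kernel_space UNIV X I j \<subseteq> poly_to_fun ` (semi_internal_space v X I \<inter> homogeneous_polys j)"
  proof
    fix f assume f: "f \<in> kernel_space UNIV X I j"
    show "f \<in> poly_to_fun ` (semi_internal_space v X I \<inter> homogeneous_polys j)"
    proof (cases "I = {}")
      case True
      then have "f \<in> graded_central UNIV X j" using kernel_space_subset_graded_central[OF assms(1) subspace_UNIV assms(3)] f by auto
      then show ?thesis using graded_central_subset_poly_to_fun_image[OF assms(1)] True by (auto simp: semi_internal_space_def)
    next
      case False
      have "\<exists>p\<in>central_space v (X - {b}) \<inter> homogeneous_polys j. f = poly_to_fun p" if b: "b \<in> I" for b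
      proof -
        have "f \<in> graded_central UNIV (X - {b}) j"
          using kernel_space_subset_graded_central_remove[OF assms(1) subspace_UNIV assms(3) _ b f] b assms(2) by auto
        then show ?thesis using graded_central_subset_poly_to_fun_image[of "X - {b}" j] assms(1) by blast
      qed
      then obtain q where q: "\<And>b. b \<in> I \<Longrightarrow> q b \<in> central_space v (X - {b}) \<inter> homogeneous_polys j"
        "\<And>b. b \<in> I \<Longrightarrow> f = poly_to_fun (q b)" by metis
      obtain b0 where b0: "b0 \<in> I" using False by auto
      have eq: "q b = q b0" if "b \<in> I" for b using q(2)[OF that] q(2)[OF b0] inj_poly_to_fun by (metis injD)
      have "q b0 \<in> central_space v (X - {b})" if "b \<in> I" for b
        using q(1)[OF that] eq[OF that] by simp
      then have "q b0 \<in> semi_internal_space v X I \<inter> homogeneous_polys j"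
        using q(1)[OF b0] False by (simp add: semi_internal_space_def) 
      then show ?thesis using q(2)[OF b0] by blast
    qed
  qed
qed

end

theorem mainTheorem5:
  fixes v :: "'i \<Rightarrow> real ^ 'n" and X I :: "'i set" and r :: "('i \<times> 'i) set" and j :: nat
  assumes "finite X"
    and "\<And>x. x \<in> X \<Longrightarrow> v x \<noteq> 0"
    and "span (v ` X) = UNIV"
    and "I \<in> indep_subsets v X"
    and "strict_linear_order_on X r"
    and "\<And>x y. x \<in> X - I \<Longrightarrow> y \<in> I \<Longrightarrow> (x, y) \<in> r"
  shows "cpoly.dim (semi_internal_space v X I \<inter> homogeneous_polys j)
       = card {B \<in> internal_bases v X r I. valuation v X r B = j}"
proof -
  interpret vector_family v .
  have I: "I \<subseteq> X" using assms(4) by (simp add: indep_subsets_def)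
  have A: "annihilator UNIV X = {0}" using assms(3) annihilator_UNIV_iff by blast
  have "order_on X r" using assms(5) by (simp add: order_on_def strict_linear_order_on_def)
  moreover have "terminal X r I" using I assms(6) by (simp add: terminal_def)
  ultimately have "fn.dim (kernel_space UNIV X I j) = card (rel_internal_bases UNIV X I r j)"
    by (rule dim_kernel_space[OF assms(1) subspace_UNIV A])
  then show ?thesis
    unfolding dim_poly_to_fun_image poly_to_fun_semi_internal_space[OF assms(1) I A] internal_bases_eq .
qed

end
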